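(* Let $k$ be a perfect field of characteristic not $2$ or $3$. Let $f=f_1f_3^3f_5^5$ where $f_1,f_3,f_5\in k[t]$ are pairwise coprime, separable polynomials and $f_1$ is nonconstant. Let $d=\deg f$ and assume $2\nmid d$. Let $\omega_3$ be the number of irreducible factors of $f_3$ in $k[t]$, and let $\zeta_3\in\bar k$ be a primitive third root of unity. Let $E: y^2=x^3+f(t)$ and $E': y^2=x^3-27f(t)$ over $k(t)$, with the $3$-isogenies $\lambda:E\to E'$, $\lambda^t:E'\to E$ described in the context. Consider the natural map $$E(k[t])\to E(k(t))/\lambda^t E'(k(t)).$$ (i) When restricted to $E(k[t])_{< d/4}$, this map is at most $2^{\omega_3}$-to-$1$ (resp. $(3\cdot 2^{\omega_3})$-to-$1$) onto its image if $\zeta_3\notin k$ (resp. if $\zeta_3\in k$), and omits $0$. In particular, $$\#E(k[t])_{< d/4} \leq \begin{cases} 2^{\omega_3}\left(3^{\operatorname{rk}_{\mathbb{Z}} E(k(t))}-1\right) & \text{if } \zeta_3\notin k, \\ 2^{\omega_3}\left(3^{\frac{1}{2}\operatorname{rk}_{\mathbb{Z}} E(k(t))+1}-3\right) & \text{if } \zeta_3\in k. \end{cases}$$ (ii) When restricted to $E(k[t])_{d/4\leq \cdot < d/2}$ or to $E(k[t])_{\geq d/2}$, it is at most $2^{\omega_3}$-to-$1$ (resp. $(3\cdot 2^{\omega_3})$-to-$1$) onto its image if $\zeta_3\notin k$ (resp. if $\zeta_3\in k$). In particular, $$\# E(k[t])_{\geq d/4} \leq \begin{cases} 2^{\omega_3+1}\cdot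 3^{\operatorname{rk}_{\mathbb{Z}} E(k(t))} & \text{if } \zeta_3\notin k, \\ 2^{\omega_3+1}\cdot 3^{\frac{1}{2}\operatorname{rk}_{\mathbb{Z}} E(k(t))+1} & \text{if } \zeta_3\in k. \end{cases}$$ (iii) The set $E(k[t])$ of all integral points on $E$ satisfies $$\#E(k[t])\leq \begin{cases} 2^{\omega_3}\cdot \left(3^{\operatorname{rk}_{\mathbb{Z}} E(k(t))+1}-1\right) & \text{if } \zeta_3\notin k, \\ 2^{\omega_3}\cdot \left(3^{\frac{1}{2}\operatorname{rk}_{\mathbb{Z}} E(k(t))+2} -3\right) & \text{if } \zeta_3\in k. \end{cases}$$
   Context: $E(k[t])=\{(x,y)\in E(k(t))\mid x,y\in k[t]\}$ (point at infinity excluded). For $P=(x,y)\in E(k[t])$, the naive height is $h(P)=\max\{\frac12\deg x,\frac13\deg y\}$; $E(k[t])_{<n}=\{P\in E(k[t])\mid h(P)<n\}$, $E(k[t])_{m\le\cdot<n}=\{P\in E(k[t])\mid m\le h(P)<n\}$, and similarly for $E(k[t])_{\ge n}$. The isogeny $\lambda:E\to E'$ is the $3$-isogeny $$(x,y)\mapsto\left(\frac{x^3+4f}{x^2},\frac{y(x^3-8f)}{x^3}\right),$$ whose kernel is the point at infinity together with the points with $x=0$; $\lambda^t:E'\to E$ is its dual isogeny. "At most $m$-to-$1$" means every fibre has at most $m$ elements; "omits $0$" means $0$ is not in the image. *)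

theory Defs
  imports
    "HOL-Computational_Algebra.Computational_Algebra"
    "HOL-Algebra.Algebraic_Closure_Type"
    "HOL-Library.Extended_Real"
begin

section \<open>Separable polynomials and perfect fields\<close>

text \<open>Separable means: no repeated root in the algebraic closure.\<close>

definition separable :: "'k::field poly \<Rightarrow> bool" where
  "separable p \<longleftrightarrow> rsquarefree (map_poly to_ac p)"

definition perfect_field :: "'k::field itself \<Rightarrow> bool" where
  "perfect_field _ \<longleftrightarrow> (\<forall>p::'k poly. Factorial_Ring.irreducible p \<longrightarrow> separable p)"

text \<open>The irreducible factors are counted up to units, hence the monic representatives.\<close>

definition num_irreducible_factors :: "'k::field poly \<Rightarrow> nat" where
  "num_irreducible_factors p =
     card {q. Factorial_Ring.irreducible q \<and> lead_coeff q = 1 \<and> q dvd p}"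


section \<open>The curves \<open>y\<^sup>2 = x\<^sup>3 + b\<close>\<close>

datatype 'a point = Infinity | Affine 'a 'a

definition on_curve :: "'a::field \<Rightarrow> 'a point \<Rightarrow> bool" where
  "on_curve b P \<longleftrightarrow> (case P of Infinity \<Rightarrow> True | Affine x y \<Rightarrow> y^2 = x^3 + b)"

text \<open>The chord-tangent law. Since the coefficient of \<open>x\<close> vanishes, the tangent
  at \<open>(x, y)\<close> has slope \<open>3x\<^sup>2/(2y)\<close>, and the formulas do not mention \<open>b\<close>.\<close>

fun point_add :: "'a::field point \<Rightarrow> 'a point \<Rightarrow> 'a point" where
  "point_add Infinity Q = Q"
| "point_add P Infinity = P"
| "point_add (Affine x1 y1) (Affine x2 y2) =
     (if x1 = x2 \<and> y1 = - y2 then Infinity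
      else
        let m = (if x1 = x2 then 3 * x1^2 / (2 * y1) else (y2 - y1) / (x2 - x1));
            x3 = m^2 - x1 - x2
        in Affine x3 (m * (x1 - x3) - y1))"

definition curve_group :: "'a::field \<Rightarrow> 'a point monoid" where
  "curve_group b =
     \<lparr>carrier = {P. on_curve b P}, monoid.mult = point_add, one = Infinity\<rparr>"

text \<open>The \<open>3\<close>-isogeny from \<open>y\<^sup>2 = x\<^sup>3 + b\<close> to \<open>y\<^sup>2 = x\<^sup>3 - 27b\<close>.\<close>

fun isog :: "'a::field \<Rightarrow> 'a point \<Rightarrow> 'a point" where
  "isog b Infinity = Infinity"
| "isog b (Affine x y) =
     (if x = 0 then Infinity
      else Affine ((x^3 + 4 * b) / x^2) (y * (x^3 - 8 * b) / x^3))"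

text \<open>The dual isogeny from \<open>y\<^sup>2 = x\<^sup>3 - 27b\<close> to \<open>y\<^sup>2 = x\<^sup>3 + b\<close>: the
  \<open>3\<close>-isogeny \<open>isog (-27b)\<close> from \<open>y\<^sup>2 = x\<^sup>3 - 27b\<close> to \<open>y\<^sup>2 = x\<^sup>3 + 729b\<close>, followed
  by the isomorphism \<open>(x, y) \<mapsto> (x/9, y/27)\<close>. The lemmas \<open>dual_isog_isog\<close> and
  \<open>isog_dual_isog\<close> below confirm that both composites are multiplication by \<open>3\<close>
  (and not by \<open>-3\<close>).\<close>

definition dual_isog :: "'a::field \<Rightarrow> 'a point \<Rightarrow> 'a point" where
  "dual_isog b P =
     (case isog (- 27 * b) P of
        Infinity \<Rightarrow> Infinity
      | Affine x y \<Rightarrow> Affine (x / 9) (y / 27))"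

lemma on_curve_isog:
  assumes "on_curve b P"
  shows "on_curve (- 27 * b) (isog b P)"
proof (cases P)
  case (Affine x y)
  show ?thesis
  proof (cases "x = 0")
    case False
    have y: "y^2 = x^3 + b" using assms Affine by (simp add: on_curve_def)
    have "(y * (x^3 - 8 * b))^2 = (x^3 + 4 * b)^3 - 27 * b * x^6"
      unfolding power_mult_distrib y by (simp add: eval_nat_numeral algebra_simps)
    then have "(y * (x^3 - 8 * b) / x^3)^2 = ((x^3 + 4 * b) / x^2)^3 + - 27 * b"
      using False by (simp add: field_simps power_divide flip: power_mult)
    then show ?thesis using Affine False by (simp add: on_curve_def)
  qed (simp add: Affine on_curve_def)
qed (simp add: on_curve_def)

lemma dual_isog_isog:
  fixes b :: "'a::field"
  assumes "on_curve b P" and two: "(2::'a) \<noteq> 0" and three: "(3::'a) \<noteq> 0" and b: "b \<noteq> 0"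
  shows "dual_isog b (isog b P) = point_add P (point_add P P)"
proof (cases P)
  case Infinity
  then show ?thesis by (simp add: dual_isog_def)
next
  case (Affine x y)
  have y: "y^2 = x^3 + b" using assms Affine by (simp add: on_curve_def)
  have y': "b = y^2 - x^3" using y by simp
  have nz: "(4::'a) \<noteq> 0" "(9::'a) \<noteq> 0" "(27::'a) \<noteq> 0" "(81::'a) \<noteq> 0"
  proof -
    have "(4::'a) = 2 * 2" "(9::'a) = 3 * 3" "(27::'a) = 3 * 3 * 3" "(81::'a) = 3 * 3 * 3 * 3" by simp_all
    then show "(4::'a) \<noteq> 0" "(9::'a) \<noteq> 0" "(27::'a) \<noteq> 0" "(81::'a) \<noteq> 0"
      using two three by (metis mult_eq_0_iff)+
  qed
  have six: "(6::'a) \<noteq> 0"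
  proof -
    have "(6::'a) = 2 * 3" by simp
    then show ?thesis using two three by (metis mult_eq_0_iff)
  qed
  have neg: "z \<noteq> - z" if "z \<noteq> 0" for z :: 'a
  proof
    assume "z = - z"
    then have "z + z = 0" by (simp add: eq_neg_iff_add_eq_0)
    then have "2 * z = 0" by (simp only: mult_2)
    then show False using two that by simp
  qed
  define s t where "s = (x^3 + 4 * b) / x^2" and "t = y * (x^3 - 8 * b) / x^3"
  consider "x = 0" | "x \<noteq> 0" "y = 0" | "x \<noteq> 0" "y \<noteq> 0" "x^3 + 4 * b = 0"
    | "x \<noteq> 0" "y \<noteq> 0" "x^3 + 4 * b \<noteq> 0" by blast
  then show ?thesis
  proof cases
    case 1
    then have "y \<noteq> 0" using y b by auto
    then show ?thesis using 1 Affine neg[of y] by (simp add: dual_isog_def Let_def)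
  next
    case 2
    then have xb: "b = - (x^3)" using y by (simp add: eq_neg_iff_add_eq_0 add.commute)
    have s: "s = - 3 * x"
      unfolding s_def xb using 2 by (simp add: field_simps power3_eq_cube power2_eq_square)
    have t: "t = 0" unfolding t_def using 2 by simp
    have "((- 3 * x)^3 + 4 * (- 27 * b)) / (- 3 * x)^2 / 9 = x"
      unfolding xb using 2 three nz by (simp add: field_simps power3_eq_cube power2_eq_square)
    then show ?thesis
      using 2 Affine s t three by (simp add: dual_isog_def s_def t_def)
  next
    case 3
    define m where "m = 3 * x^2 / (2 * y)"
    have m: "m * (2 * y) = 3 * x^2" unfolding m_def using 3 two by simp
    have "4 * y^2 = 3 * x^3 + (x^3 + 4 * b)" unfolding y by (simp add: algebra_simps)
    then have "3 * x^3 * m^2 = (m * (2 * y))^2"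
      using 3(3) by (simp add: power_mult_distrib mult.commute)
    also have "\<dots> = 3 * x^3 * (3 * x)"
      unfolding m by (simp add: eval_nat_numeral algebra_simps)
    finally have "3 * x^3 * m^2 = 3 * x^3 * (3 * x)" .
    moreover have "3 * x^3 \<noteq> 0" using 3 three by simp
    ultimately have m2: "m^2 = 3 * x" using mult_left_cancel by blast
    have s: "s = 0" unfolding s_def using 3 by simp
    have "point_add P P = Affine x (- y)"
      using Affine neg[OF 3(2)] m2 by (simp add: m_def[symmetric] Let_def)
    then show ?thesis
      using Affine 3 s by (simp add: dual_isog_def s_def)
  next
    case 4
    define m where "m = 3 * x^2 / (2 * y)"
    have m: "m * (2 * y) = 3 * x^2" unfolding m_def using 4 two by simp
    define u where "u = m^2 - x - x"
    define v where "v = m * (x - u) - y"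
    have PP: "point_add P P = Affine u v"
      using Affine neg[OF 4(2)] by (simp add: m_def[symmetric] Let_def u_def v_def)
    have ux: "(u - x) * (4 * y^2) = - 3 * x * (x^3 + 4 * b)"
    proof -
      have "(u - x) * (4 * y^2) = (m * (2 * y))^2 - 12 * x * y^2"
        unfolding u_def by (simp add: power2_eq_square algebra_simps)
      also have "\<dots> = - 3 * x * (x^3 + 4 * b)"
        unfolding m y by (simp add: eval_nat_numeral algebra_simps)
      finally show ?thesis .
    qed
    then have ux0: "u - x \<noteq> 0" using 4 three by auto
    define n where "n = (v - y) / (u - x)"
    have n: "n * (u - x) = v - y" unfolding n_def using ux0 by simp
    have PPP: "point_add P (point_add P P) =
        Affine (n^2 - x - u) (n * (x - (n^2 - x - u)) - y)"
      using Affine PP ux0 by (simp add: n_def Let_def minus_divide_left divide_simps)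
    have s: "s * x^2 = x^3 + 4 * b" unfolding s_def using 4 by simp
    have s0: "s \<noteq> 0" unfolding s_def using 4 by simp
    have t: "t * x^3 = y * (x^3 - 8 * b)" unfolding t_def using 4 by simp
    define p where "p = (s^3 + 4 * (- 27 * b)) / s^2 / 9"
    define q where "q = t * (s^3 - 8 * (- 27 * b)) / s^3 / 27"
    have p: "p * (9 * s^2) = s^3 - 108 * b" unfolding p_def using s0 nz by simp
    have q: "q * (27 * s^3) = t * (s^3 + 216 * b)" unfolding q_def using s0 nz by simp
    have dual: "dual_isog b (isog b P) = Affine p q"
      using Affine 4 s0 by (simp add: dual_isog_def s_def t_def p_def q_def)
    define D where "D = x^3 + 4 * b"
    have D: "D = 4 * y^2 - 3 * x^3" unfolding D_def y' by simp
    have D0: "D \<noteq> 0" using 4 D_def by simp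
    define k where "k = n + m"
    have vy: "v - y = - m * (u - x) - 2 * y" unfolding v_def by (simp add: algebra_simps)
    have "k * (u - x) = - 2 * y" unfolding k_def using n vy by (simp add: algebra_simps)
    then have "k * ((u - x) * (4 * y^2)) = - 2 * y * (4 * y^2)"
      by (metis mult.assoc)
    then have k: "k * (3 * x * D) = 8 * y^3"
      unfolding ux D_def[symmetric] by (simp add: power2_eq_square power3_eq_cube algebra_simps)
    have "(6 * x * y) * (k * m * D) = (k * (3 * x * D)) * (m * (2 * y))"
      by (simp add: algebra_simps)
    also have "\<dots> = (6 * x * y) * (4 * x * y^2)"
      unfolding k m by (simp add: power2_eq_square power3_eq_cube algebra_simps)
    finally have km: "k * m * D = 4 * x * y^2"
      using mult_left_cancel[of "6 * x * y"] 4 D0 two six nz by (metis mult_eq_0_iff power_not_zero)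
    have "(2 * y) * (k * m^2 * D) = (k * m * D) * (m * (2 * y))"
      by (simp add: power2_eq_square algebra_simps)
    also have "\<dots> = (2 * y) * (6 * x^3 * y)"
      unfolding km m by (simp add: power2_eq_square power3_eq_cube algebra_simps)
    finally have kmm: "k * m^2 * D = 6 * x^3 * y"
      using mult_left_cancel[of "2 * y"] 4 D0 two six nz by (metis mult_eq_0_iff power_not_zero)
    have "x * (3 * D^2 * (k^2 * m)) = (k * m * D) * (k * (3 * x * D))"
      by (simp add: power2_eq_square algebra_simps)
    also have "\<dots> = x * (32 * y^5)"
      unfolding km k by (simp add: eval_nat_numeral algebra_simps)
    finally have kkm: "3 * D^2 * (k^2 * m) = 32 * y^5" using 4 by simp
    have kk: "9 * x^2 * D^2 * k^2 = 64 * y^6"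
      using arg_cong[OF k, of "\<lambda>z. z^2"] by (simp add: power_mult_distrib algebra_simps flip: power_mult)
    have kkk: "27 * x^3 * D^3 * k^3 = 512 * y^9"
      using arg_cong[OF k, of "\<lambda>z. z^3"] by (simp add: power_mult_distrib algebra_simps flip: power_mult)
    define X3 where "X3 = n^2 - x - u"
    have X3: "X3 = k^2 - 2 * (k * m) + x"
      unfolding X3_def k_def u_def by (simp add: power2_eq_square algebra_simps)
    define Y3 where "Y3 = n * (x - X3) - y"
    have Y3: "Y3 = - (k^3 - 3 * (k^2 * m) + 2 * (k * m^2)) - y"
    proof -
      have nk: "n = k - m" by (simp add: k_def)
      show ?thesis
        unfolding Y3_def X3 nk by (simp add: power2_eq_square power3_eq_cube algebra_simps)
    qed
    have sD: "s * x^2 = D" using s D_def by simp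
    have "9 * x^2 * D^2 * p = x^6 * (p * (9 * s^2))"
      unfolding sD[symmetric] by (simp add: eval_nat_numeral algebra_simps)
    also have "\<dots> = (s * x^2)^3 - 108 * b * x^6"
      unfolding p by (simp add: eval_nat_numeral algebra_simps)
    also have "\<dots> = 64 * y^6 - 18 * x^2 * D * (4 * x * y^2) + 9 * x^3 * D^2"
      unfolding sD D y' by (simp add: eval_nat_numeral algebra_simps)
    also have "\<dots> = 9 * x^2 * D^2 * X3"
      unfolding X3 kk[symmetric] km[symmetric] by (simp add: eval_nat_numeral algebra_simps)
    finally have eqX: "p = X3"
      using mult_left_cancel[of "9 * x^2 * D^2"] 4 D0 two six nz by (metis mult_eq_0_iff power_not_zero)
    have "27 * x^3 * D^3 * q = x^9 * (q * (27 * s^3))"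
      unfolding sD[symmetric] by (simp add: eval_nat_numeral algebra_simps)
    also have "\<dots> = (t * x^3) * ((s * x^2)^3 + 216 * b * x^6)"
      unfolding q by (simp add: eval_nat_numeral algebra_simps)
    also have "\<dots> = - (512 * y^9 - 27 * x^3 * D * (32 * y^5) + 54 * x^3 * D^2 * (6 * x^3 * y))
                    - 27 * x^3 * D^3 * y"
      unfolding t sD D y' by (simp add: eval_nat_numeral algebra_simps)
    also have "\<dots> = 27 * x^3 * D^3 * Y3"
      unfolding Y3 kkk[symmetric] kkm[symmetric] kmm[symmetric]
      by (simp add: eval_nat_numeral algebra_simps)
    finally have eqY: "q = Y3"
      using mult_left_cancel[of "27 * x^3 * D^3"] 4 D0 two six nz by (metis mult_eq_0_iff power_not_zero)
    show ?thesis using dual PPP eqX eqY by (simp add: X3_def Y3_def)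
  qed
qed

lemma on_curve_dual_isog:
  fixes b :: "'a::field"
  assumes "on_curve (- 27 * b) Q" and three: "(3::'a) \<noteq> 0"
  shows "on_curve b (dual_isog b Q)"
proof -
  have nz: "(27::'a) \<noteq> 0" "(9::'a) \<noteq> 0" "(729::'a) \<noteq> 0" "(81::'a) \<noteq> 0" "(19683::'a) \<noteq> 0"
  proof -
    have "(9::'a) = 3 * 3" "(27::'a) = 3 * 3 * 3" "(729::'a) = 3 * 3 * 3 * 3 * 3 * 3"
      "(81::'a) = 3 * 3 * 3 * 3" "(19683::'a) = 3 * 3 * 3 * 3 * 3 * 3 * 3 * 3 * 3" by simp_all
    then show "(27::'a) \<noteq> 0" "(9::'a) \<noteq> 0" "(729::'a) \<noteq> 0" "(81::'a) \<noteq> 0" "(19683::'a) \<noteq> 0"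
      using three by (metis mult_eq_0_iff)+
  qed
  have "on_curve (- 27 * (- 27 * b)) (isog (- 27 * b) Q)"
    by (rule on_curve_isog) (rule assms)
  moreover have "(y / 27)^2 = (x / 9)^3 + b" if "y^2 = x^3 + - 27 * (- 27 * b)" for x y :: 'a
  proof -
    have "(y / 27)^2 = y^2 / 729" by (simp add: power_divide)
    also have "\<dots> = (x / 9)^3 + b"
      unfolding that using nz by (simp add: power_divide field_simps)
    finally show ?thesis .
  qed
  ultimately show ?thesis
    unfolding dual_isog_def on_curve_def by (cases "isog (- 27 * b) Q") (simp_all only: point.case)
qed

lemma isog_dual_isog:
  fixes b :: "'a::field"
  assumes "on_curve (- 27 * b) Q" and two: "(2::'a) \<noteq> 0" and three: "(3::'a) \<noteq> 0" and b: "b \<noteq> 0"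
  shows "isog b (dual_isog b Q) = point_add Q (point_add Q Q)"
proof -
  have nz: "(27::'a) \<noteq> 0" "(9::'a) \<noteq> 0" "(729::'a) \<noteq> 0" "(81::'a) \<noteq> 0" "(19683::'a) \<noteq> 0"
  proof -
    have "(9::'a) = 3 * 3" "(27::'a) = 3 * 3 * 3" "(729::'a) = 3 * 3 * 3 * 3 * 3 * 3"
      "(81::'a) = 3 * 3 * 3 * 3" "(19683::'a) = 3 * 3 * 3 * 3 * 3 * 3 * 3 * 3 * 3" by simp_all
    then show "(27::'a) \<noteq> 0" "(9::'a) \<noteq> 0" "(729::'a) \<noteq> 0" "(81::'a) \<noteq> 0" "(19683::'a) \<noteq> 0"
      using three by (metis mult_eq_0_iff)+
  qed
  have "isog b (dual_isog b Q) = dual_isog (- 27 * b) (isog (- 27 * b) Q)"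
    using nz
    by (cases "isog (- 27 * b) Q")
       (auto simp: dual_isog_def power_divide field_simps power2_eq_square power3_eq_cube)
  also have "\<dots> = point_add Q (point_add Q Q)"
    using assms nz by (intro dual_isog_isog) auto
  finally show ?thesis .
qed

section \<open>Integral points over \<open>k(t)\<close>\<close>

text \<open>The set \<open>E(k[t])\<close> for \<open>E: y\<^sup>2 = x\<^sup>3 + f\<close>, as a subset of \<open>E(k(t))\<close>.\<close>

definition integral_points :: "'k::field poly \<Rightarrow> 'k poly fract point set" where
  "integral_points f =
     {P \<in> carrier (curve_group (to_fract f)). \<exists>x y. P = Affine (to_fract x) (to_fract y)}"

text \<open>Only meaningful on integral points. The convention \<open>degree 0 = 0\<close> is harmless: if
  \<open>f\<close> is nonconstant and \<open>y\<^sup>2 = x\<^sup>3 + f\<close>, then a vanishing coordinate is accompanied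
  by a nonconstant one.\<close>

fun naive_height :: "'k::field poly fract point \<Rightarrow> real" where
  "naive_height Infinity = 0"
| "naive_height (Affine x y) =
     max (real (Polynomial.degree (inv_into UNIV to_fract x)) / 2)
         (real (Polynomial.degree (inv_into UNIV to_fract y)) / 3)"


section \<open>The natural map to \<open>E(k(t))/\<lambda>\<^sup>tE'(k(t))\<close>\<close>

text \<open>The image of \<open>E'(k(t))\<close> under the dual isogeny.\<close>

definition dual_image :: "'k::field poly \<Rightarrow> 'k poly fract point set" where
  "dual_image f = dual_isog (to_fract f) ` carrier (curve_group (- 27 * to_fract f))"

definition quotient_map ::
    "'k::field poly \<Rightarrow> 'k poly fract point \<Rightarrow> 'k poly fract point set" where
  "quotient_map f P = dual_image f #>\<^bsub>curve_group (to_fract f)\<^esub> P"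

definition at_most_to_one :: "nat \<Rightarrow> ('a \<Rightarrow> 'b) \<Rightarrow> 'a set \<Rightarrow> bool" where
  "at_most_to_one m g A \<longleftrightarrow> (\<forall>c. finite {a \<in> A. g a = c} \<and> card {a \<in> A. g a = c} \<le> m)"


section \<open>Cardinality and rank with values in \<open>\<nat> \<union> {\<infinity>}\<close>\<close>

definition ecard :: "'a set \<Rightarrow> enat" where
  "ecard A = (if finite A then enat (card A) else \<infinity>)"

definition int_independent :: "('a, 'm) monoid_scheme \<Rightarrow> 'a set \<Rightarrow> bool" where
  "int_independent G S \<longleftrightarrow>
     finite S \<and> S \<subseteq> carrier G \<and>
     (\<forall>c :: 'a \<Rightarrow> int. finprod G (\<lambda>s. s [^]\<^bsub>G\<^esub> c s) S = \<one>\<^bsub>G\<^esub> \<longrightarrow> (\<forall>s\<in>S. c s = 0))"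

definition int_rank :: "('a, 'm) monoid_scheme \<Rightarrow> enat" where
  "int_rank G = (SUP S \<in> {S. int_independent G S}. enat (card S))"

definition pow3 :: "ereal \<Rightarrow> ereal" where
  "pow3 r = (if r = \<infinity> then \<infinity> else ereal (3 powr real_of_ereal r))"

end

theory Submission
  imports Defs
begin

text \<open>
  Over \<open>K = k(t)\<close>, the map \<open>(x, y) \<mapsto> y + \<surd>f\<close> induces an injective homomorphism from
  \<open>E(K)/\<lambda>\<^sup>tE'(K)\<close> to \<open>K(\<surd>f)\<^sup>*\<close> modulo cubes. If two integral points \<open>P\<close>, \<open>Q\<close> lie in the same
  class, then \<open>(y\<^sub>P + \<surd>f)(y\<^sub>Q - \<surd>f) = (a + b\<surd>f)\<^sup>3\<close>. The norm \<open>a\<^sup>2 - b\<^sup>2f\<close> is \<open>x\<^sub>Px\<^sub>Q\<close> up to a root of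
  unity, and comparing the coefficients of \<open>\<surd>f\<close> gives \<open>b(3a\<^sup>2 + b\<^sup>2f) = y\<^sub>Q - y\<^sub>P\<close>. As \<open>deg f\<close> is
  odd, \<open>a\<^sup>2\<close> and \<open>b\<^sup>2f\<close> cannot cancel, so \<open>deg b + deg x\<^sub>P + deg x\<^sub>Q = deg (y\<^sub>Q - y\<^sub>P)\<close> if
  \<open>y\<^sub>P \<noteq> y\<^sub>Q\<close>. A local analysis shows that \<open>b\<close> is a polynomial as soon as the same primes
  dividing \<open>f\<^sub>3\<close> divide \<open>x\<^sub>P\<close> and \<open>x\<^sub>Q\<close>; then one of the heights is at least twice the other, which is
  impossible within each of the three ranges, because \<open>d/6 \<le> h(P) < d\<close> (the upper bound is
  Davenport's inequality). The same argument with \<open>y\<^sub>P + \<surd>f = (a + b\<surd>f)\<^sup>3\<close> shows that no integral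
  point at all lies in \<open>\<lambda>\<^sup>tE'(K)\<close>. The number of classes is bounded in terms of the rank since
  \<open>3E(K) \<subseteq> \<lambda>\<^sup>tE'(K)\<close> and \<open>E(K)\<close> has no \<open>3\<close>-torsion; if \<open>\<zeta>\<^sub>3 \<in> k\<close>, then even
  \<open>(1 - \<zeta>\<^sub>3)E(K) \<subseteq> \<lambda>\<^sup>tE'(K)\<close>.
\<close>

section \<open>The chord-tangent law\<close>

text \<open>Cosets and ranks make sense only once \<open>point_add\<close> is known to be
  associative, so the group law is proved first, over an arbitrary field that is later specialised
  to \<open>k(t)\<close>. The cube root \<open>a + b*sqrt f\<close> has coefficients in
  \<open>k(t)\<close>. They are written as \<open>A/C\<close> and \<open>B/C\<close> with a common
  denominator that need not be reduced, and everything is read off from vanishing orders over the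
  algebraic closure of \<open>k\<close> and from degrees. Parity drives both: \<open>f\<close> has
  odd degree and odd order at each of its roots, so \<open>a^2\<close> and \<open>b^2*f\<close> have
  different orders at those roots and at infinity. The nonconstant factor \<open>f1\<close> provides
  a simple root of \<open>f\<close>. It keeps Davenport's inequality alive in positive
  characteristic, and it shows that \<open>-4*f\<close> is not a cube, which excludes 3-torsion. The
  cut points \<open>d/4\<close> and \<open>d/2\<close> make \<open>[d/6, d/4)\<close>,
  \<open>[d/4, d/2)\<close> and \<open>[d/2, d)\<close> intervals in which no number is twice
  another. Once heights cannot differ by a factor 2, points of a class that agree at the primes of
  \<open>f3\<close> share their \<open>y\<close>; then \<open>x\<close> is fixed up to a cube root
  of unity, which explains the factor 3 in the second case.\<close>

lemma point_add_collinear: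
  fixes b :: "'a::field"
  assumes two: "(2::'a) \<noteq> 0"
    and P: "on_curve b (Affine x1 y1)" and Q: "on_curve b (Affine x2 y2)"
    and nopp: "\<not> (x1 = x2 \<and> y1 = - y2)"
  obtains m c x3 where "point_add (Affine x1 y1) (Affine x2 y2) = Affine x3 (- (m * x3 + c))"
    "y1 = m * x1 + c" "y2 = m * x2 + c" "x1 + x2 + x3 = m^2"
    "x1 * x2 + x1 * x3 + x2 * x3 = - 2 * m * c" "x1 * x2 * x3 = c^2 - b"
proof -
  have y1: "y1^2 = x1^3 + b" and y2: "y2^2 = x2^3 + b"
    using P Q by (auto simp: on_curve_def)
  define m where "m = (if x1 = x2 then 3 * x1^2 / (2 * y1) else (y2 - y1) / (x2 - x1))"
  define x3 c where "x3 = m^2 - x1 - x2" and "c = y1 - m * x1"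
  have same: "y1 = y2 \<and> y1 \<noteq> 0" if "x1 = x2"
  proof -
    have "(y1 - y2) * (y1 + y2) = 0" using y1 y2 that by (simp add: algebra_simps power2_eq_square)
    moreover have "y1 + y2 \<noteq> 0" using nopp that by (auto simp: eq_neg_iff_add_eq_0)
    ultimately show ?thesis using that nopp by auto
  qed
  have slope: "x1^2 + x1 * x2 + x2^2 = m * (y1 + y2)"
  proof (cases "x1 = x2")
    case True
    then have "y1 = y2" "y1 \<noteq> 0" using same by auto
    then show ?thesis using True two by (simp add: m_def power2_eq_square field_simps)
  next
    case False
    have "(x2 - x1) * (x1^2 + x1 * x2 + x2^2) = y2^2 - y1^2"
      unfolding y1 y2 by (simp add: algebra_simps power2_eq_square power3_eq_cube)
    also have "\<dots> = (y2 - y1) * (y1 + y2)" by (simp add: algebra_simps power2_eq_square)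
    finally show ?thesis using False by (simp add: m_def field_simps)
  qed
  have my2: "y2 = m * x2 + c"
  proof (cases "x1 = x2")
    case False
    then have "m * (x2 - x1) = y2 - y1" by (simp add: m_def)
    then show ?thesis by (simp add: c_def algebra_simps)
  qed (use same in \<open>auto simp: c_def\<close>)
  have e2: "x1 * x2 + x1 * x3 + x2 * x3 = - 2 * m * c"
  proof -
    have "x1 * x2 + x1 * x3 + x2 * x3 = m^2 * (x1 + x2) - (x1^2 + x1 * x2 + x2^2)"
      by (simp add: x3_def algebra_simps power2_eq_square)
    then show ?thesis unfolding slope my2 c_def by (simp add: algebra_simps power2_eq_square)
  qed
  have "x1 * x2 * x3 = x1 * (x1 * x2 + x1 * x3 + x2 * x3) - x1^2 * (x1 + x2 + x3) + x1^3"
    by (simp add: algebra_simps power2_eq_square power3_eq_cube)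
  also have "\<dots> = x1 * (- 2 * m * c) - x1^2 * m^2 + (y1^2 - b)"
    unfolding e2 y1 by (simp add: x3_def)
  also have "\<dots> = c^2 - b" by (simp add: c_def algebra_simps power2_eq_square)
  finally have e3: "x1 * x2 * x3 = c^2 - b" .
  have "point_add (Affine x1 y1) (Affine x2 y2) = Affine x3 (m * (x1 - x3) - y1)"
    unfolding point_add.simps if_not_P[OF nopp] m_def[symmetric] Let_def x3_def ..
  also have "m * (x1 - x3) - y1 = - (m * x3 + c)" by (simp add: c_def algebra_simps)
  finally have "point_add (Affine x1 y1) (Affine x2 y2) = Affine x3 (- (m * x3 + c))" .
  moreover have "y1 = m * x1 + c" "x1 + x2 + x3 = m^2" by (simp_all add: c_def x3_def)
  ultimately show ?thesis using that[OF _ _ my2 _ e2 e3] by blast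
qed

text \<open>The monic cubic with roots \<open>x1\<close>, \<open>x2\<close>, \<open>x3\<close> is
  \<open>X^3 + b - (m*X + c)^2\<close>, and \<open>x3\<close> is one of its roots.\<close>

lemma on_curve_third_point:
  fixes m :: "'a::comm_ring_1"
  assumes "x1 + x2 + x3 = m^2" "x1 * x2 + x1 * x3 + x2 * x3 = - 2 * m * c" "x1 * x2 * x3 = c^2 - b"
  shows "(m * x3 + c)^2 = x3^3 + b"
proof -
  have "x3^3 = x3^2 * (x1 + x2 + x3) - x3 * (x1 * x2 + x1 * x3 + x2 * x3) + x1 * x2 * x3"
    by (simp add: algebra_simps power2_eq_square power3_eq_cube)
  then show ?thesis unfolding assms by (simp add: algebra_simps power2_eq_square)
qed

lemma on_curve_point_add:
  fixes b :: "'a::field"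
  assumes two: "(2::'a) \<noteq> 0" and P: "on_curve b P" and Q: "on_curve b Q"
  shows "on_curve b (point_add P Q)"
proof (cases P; cases Q)
  fix x1 y1 x2 y2 assume PQ: "P = Affine x1 y1" "Q = Affine x2 y2"
  show ?thesis
  proof (cases "x1 = x2 \<and> y1 = - y2")
    case True then show ?thesis using PQ by (simp add: on_curve_def)
  next
    case False
    from point_add_collinear[OF two _ _ False, of b] P Q PQ
    obtain m c x3 where A: "point_add P Q = Affine x3 (- (m * x3 + c))"
      and e: "x1 + x2 + x3 = m^2" "x1 * x2 + x1 * x3 + x2 * x3 = - 2 * m * c"
        "x1 * x2 * x3 = c^2 - b" by metis
    show ?thesis using on_curve_third_point[OF e] unfolding A on_curve_def point.case power2_minus .
  qed
qed (use P Q in \<open>simp_all add: on_curve_def\<close>)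

fun point_neg :: "'a::field point \<Rightarrow> 'a point" where
  "point_neg Infinity = Infinity"
| "point_neg (Affine x y) = Affine x (- y)"

lemma on_curve_point_neg: "on_curve b P \<Longrightarrow> on_curve b (point_neg P)"
  by (cases P) (auto simp: on_curve_def)

lemma point_add_neg [simp]: "point_add P (point_neg P) = Infinity"
  by (cases P) auto

lemma point_add_neg_eq_InfinityD: "point_add P (point_neg Q) = Infinity \<Longrightarrow> P = Q"
  by (cases P; cases Q) (auto simp: Let_def split: if_splits)


section \<open>Products of submodules of a field\<close>

definition is_module :: "'m::field set \<Rightarrow> 'm set \<Rightarrow> bool" where
  "is_module R I \<longleftrightarrow> 0 \<in> I \<and> (\<forall>x\<in>I. \<forall>y\<in>I. x + y \<in> I) \<and> (\<forall>r\<in>R. \<forall>x\<in>I. r * x \<in> I)"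

text \<open>Finite sums of products, as for ideals. Stability under scalars is not imposed but
  inherited from the first factor, see \<open>is_module_prd\<close>.\<close>

inductive_set prd :: "'m::field set \<Rightarrow> 'm set \<Rightarrow> 'm set" for I J where
  zero: "0 \<in> prd I J"
| step: "z \<in> prd I J \<Longrightarrow> i \<in> I \<Longrightarrow> j \<in> J \<Longrightarrow> z + i * j \<in> prd I J"

lemma prd_times: "i \<in> I \<Longrightarrow> j \<in> J \<Longrightarrow> i * j \<in> prd I J"
  using prd.step[OF prd.zero] by fastforce

lemma prd_add: "x \<in> prd I J \<Longrightarrow> y \<in> prd I J \<Longrightarrow> x + y \<in> prd I J"
proof -
  assume x: "x \<in> prd I J" and "y \<in> prd I J"
  from this(2) show ?thesis by induction (auto simp: x simp flip: add.assoc intro: prd.step)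
qed

lemma prd_least:
  assumes "0 \<in> K" "\<And>x y. x \<in> K \<Longrightarrow> y \<in> K \<Longrightarrow> x + y \<in> K" "\<And>i j. i \<in> I \<Longrightarrow> j \<in> J \<Longrightarrow> i * j \<in> K"
  shows "prd I J \<subseteq> K"
proof
  fix x assume "x \<in> prd I J"
  then show "x \<in> K" by induction (auto intro: assms)
qed

lemma prd_commute: "prd I J = prd J I"
proof -
  have "prd I J \<subseteq> prd J I" for I J :: "'a set"
  proof (rule prd_least)
    fix i j assume "i \<in> I" "j \<in> J"
    then show "i * j \<in> prd J I" using prd_times[of j J i I] by (simp add: mult.commute)
  qed (auto intro: prd.zero prd_add)
  then show ?thesis by blast
qed

lemma prd_assoc: "prd (prd I J) K = prd I (prd J K)"
proof
  have "i * k \<in> prd I (prd J K)" if "i \<in> prd I J" "k \<in> K" for i k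
    using that(1)
  proof induction
    case (step z i j)
    have "z * k + i * (j * k) \<in> prd I (prd J K)"
      by (intro prd.step step prd_times that(2))
    then show ?case by (simp add: algebra_simps)
  qed (auto intro: prd.zero)
  then show "prd (prd I J) K \<subseteq> prd I (prd J K)"
    by (intro prd_least) (auto intro: prd.zero prd_add)
  have "i * k \<in> prd (prd I J) K" if "k \<in> prd J K" "i \<in> I" for i k
    using that(1)
  proof induction
    case (step z j k)
    have "i * z + (i * j) * k \<in> prd (prd I J) K"
      by (intro prd.step step prd_times that(2))
    then show ?case by (simp add: algebra_simps)
  qed (auto intro: prd.zero)
  then show "prd I (prd J K) \<subseteq> prd (prd I J) K"
    by (intro prd_least) (auto intro: prd.zero prd_add)
qed

lemma is_module_prd:
  assumes "is_module R I" shows "is_module R (prd I J)"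
proof -
  have "r * x \<in> prd I J" if "x \<in> prd I J" "r \<in> R" for r x
    using that(1)
  proof induction
    case (step z i j)
    have "r * i \<in> I" using assms step that by (auto simp: is_module_def)
    from prd.step[OF step(4) this step(3)] show ?case by (simp add: algebra_simps)
  qed (auto intro: prd.zero)
  then show ?thesis by (auto simp: is_module_def intro: prd.zero prd_add)
qed

lemma prd_unit:
  assumes "is_module R I" "1 \<in> R" shows "prd R I = I"
proof
  show "prd R I \<subseteq> I" by (rule prd_least) (use assms in \<open>auto simp: is_module_def\<close>)
  show "I \<subseteq> prd R I" using prd_times[OF assms(2), of _ I] by auto
qed

lemma prd_scale: "prd ((*) c ` I) J = (*) c ` prd I J"
proof
  show "prd ((*) c ` I) J \<subseteq> (*) c ` prd I J"
  proof (rule prd_least)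
    show "0 \<in> (*) c ` prd I J" using prd.zero[of I J] by force
  next
    fix x y assume "x \<in> (*) c ` prd I J" "y \<in> (*) c ` prd I J"
    then obtain x' y' where "x = c * x'" "y = c * y'" "x' \<in> prd I J" "y' \<in> prd I J" by blast
    then show "x + y \<in> (*) c ` prd I J" by (auto simp flip: distrib_left intro: prd_add)
  next
    fix i j assume "i \<in> (*) c ` I" "j \<in> J"
    then show "i * j \<in> (*) c ` prd I J" by (auto simp: mult.assoc intro: prd_times)
  qed
  have "c * x \<in> prd ((*) c ` I) J" if "x \<in> prd I J" for x
    using that
  proof induction
    case (step z i j)
    have "c * z + (c * i) * j \<in> prd ((*) c ` I) J"
      by (intro prd.step step imageI)
    then show ?case by (simp add: algebra_simps)
  qed (auto intro: prd.zero)
  then show "(*) c ` prd I J \<subseteq> prd ((*) c ` I) J" by auto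
qed

text \<open>Equality in the ideal class group. Two scalars instead of one quotient keep the relation
  symmetric, and they may come from the whole ambient field.\<close>

definition same_class :: "'m::field set \<Rightarrow> 'm set \<Rightarrow> bool" where
  "same_class I J \<longleftrightarrow> (\<exists>c d. c \<noteq> 0 \<and> d \<noteq> 0 \<and> (*) c ` I = (*) d ` J)"

lemma same_class_refl: "same_class I I"
  unfolding same_class_def by (intro exI[of _ 1]) auto

lemma same_class_sym: "same_class I J \<Longrightarrow> same_class J I"
  unfolding same_class_def by metis

lemma image_times_times: "(*) c ` (*) d ` I = (*) (c * d) ` (I :: 'm::field set)"
  by (auto simp: image_image mult.assoc)

lemma same_class_trans:
  assumes "same_class I J" "same_class J K" shows "same_class I K"
proof -
  obtain c d where n: "c \<noteq> 0" "d \<noteq> 0" and e: "(*) c ` I = (*) d ` J"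
    using assms(1) unfolding same_class_def by auto
  obtain c' d' where n': "c' \<noteq> 0" "d' \<noteq> 0" and e': "(*) c' ` J = (*) d' ` K"
    using assms(2) unfolding same_class_def by auto
  have "(*) (c' * c) ` I = (*) c' ` (*) d ` J" by (simp only: image_times_times flip: e)
  also have "\<dots> = (*) d ` (*) c' ` J" by (simp only: image_times_times mult.commute[of c'])
  also have "\<dots> = (*) (d * d') ` K" by (simp only: image_times_times e')
  finally have "(*) (c' * c) ` I = (*) (d * d') ` K" .
  moreover have "c' * c \<noteq> 0" "d * d' \<noteq> 0" using n n' by auto
  ultimately show ?thesis unfolding same_class_def by blast
qed

lemma same_class_prd_left:
  assumes "same_class I J" shows "same_class (prd I K) (prd J K)"
proof -
  from assms obtain c d where "c \<noteq> 0" "d \<noteq> 0" "(*) c ` I = (*) d ` J"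
    unfolding same_class_def by blast
  moreover from this(3) have "(*) c ` prd I K = (*) d ` prd J K"
    by (simp only: prd_scale[symmetric])
  ultimately show ?thesis unfolding same_class_def by blast
qed

lemma same_class_prd:
  assumes "same_class I J" "same_class K L" shows "same_class (prd I K) (prd J L)"
proof (rule same_class_trans)
  show "same_class (prd I K) (prd J K)" by (rule same_class_prd_left) (rule assms)
  show "same_class (prd J K) (prd J L)"
    unfolding prd_commute[of J] by (rule same_class_prd_left) (rule assms)
qed


section \<open>The coordinate ring and the group law\<close>

definition emb :: "'a::field poly \<Rightarrow> 'a poly fract alg_closure" where
  "emb p = to_ac (to_fract p)"

lemma emb_simps [simp]: "emb 0 = 0" "emb 1 = 1" "emb (p + q) = emb p + emb q"
  "emb (p - q) = emb p - emb q" "emb (- p) = - emb p" "emb (p * q) = emb p * emb q"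
  "emb p = emb q \<longleftrightarrow> p = q" "emb p = 0 \<longleftrightarrow> p = 0"
  by (simp_all add: emb_def)

lemma emb_power [simp]: "emb (p ^ n) = emb p ^ n"
  by (induction n) simp_all

lemma to_fract_power [simp]: "to_fract (p ^ n) = to_fract p ^ n"
  by (induction n) simp_all

lemma to_fract_of_nat [simp]: "to_fract (of_nat n) = of_nat n"
  by (induction n) simp_all

lemma to_fract_numeral [simp]: "to_fract (numeral n) = numeral n"
  using to_fract_of_nat[of "numeral n"] by simp

lemma emb_numeral [simp]: "emb (numeral n) = numeral n"
  by (simp add: emb_def)

text \<open>The coordinate ring of \<open>y\<^sup>2 = x\<^sup>3 + b\<close> is realised inside an algebraic closure of the rational
  function field, \<open>w\<close> playing the role of \<open>y\<close>; no quotient type is needed and ideals are sets.\<close>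

locale weierstrass =
  fixes b :: "'a::field"
  assumes two: "(2::'a) \<noteq> 0" and three: "(3::'a) \<noteq> 0" and b: "b \<noteq> 0"
begin

definition cub :: "'a poly" where "cub = [:b, 0, 0, 1:]"

definition w :: "'a poly fract alg_closure" where "w = (SOME w. w^2 = emb cub)"

definition elt :: "'a poly \<Rightarrow> 'a poly \<Rightarrow> 'a poly fract alg_closure" where
  "elt p q = emb p + emb q * w"

definition R :: "'a poly fract alg_closure set" where
  "R = {elt p q | p q. True}"

text \<open>Associativity comes from the ideal class group: \<open>P \<mapsto> pt_ideal P\<close> is additive and injective
  on classes, the injectivity because no norm from \<open>R\<close> has degree 1.\<close>

definition pt_ideal :: "'a point \<Rightarrow> 'a poly fract alg_closure set" where
  "pt_ideal P = (case P of Infinity \<Rightarrow> R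
     | Affine x y \<Rightarrow> {elt p q | p q. poly p x + poly q x * y = 0})"

lemma w_square: "w^2 = emb cub"
  unfolding w_def by (rule someI_ex) (rule nth_root_exists, simp)

lemma poly_cub: "poly cub x = x^3 + b"
  by (simp add: cub_def algebra_simps power3_eq_cube)

lemma degree_cub: "degree cub = 3" "cub \<noteq> 0"
  by (simp_all add: cub_def)

lemma elt_mult: "elt p q * elt p' q' = elt (p * p' + q * q' * cub) (p * q' + q * p')"
  using w_square by (simp add: elt_def algebra_simps power2_eq_square)

lemma elt_add: "elt p q + elt p' q' = elt (p + p') (q + q')"
  by (simp add: elt_def algebra_simps)

section \<open>Norms from the coordinate ring\<close>

definition nm :: "'a poly \<Rightarrow> 'a poly \<Rightarrow> 'a poly" where
  "nm p q = p^2 - q^2 * cub"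

text \<open>\<open>p^2\<close> has even degree and \<open>q^2 * cub\<close> odd degree, so they
  agree only if both vanish. In particular \<open>w\<close> is irrational, and \<open>elt\<close>
  represents each element of \<open>R\<close> uniquely.\<close>

lemma nm_eq_0_iff: "nm p q = 0 \<longleftrightarrow> p = 0 \<and> q = 0"
proof
  assume "nm p q = 0"
  then have eq: "p^2 = q^2 * cub" by (simp add: nm_def)
  have "q = 0"
  proof (rule ccontr)
    assume q: "q \<noteq> 0"
    then have "p \<noteq> 0" using eq degree_cub by auto
    then have "2 * degree p = 2 * degree q + 3"
      using arg_cong[OF eq, of degree] q by (simp add: degree_mult_eq degree_power_eq degree_cub)
    then show False by presburger
  qed
  then show "p = 0 \<and> q = 0" using eq by simp
qed (simp add: nm_def)

lemma elt_eq_iff: "elt p q = elt p' q' \<longleftrightarrow> p = p' \<and> q = q'"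
proof
  assume "elt p q = elt p' q'"
  then have "emb (p - p') = - emb (q - q') * w" by (simp add: elt_def algebra_simps)
  then have "emb (p - p')^2 = emb (q - q')^2 * w^2"
    by (simp only: power_mult_distrib power2_minus)
  then have "emb ((p - p')^2) = emb ((q - q')^2 * cub)"
    unfolding w_square by (simp only: emb_simps emb_power)
  then have "(p - p')^2 = (q - q')^2 * cub" unfolding emb_simps(7) .
  then have "nm (p - p') (q - q') = 0" by (simp add: nm_def)
  then show "p = p' \<and> q = q'" by (simp add: nm_eq_0_iff)
qed simp

lemma nm_mult: "nm (p * p' + q * q' * cub) (p * q' + q * p') = nm p q * nm p' q'"
  by (simp add: nm_def algebra_simps power2_eq_square)

text \<open>The degrees of \<open>p^2\<close> and \<open>q^2 * cub\<close> have different parity,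
  the second being at least 3, so the larger survives. The gap at degree 1 reflects genus one: no
  function has just one simple pole at infinity.\<close>

lemma degree_nm:
  assumes "p \<noteq> 0 \<or> q \<noteq> 0"
  shows "degree (nm p q) = 0 \<and> q = 0 \<or> degree (nm p q) \<ge> 2"
proof (cases "q = 0")
  case True
  then show ?thesis using assms by (auto simp: nm_def degree_power_eq)
next
  case False
  have dq: "degree (q^2 * cub) = 2 * degree q + 3"
    using False by (simp add: degree_mult_eq degree_power_eq degree_cub)
  have "degree (p^2) = 2 * degree p" by (cases "p = 0") (simp_all add: degree_power_eq)
  then have "degree (p^2) < degree (q^2 * cub) \<or> degree (p^2) > degree (q^2 * cub)"
    unfolding dq by presburger
  then show ?thesis
    using dq degree_add_eq_left[of "- (q^2 * cub)" "p^2"] degree_add_eq_right[of "p^2" "- (q^2 * cub)"]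
    by (auto simp: nm_def)
qed

lemma R_module: "is_module R R" and R_one: "1 \<in> R"
proof -
  have "elt 0 0 = 0" "elt 1 0 = 1" by (simp_all add: elt_def)
  then show "is_module R R" "1 \<in> R"
    unfolding is_module_def R_def by (auto simp: elt_add elt_mult) metis+
qed

lemma elt_in_R [simp]: "elt p q \<in> R"
  by (auto simp: R_def)

lemma emb_in_R [simp]: "emb p \<in> R" and w_in_R [simp]: "w \<in> R"
  using elt_in_R[of p 0] elt_in_R[of 0 1] by (simp_all only: elt_def) simp_all

lemma elt_in_pt_ideal_iff: "elt p q \<in> pt_ideal (Affine x y) \<longleftrightarrow> poly p x + poly q x * y = 0"
  by (auto simp: pt_ideal_def elt_eq_iff)

lemma pt_ideal_subset_R: "pt_ideal P \<subseteq> R"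
  by (cases P) (auto simp: pt_ideal_def)

text \<open>Evaluation at \<open>(x, y)\<close> is multiplicative on \<open>R\<close> because
  \<open>y^2 = poly cub x\<close> matches \<open>w^2 = emb cub\<close>.\<close>

lemma pt_ideal_module:
  assumes "on_curve b P" shows "is_module R (pt_ideal P)"
proof (cases P)
  case Infinity then show ?thesis by (simp add: pt_ideal_def R_module)
next
  case (Affine x y)
  have y: "y^2 = poly cub x" using assms Affine by (simp add: on_curve_def poly_cub)
  have [simp]: "elt 0 0 = 0" by (simp add: elt_def)
  show ?thesis unfolding is_module_def Affine
  proof (intro conjI ballI)
    show "0 \<in> pt_ideal (Affine x y)" using elt_in_pt_ideal_iff[of 0 0 x y] by simp
  next
    fix u v assume "u \<in> pt_ideal (Affine x y)" "v \<in> pt_ideal (Affine x y)"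
    moreover from this obtain p q p' q' where "u = elt p q" "v = elt p' q'"
      using pt_ideal_subset_R by (auto simp: R_def subset_iff) metis
    moreover have "poly p x + poly p' x + (poly q x + poly q' x) * y =
      (poly p x + poly q x * y) + (poly p' x + poly q' x * y)" by (simp add: algebra_simps)
    ultimately show "u + v \<in> pt_ideal (Affine x y)"
      by (simp add: elt_add elt_in_pt_ideal_iff)
  next
    fix u v assume "u \<in> R" "v \<in> pt_ideal (Affine x y)"
    moreover from this obtain p q p' q' where "u = elt p q" "v = elt p' q'"
      using pt_ideal_subset_R by (auto simp: R_def subset_iff) metis
    moreover have "poly p x * poly p' x + poly q x * poly q' x * poly cub x
        + (poly p x * poly q' x + poly q x * poly p' x) * y
      = (poly p x + poly q x * y) * (poly p' x + poly q' x * y)"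
      unfolding y[symmetric] by (simp add: algebra_simps power2_eq_square)
    ultimately show "u * v \<in> pt_ideal (Affine x y)"
      by (simp add: elt_mult elt_in_pt_ideal_iff)
  qed
qed

section \<open>Generators of the point ideals\<close>

definition T :: "'a poly fract alg_closure" where "T = emb [:0, 1:]"

definition K :: "'a \<Rightarrow> 'a poly fract alg_closure" where "K c = emb [:c:]"

lemma K_simps [simp]: "K 0 = 0" "K 1 = 1" "K (c + d) = K c + K d" "K (c - d) = K c - K d"
  "K (- c) = - K c" "K (c * d) = K c * K d" "K c = K d \<longleftrightarrow> c = d" "K c \<in> R" "T \<in> R"
proof -
  show "K (c * d) = K c * K d" unfolding K_def emb_simps(6)[symmetric] by simp
  show "K c = K d \<longleftrightarrow> c = d" unfolding K_def emb_simps(7) by simp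
qed (simp_all add: K_def T_def one_pCons emb_in_R del: emb_simps(3-) flip: emb_simps)

lemma K_power [simp]: "K (c ^ n) = K c ^ n"
  by (induction n) simp_all

lemma K_numeral [simp]: "K (numeral n) = numeral n"
  unfolding K_def numeral_poly[symmetric] by (rule emb_numeral)

lemma T_minus_K: "T - K x = emb [:- x, 1:]"
  by (simp add: T_def K_def flip: emb_simps)

lemma T_minus_K_neq_0: "T - K x \<noteq> 0"
  unfolding T_minus_K by simp

lemma w_square_T: "w^2 = T^3 + K b"
proof -
  have "cub = [:0, 1:]^3 + [:b:]" by (simp add: cub_def power3_eq_cube)
  then show ?thesis unfolding w_square by (simp only: emb_simps emb_power T_def K_def)
qed

lemma T_minus_K_elt: "T - K x = elt [:- x, 1:] 0"
  by (simp only: elt_def T_minus_K) simp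

lemma w_minus_K_elt: "w - K y = elt (- [:y:]) 1"
  unfolding elt_def K_def emb_simps(5) by simp

lemma line_elt: "w - (K m * T + K c) = elt (- [:c, m:]) 1"
proof -
  have L: "[:c, m:] = [:m:] * [:0, 1:] + [:c:]" by simp
  show ?thesis unfolding elt_def K_def T_def emb_simps(5) L emb_simps(3,6) by simp
qed

lemma generators_in_pt_ideal:
  "T - K x \<in> pt_ideal (Affine x y)" "w - K y \<in> pt_ideal (Affine x y)"
proof -
  show "T - K x \<in> pt_ideal (Affine x y)" "w - K y \<in> pt_ideal (Affine x y)"
    by (simp_all add: elt_in_pt_ideal_iff T_minus_K_elt w_minus_K_elt)
qed

text \<open>Rewrite \<open>p + q*w\<close> as \<open>(p + q*y) + q*(w - y)\<close>: the first
  summand is a polynomial vanishing at \<open>x\<close>, hence a multiple of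
  \<open>T - x\<close>.\<close>

lemma pt_idealE:
  assumes "i \<in> pt_ideal (Affine x y)"
  obtains r r' where "r \<in> R" "r' \<in> R" "i = r * (T - K x) + r' * (w - K y)"
proof -
  obtain p q where i: "i = elt p q" and v: "poly p x + poly q x * y = 0"
    using assms by (auto simp: pt_ideal_def)
  have "poly (p + q * [:y:]) x = 0" using v by (simp add: mult.commute)
  then obtain s where s: "p + q * [:y:] = [:- x, 1:] * s" unfolding poly_eq_0_iff_dvd dvd_def by blast
  have "elt p q = emb (p + q * [:y:]) + emb q * (w - K y)"
    unfolding elt_def K_def emb_simps(3,6) by (simp add: algebra_simps)
  also have "\<dots> = emb s * (T - K x) + emb q * (w - K y)"
    unfolding s T_minus_K emb_simps(6) by (simp only: mult.commute)
  finally show ?thesis using that[of "emb s" "emb q"] i by simp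
qed


lemma R_closed [simp]: "u \<in> R \<Longrightarrow> v \<in> R \<Longrightarrow> u + v \<in> R" "u \<in> R \<Longrightarrow> v \<in> R \<Longrightarrow> u * v \<in> R"
  "u \<in> R \<Longrightarrow> - u \<in> R" "u \<in> R \<Longrightarrow> v \<in> R \<Longrightarrow> u - v \<in> R" "u \<in> R \<Longrightarrow> u ^ n \<in> R"
  "1 \<in> R" "0 \<in> R" "numeral k \<in> R"
proof -
  show c: "u + v \<in> R" "u * v \<in> R" if "u \<in> R" "v \<in> R" for u v
    using R_module that by (auto simp: is_module_def)
  have m: "- u \<in> R" if "u \<in> R" for u
    using c(2)[OF emb_in_R[of "-1"] that] by simp
  then show "u \<in> R \<Longrightarrow> - u \<in> R" .
  show "u \<in> R \<Longrightarrow> v \<in> R \<Longrightarrow> u - v \<in> R" using c(1)[OF _ m] by force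
  show "u ^ n \<in> R" if "u \<in> R" by (induction n) (auto intro: c R_one that)
  show "1 \<in> R" "0 \<in> R" using R_one emb_in_R[of 0] by simp_all
  show "numeral k \<in> R" using emb_in_R[of "numeral k"] by simp
qed

lemma module_rules:
  assumes "is_module R I"
  shows "x \<in> I \<Longrightarrow> y \<in> I \<Longrightarrow> x + y \<in> I" "x \<in> I \<Longrightarrow> y \<in> I \<Longrightarrow> x - y \<in> I"
    "r \<in> R \<Longrightarrow> x \<in> I \<Longrightarrow> r * x \<in> I" "r \<in> R \<Longrightarrow> x \<in> I \<Longrightarrow> x * r \<in> I"
proof -
  have s: "r * x \<in> I" if "r \<in> R" "x \<in> I" for r x using assms that by (auto simp: is_module_def)
  then show "r \<in> R \<Longrightarrow> x \<in> I \<Longrightarrow> r * x \<in> I" "r \<in> R \<Longrightarrow> x \<in> I \<Longrightarrow> x * r \<in> I"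
    by (auto simp: mult.commute)
  have a: "x + y \<in> I" if "x \<in> I" "y \<in> I" for x y using assms that by (auto simp: is_module_def)
  then show "x \<in> I \<Longrightarrow> y \<in> I \<Longrightarrow> x + y \<in> I" .
  show "x - y \<in> I" if "x \<in> I" "y \<in> I"
    using a[OF that(1) s[of "-1", OF _ that(2)]] by simp
qed

section \<open>Principal products: vertical lines and chords\<close>

lemma is_module_colon: "is_module R I \<Longrightarrow> is_module R {r. g * r \<in> I}"
  by (auto simp: is_module_def distrib_left mult.left_commute)

text \<open>For \<open>I\<close> inside \<open>g*R\<close>, equality is a statement about the colon
  ideal \<open>{r. g * r \<in> I}\<close>; it becomes a search for a combination of known members
  that equals 1.\<close>

lemma principal_eqI:
  assumes "is_module R I" "I \<subseteq> (*) g ` R" "1 \<in> {r. g * r \<in> I}"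
  shows "I = (*) g ` R"
proof
  have "g \<in> I" using assms(3) by simp
  then show "(*) g ` R \<subseteq> I" using module_rules(4)[OF assms(1)] by auto
qed (rule assms)

text \<open>The divisor of \<open>T - x\<close> is \<open>P + (-P)\<close>. That the product fills
  all of \<open>g*R\<close> is smoothness: \<open>2*y\<close> and \<open>3*x^2\<close> do not vanish
  together on the curve since \<open>b \<noteq> 0\<close>.\<close>

lemma prd_pt_ideal_neg:
  assumes "on_curve b (Affine x y)"
  shows "prd (pt_ideal (Affine x y)) (pt_ideal (Affine x (- y))) = (*) (T - K x) ` R"
    (is "?A = (*) ?g ` R")
proof (rule principal_eqI)
  have y: "y^2 = x^3 + b" using assms by (simp add: on_curve_def)
  show mod: "is_module R ?A" by (intro is_module_prd pt_ideal_module assms)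
  have w2: "(w - K y) * (w + K y) = ?g * (T^2 + T * K x + K x^2)"
  proof -
    have "(w - K y) * (w + K y) = w^2 - K (y^2)" by (simp add: power2_eq_square algebra_simps)
    also have "\<dots> = T^3 - K x^3" unfolding y w_square_T by simp
    finally show ?thesis by (simp add: power2_eq_square power3_eq_cube algebra_simps)
  qed
  show "?A \<subseteq> (*) ?g ` R"
  proof (rule prd_least)
    show "0 \<in> (*) ?g ` R" by force
    show "u + v \<in> (*) ?g ` R" if "u \<in> (*) ?g ` R" "v \<in> (*) ?g ` R" for u v
      using that by (auto simp flip: distrib_left)
    fix i j assume "i \<in> pt_ideal (Affine x y)" "j \<in> pt_ideal (Affine x (- y))"
    then obtain r r' s s' where R: "r \<in> R" "r' \<in> R" "s \<in> R" "s' \<in> R"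
      and i: "i = r * ?g + r' * (w - K y)" and j: "j = s * ?g + s' * (w - K (- y))"
      by (auto elim!: pt_idealE)
    have "i * j = ?g * (r * s * ?g + r * s' * (w + K y) + r' * s * (w - K y))
        + r' * s' * ((w - K y) * (w + K y))"
      unfolding i j K_simps by (simp add: algebra_simps)
    also have "\<dots> = ?g * (r * s * ?g + r * s' * (w + K y) + r' * s * (w - K y)
        + r' * s' * (T^2 + T * K x + K x^2))"
      unfolding w2 by (simp add: algebra_simps)
    finally show "i * j \<in> (*) ?g ` R" using R by auto
  qed
  define J where "J = {r. ?g * r \<in> ?A}"
  have J: "is_module R J" unfolding J_def by (rule is_module_colon) (rule mod)
  note rules = module_rules[OF J]
  note gens = generators_in_pt_ideal[where x = x and y = y] generators_in_pt_ideal[where x = x and y = "- y"]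
  have "?g \<in> J" unfolding J_def using prd_times[OF gens(1,3)] by simp
  have 1: "w - K y \<in> J" unfolding J_def using prd_times[OF gens(2,3)] by (simp add: mult.commute[of ?g])
  have 2: "w + K y \<in> J" unfolding J_def using prd_times[OF gens(1,4)] by simp
  have 3: "T^2 + T * K x + K x^2 \<in> J" unfolding J_def using prd_times[OF gens(2,4)] w2 by simp
  show "1 \<in> J"
  proof (cases "y = 0")
    case False
    have "K (1 / (2 * y)) * ((w + K y) - (w - K y)) = K (1 / (2 * y)) * K (2 * y)" by simp
    also have "\<dots> = K (1 / (2 * y) * (2 * y))" by (simp only: K_simps)
    also have "\<dots> = 1" using False two by simp
    finally show ?thesis using rules(3)[OF _ rules(2)[OF 2 1], of "K (1 / (2 * y))"] by simp
  next
    case True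
    then have x: "x \<noteq> 0" using y b by auto
    \<comment> \<open>For \<open>y = 0\<close> the elements \<open>w - K y\<close> and
      \<open>w + K y\<close> coincide. Dividing the quadratic cofactor by \<open>T - x\<close>
      instead leaves the remainder \<open>3*x^2\<close>, the derivative of the cubic at
      \<open>x\<close>.\<close>
    have "(T^2 + T * K x + K x^2) - (T + 2 * K x) * ?g \<in> J"
      by (intro rules(2,3) 3 \<open>?g \<in> J\<close>) simp_all
    also have "(T^2 + T * K x + K x^2) - (T + 2 * K x) * ?g = K (3 * x^2)"
      by (simp add: power2_eq_square algebra_simps)
    finally have "K (1 / (3 * x^2)) * K (3 * x^2) \<in> J" by (intro rules(3)) simp_all
    also have "K (1 / (3 * x^2)) * K (3 * x^2) = K (1 / (3 * x^2) * (3 * x^2))" by (simp only: K_simps)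
    also have "\<dots> = 1" using x three by simp
    finally show ?thesis .
  qed
qed

text \<open>The divisor of the line \<open>w - (m*T + c)\<close> is the sum of its three
  intersection points. Only the symmetric functions of \<open>x1\<close>, \<open>x2\<close>,
  \<open>x3\<close> enter, so tangents and flexes are included.\<close>

lemma prd_pt_ideal_collinear:
  assumes e1: "x1 + x2 + x3 = m^2" and e2: "x1 * x2 + x1 * x3 + x2 * x3 = - 2 * m * c"
    and e3: "x1 * x2 * x3 = c^2 - b"
    and P: "on_curve b (Affine x1 (m * x1 + c))"
  shows "prd (prd (pt_ideal (Affine x1 (m * x1 + c))) (pt_ideal (Affine x2 (m * x2 + c))))
      (pt_ideal (Affine x3 (m * x3 + c))) = (*) (w - (K m * T + K c)) ` R"
    (is "prd (prd (?I x1) (?I x2)) (?I x3) = (*) ?g ` R")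
proof (rule principal_eqI)
  define U where "U = K m * T + K c"
  let ?A = "prd (prd (?I x1) (?I x2)) (?I x3)"
  show mod: "is_module R ?A" by (intro is_module_prd pt_ideal_module P)
  have UR [simp]: "U \<in> R" by (simp add: U_def)
  have K1: "K x1 + K x2 + K x3 = K m^2"
    using arg_cong[OF e1, of K] by simp
  have K2: "K x1 * K x2 + K x1 * K x3 + K x2 * K x3 = - 2 * K m * K c"
    using arg_cong[OF e2, of K] by simp
  have K3: "K x1 * K x2 * K x3 = K c^2 - K b"
    using arg_cong[OF e3, of K] by simp
  have prod: "(T - K x1) * (T - K x2) * (T - K x3) = (w - U) * (w + U)"
  proof -
    have "(T - K x1) * (T - K x2) * (T - K x3) = T^3 - (K x1 + K x2 + K x3) * T^2
        + (K x1 * K x2 + K x1 * K x3 + K x2 * K x3) * T - K x1 * K x2 * K x3"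
      by (simp add: power2_eq_square power3_eq_cube algebra_simps)
    also have "\<dots> = w^2 - U^2" unfolding K1 K2 K3 w_square_T U_def
      by (simp add: power2_eq_square power3_eq_cube algebra_simps)
    finally show ?thesis by (simp add: power2_eq_square algebra_simps)
  qed
  \<comment> \<open>On the line, \<open>w - y\<close> and \<open>w - U\<close> differ by the
    multiple \<open>m*(T - x)\<close> of the other generator, so the three ideals share the
    generator \<open>w - U\<close>.\<close>
  have gen: "\<exists>r\<in>R. \<exists>r'\<in>R. i = r * (T - K x) + r' * (w - U)" if "i \<in> ?I x" for i x
  proof -
    from that obtain r r' where "r \<in> R" "r' \<in> R" "i = r * (T - K x) + r' * (w - K (m * x + c))"
      by (rule pt_idealE)
    moreover from this have "i = (r + r' * K m) * (T - K x) + r' * (w - U)"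
      by (simp add: U_def algebra_simps)
    ultimately show ?thesis by (intro bexI[of _ "r + r' * K m"] bexI[of _ r']) auto
  qed
  have lin: "w - U \<in> ?I x" for x
  proof -
    show ?thesis unfolding U_def line_elt by (simp add: elt_in_pt_ideal_iff algebra_simps)
  qed
  have tx: "T - K x \<in> ?I x" for x by (rule generators_in_pt_ideal)
  let ?B = "{a * ((T - K x1) * (T - K x2)) + (w - U) * r | a r. a \<in> R \<and> r \<in> R}"
  have 12: "prd (?I x1) (?I x2) \<subseteq> ?B"
  proof (rule prd_least)
    show "0 \<in> ?B" by (intro CollectI exI[of _ 0]) simp
  next
    fix u v assume "u \<in> ?B" "v \<in> ?B"
    then obtain a r a' r' where R: "a \<in> R" "r \<in> R" "a' \<in> R" "r' \<in> R"
      and u: "u = a * ((T - K x1) * (T - K x2)) + (w - U) * r"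
      and v: "v = a' * ((T - K x1) * (T - K x2)) + (w - U) * r'" by blast
    show "u + v \<in> ?B" unfolding u v using R
      by (intro CollectI exI[of _ "a + a'"] exI[of _ "r + r'"]) (simp add: algebra_simps)
  next
    fix i j assume "i \<in> ?I x1" "j \<in> ?I x2"
    with gen obtain r r' s s' where R: "r \<in> R" "r' \<in> R" "s \<in> R" "s' \<in> R"
      and i: "i = r * (T - K x1) + r' * (w - U)" and j: "j = s * (T - K x2) + s' * (w - U)" by meson
    show "i * j \<in> ?B" unfolding i j using R
      by (intro CollectI exI[of _ "r * s"]
          exI[of _ "r * (T - K x1) * s' + r' * s * (T - K x2) + r' * (w - U) * s'"])
        (simp add: algebra_simps)
  qed
  show "?A \<subseteq> (*) ?g ` R" unfolding U_def[symmetric]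
  proof (rule prd_least)
    show "0 \<in> (*) (w - U) ` R" by force
    show "u + v \<in> (*) (w - U) ` R" if "u \<in> (*) (w - U) ` R" "v \<in> (*) (w - U) ` R" for u v
      using that by (auto simp flip: distrib_left)
    fix i j assume i: "i \<in> prd (?I x1) (?I x2)" and j: "j \<in> ?I x3"
    from i 12 obtain a r where *: "a \<in> R" "r \<in> R" "i = a * ((T - K x1) * (T - K x2)) + (w - U) * r"
      by blast
    from gen[OF j] obtain s s' where **: "s \<in> R" "s' \<in> R" "j = s * (T - K x3) + s' * (w - U)" by blast
    have "i * j = a * s * ((T - K x1) * (T - K x2) * (T - K x3))
      + (w - U) * (a * ((T - K x1) * (T - K x2)) * s' + r * j)"
      unfolding * ** by (simp add: algebra_simps)
    also have "\<dots> = (w - U) * (a * s * (w + U) + (a * ((T - K x1) * (T - K x2)) * s' + r * j))"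
      unfolding prod by (simp add: algebra_simps)
    finally show "i * j \<in> (*) (w - U) ` R" using * ** by auto
  qed
  define J where "J = {r. (w - U) * r \<in> ?A}"
  have J: "is_module R J" unfolding J_def by (rule is_module_colon) (rule mod)
  note rules = module_rules[OF J]
  have A: "i * j * k \<in> ?A" if "i \<in> ?I x1" "j \<in> ?I x2" "k \<in> ?I x3" for i j k
    by (intro prd_times that)
  have j1: "(w - U)^2 \<in> J" using A[OF lin lin lin] by (simp add: J_def power2_eq_square mult.assoc)
  have j2: "w + U \<in> J" using A[OF tx tx tx] by (simp add: J_def prod)
  \<comment> \<open>This sum is the derivative of \<open>(T - x1)*(T - x2)*(T - x3)\<close>, that
    is, of \<open>T^3 + b - U^2\<close>.\<close>
  have "(T - K x1) * (T - K x2) + (T - K x1) * (T - K x3) + (T - K x2) * (T - K x3) \<in> J"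
    using A[OF tx tx lin] A[OF tx lin tx] A[OF lin tx tx]
    by (intro rules(1)) (simp_all add: J_def mult_ac)
  also have "(T - K x1) * (T - K x2) + (T - K x1) * (T - K x3) + (T - K x2) * (T - K x3)
     = 3 * T^2 - 2 * (K x1 + K x2 + K x3) * T + (K x1 * K x2 + K x1 * K x3 + K x2 * K x3)"
    by (simp add: power2_eq_square algebra_simps)
  also have "\<dots> = 3 * T^2 - 2 * K m * U"
    unfolding K1 K2 U_def by (simp add: power2_eq_square algebra_simps)
  finally have j3: "3 * T^2 - 2 * K m * U \<in> J" .
  have inv: "u \<in> J" if "K a * u \<in> J" "a \<noteq> 0" for a u
  proof -
    have "K (1 / a) * (K a * u) \<in> J" by (intro rules(3) that) simp
    also have "K (1 / a) * (K a * u) = K (1 / a * a) * u" by (simp only: K_simps mult.assoc)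
    finally show ?thesis using that by simp
  qed
  have "(2 * 2 :: 'a) \<noteq> 0" using two by (simp only: mult_eq_0_iff) simp
  then have four: "(4::'a) \<noteq> 0" by simp
  have "(3 * 3 :: 'a) \<noteq> 0" using three by (simp only: mult_eq_0_iff) simp
  then have nine: "(9::'a) \<noteq> 0" by simp
  \<comment> \<open>The members of \<open>J\<close> found so far have no common zero:
    \<open>w = U\<close> and \<open>w = -U\<close> give \<open>U = w = 0\<close>, then
    \<open>3*T^2 = 2*m*U\<close> gives \<open>T = 0\<close>, and \<open>w^2 = T^3 + b\<close> would
    give \<open>b = 0\<close>. The remaining lines turn this argument into membership of 1.\<close>
  have "(w + U) * (w + U) - 2 * (w - U) * (w + U) + (w - U)^2 \<in> J"
    by (intro rules(1,2,3) j1 j2) simp_all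
  also have "(w + U) * (w + U) - 2 * (w - U) * (w + U) + (w - U)^2 = K 4 * U^2"
    by (simp add: power2_eq_square algebra_simps)
  finally have u2: "U^2 \<in> J" using inv four by blast
  have "(w - U) * (w + U) + U^2 \<in> J" by (intro rules j2 u2) simp_all
  also have "(w - U) * (w + U) + U^2 = T^3 + K b"
    using w_square_T by (simp add: power2_eq_square algebra_simps)
  finally have t3: "T^3 + K b \<in> J" .
  have "(3 * T^2 + 2 * K m * U) * (3 * T^2 - 2 * K m * U) + (4 * K m^2) * U^2 \<in> J"
    by (intro rules j3 u2) simp_all
  also have "(3 * T^2 + 2 * K m * U) * (3 * T^2 - 2 * K m * U) + (4 * K m^2) * U^2 = K 9 * T^4"
    by (simp add: eval_nat_numeral algebra_simps)
  finally have t4: "T^4 \<in> J" using inv nine by blast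
  have "T * (T^3 + K b) - T^4 \<in> J" by (intro rules t3 t4) simp_all
  also have "T * (T^3 + K b) - T^4 = K b * T" by (simp add: eval_nat_numeral algebra_simps)
  finally have t1: "T \<in> J" using inv b by blast
  have "(T^3 + K b) - T^2 * T \<in> J" by (intro rules t3 t1) simp_all
  also have "(T^3 + K b) - T^2 * T = K b * 1" by (simp add: eval_nat_numeral algebra_simps)
  finally have "1 \<in> J" using inv b by blast
  then show "1 \<in> {r. ?g * r \<in> ?A}" by (simp add: J_def U_def)
qed


text \<open>The norm of a generator divides the norm \<open>(X - x)^2\<close> of
  \<open>T - x\<close>. As degree 1 is impossible, the generator or its cofactor is a nonzero
  constant. A constant does not vanish at the point, and a scalar multiple of \<open>T - x\<close>
  does not divide \<open>w - y\<close>.\<close>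

lemma pt_ideal_not_principal: "\<not> same_class (pt_ideal (Affine x y)) R"
proof
  assume "same_class (pt_ideal (Affine x y)) R"
  then obtain c d where c: "c \<noteq> 0" "d \<noteq> 0" and e: "(*) c ` pt_ideal (Affine x y) = (*) d ` R"
    unfolding same_class_def by auto
  have "d * 1 \<in> (*) c ` pt_ideal (Affine x y)" unfolding e by (rule imageI) simp
  then obtain g where g: "g \<in> pt_ideal (Affine x y)" "d = c * g" by auto
  have factor: "\<exists>p' q'. i = g * elt p' q'" if "i \<in> pt_ideal (Affine x y)" for i
  proof -
    have "c * i \<in> (*) d ` R" unfolding e[symmetric] using that by (rule imageI)
    then obtain r where "r \<in> R" "c * i = c * (g * r)" by (auto simp: g(2) mult.assoc)
    then show ?thesis using c(1) by (auto simp: R_def)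
  qed
  obtain p q where pq: "g = elt p q" "poly p x + poly q x * y = 0"
    using g(1) by (auto simp: pt_ideal_def)
  from factor[OF generators_in_pt_ideal(1)] obtain p' q'
    where "elt [:- x, 1:] 0 = elt p q * elt p' q'" unfolding pq T_minus_K_elt by blast
  then have 1: "[:- x, 1:] = p * p' + q * q' * cub" "0 = p * q' + q * p'"
    by (simp_all add: elt_mult elt_eq_iff)
  from factor[OF generators_in_pt_ideal(2)] obtain p'' q''
    where "elt (- [:y:]) 1 = elt p q * elt p'' q''" unfolding pq w_minus_K_elt by blast
  then have 2: "1 = p * q'' + q * p''" by (simp add: elt_mult elt_eq_iff)
  have nm: "nm p q * nm p' q' = [:- x, 1:]^2"
    unfolding nm_mult[symmetric] 1[symmetric] by (simp add: nm_def)
  then have "nm p q * nm p' q' \<noteq> 0" by simp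
  then have n0: "nm p q \<noteq> 0" "nm p' q' \<noteq> 0" by auto
  have "degree (nm p q) + degree (nm p' q') = 2"
    using arg_cong[OF nm, of degree] n0 by (simp add: degree_mult_eq degree_power_eq)
  moreover have "p \<noteq> 0 \<or> q \<noteq> 0" "p' \<noteq> 0 \<or> q' \<noteq> 0" using n0 by (auto simp: nm_eq_0_iff)
  ultimately consider "degree (nm p q) = 0" "q = 0" | "degree (nm p' q') = 0" "q' = 0"
    using degree_nm[of p q] degree_nm[of p' q'] by fastforce
  then show False
  proof cases
    case 1
    then have "p \<noteq> 0" using n0 by (simp add: nm_def)
    moreover from this have "degree p = 0" using 1 by (simp add: nm_def degree_power_eq)
    moreover have "poly p x = 0" using pq 1 by simp
    ultimately show False by (auto elim!: degree_eq_zeroE)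
  next
    case u: 2
    then have p': "p' \<noteq> 0" using n0 by (simp add: nm_def)
    then have "degree p' = 0" using u by (simp add: nm_def degree_power_eq)
    have q: "q = 0" using 1(2) u p' by simp
    have "p \<noteq> 0" using q n0 by (simp add: nm_def)
    have "degree p + degree p' = 1"
      using arg_cong[OF 1(1), of degree] u \<open>p \<noteq> 0\<close> p' by (simp add: degree_mult_eq)
    moreover have "degree p = 0"
    proof -
      have "p * q'' = 1" using 2 q by simp
      then have "is_unit p" by (metis dvdI)
      then show ?thesis by (auto simp: is_unit_poly_iff)
    qed
    ultimately show False using \<open>degree p' = 0\<close> by simp
  qed
qed

section \<open>From ideal classes to the group axioms\<close>

declare same_class_trans [trans]

lemma same_class_principal:
  assumes "g \<noteq> 0" shows "same_class ((*) g ` I) I"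
  unfolding same_class_def by (intro exI[of _ 1] exI[of _ g]) (use assms in \<open>auto simp: image_image\<close>)

lemma prd_R: "is_module R I \<Longrightarrow> prd R I = I" "is_module R I \<Longrightarrow> prd I R = I"
  using prd_unit[OF _ R_one] by (auto simp: prd_commute[of I])

lemma prd_pt_ideal_neg_class:
  assumes "on_curve b P"
  shows "same_class (prd (pt_ideal P) (pt_ideal (point_neg P))) R"
proof (cases P)
  case Infinity
  then show ?thesis by (simp add: pt_ideal_def prd_R R_module same_class_refl)
next
  case (Affine x y)
  then show ?thesis
    using prd_pt_ideal_neg[of x y] same_class_principal[OF T_minus_K_neq_0, of _ R] assms by simp
qed

text \<open>With \<open>S = P + Q\<close>, the ideals of \<open>P\<close>, \<open>Q\<close> and
  \<open>-S\<close> have a principal product because the points are collinear; multiplying by the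
  ideal of \<open>S\<close> cancels that of \<open>-S\<close>.\<close>

lemma prd_pt_ideal_class:
  assumes P: "on_curve b P" and Q: "on_curve b Q"
  shows "same_class (prd (pt_ideal P) (pt_ideal Q)) (pt_ideal (point_add P Q))"
proof (cases "P = Infinity \<or> Q = Infinity")
  case True
  then show ?thesis
    using pt_ideal_module[OF P] pt_ideal_module[OF Q]
    by (cases P; cases Q) (auto simp: prd_R pt_ideal_def[of Infinity] same_class_refl)
next
  case False
  then obtain x1 y1 x2 y2 where PQ: "P = Affine x1 y1" "Q = Affine x2 y2"
    by (cases P; cases Q) auto
  show ?thesis
  proof (cases "x1 = x2 \<and> y1 = - y2")
    case True
    then have "Q = point_neg P" using PQ by simp
    then show ?thesis using prd_pt_ideal_neg_class[OF P] by (simp add: pt_ideal_def[of Infinity])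
  next
    case False
    obtain m c x3 where S: "point_add P Q = Affine x3 (- (m * x3 + c))"
      and y: "y1 = m * x1 + c" "y2 = m * x2 + c" and e: "x1 + x2 + x3 = m^2"
        "x1 * x2 + x1 * x3 + x2 * x3 = - 2 * m * c" "x1 * x2 * x3 = c^2 - b"
      using point_add_collinear[OF two P[unfolded PQ] Q[unfolded PQ] False] PQ by metis
    let ?S = "point_add P Q"
    let ?N = "point_neg ?S"
    have N: "?N = Affine x3 (m * x3 + c)" using S by simp
    have onS: "on_curve b ?S" by (rule on_curve_point_add[OF two P Q])
    have mS: "is_module R (pt_ideal ?S)" by (rule pt_ideal_module[OF onS])
    have mPQ: "is_module R (prd (pt_ideal P) (pt_ideal Q))"
      by (intro is_module_prd pt_ideal_module P)
    define g where "g = w - (K m * T + K c)"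
    have "prd (prd (pt_ideal P) (pt_ideal Q)) (pt_ideal ?N) = (*) g ` R"
      unfolding N unfolding PQ y g_def by (rule prd_pt_ideal_collinear[OF e]) (use P PQ y in simp)
    moreover have "g \<noteq> 0"
    proof
      assume "g = 0"
      moreover have "g = elt (- [:c, m:]) 1" unfolding g_def by (rule line_elt)
      moreover have "0 = elt 0 0" by (simp add: elt_def)
      ultimately show False by (metis elt_eq_iff zero_neq_one)
    qed
    ultimately have principal: "same_class (prd (prd (pt_ideal P) (pt_ideal Q)) (pt_ideal ?N)) R"
      using same_class_principal[of g R] by simp
    have "same_class (prd (prd (prd (pt_ideal P) (pt_ideal Q)) (pt_ideal ?N)) (pt_ideal ?S)) (pt_ideal ?S)"
      using same_class_prd_left[OF principal, of "pt_ideal ?S"] by (simp add: prd_R mS)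
    moreover have "same_class (prd (pt_ideal ?N) (pt_ideal ?S)) R"
      using prd_pt_ideal_neg_class[OF onS] by (simp add: prd_commute)
    then have "same_class (prd (prd (prd (pt_ideal P) (pt_ideal Q)) (pt_ideal ?N)) (pt_ideal ?S))
        (prd (prd (pt_ideal P) (pt_ideal Q)) R)"
      unfolding prd_assoc[of _ "pt_ideal ?N"] by (intro same_class_prd same_class_refl)
    ultimately have "same_class (prd (prd (pt_ideal P) (pt_ideal Q)) R) (pt_ideal ?S)"
      by (rule same_class_trans[OF same_class_sym, rotated])
    then show ?thesis by (simp only: prd_R(2)[OF mPQ])
  qed
qed

text \<open>Multiplying by the ideal of \<open>-Q\<close> makes the class of \<open>P - Q\<close>
  trivial, and only \<open>Infinity\<close> has trivial class. No group axiom enters, so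
  associativity may be deduced from this without circularity.\<close>

lemma pt_ideal_class_inj:
  assumes P: "on_curve b P" and Q: "on_curve b Q" and c: "same_class (pt_ideal P) (pt_ideal Q)"
  shows "P = Q"
proof (rule point_add_neg_eq_InfinityD)
  note N = on_curve_point_neg[OF Q]
  note same_class_sym[OF prd_pt_ideal_class[OF P N]]
  also note same_class_prd_left[OF c]
  also note prd_pt_ideal_neg_class[OF Q]
  finally show "point_add P (point_neg Q) = Infinity"
    using pt_ideal_not_principal by (cases "point_add P (point_neg Q)") auto
qed

lemma point_add_commute:
  assumes P: "on_curve b P" and Q: "on_curve b Q"
  shows "point_add P Q = point_add Q P"
proof (rule pt_ideal_class_inj)
  note same_class_sym[OF prd_pt_ideal_class[OF P Q]]
  also note prd_pt_ideal_class[OF Q P, unfolded prd_commute[of "pt_ideal Q"]]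
  finally show "same_class (pt_ideal (point_add P Q)) (pt_ideal (point_add Q P))" .
qed (intro on_curve_point_add two assms)+

lemma point_add_assoc:
  assumes P: "on_curve b P" and Q: "on_curve b Q" and S: "on_curve b S"
  shows "point_add (point_add P Q) S = point_add P (point_add Q S)"
proof (rule pt_ideal_class_inj)
  note add = on_curve_point_add[OF two]
  show "on_curve b (point_add (point_add P Q) S)" "on_curve b (point_add P (point_add Q S))"
    by (intro add assms)+
  note same_class_sym[OF prd_pt_ideal_class[OF add[OF P Q] S]]
  also note same_class_sym[OF same_class_prd_left[OF prd_pt_ideal_class[OF P Q]]]
  also note same_class_prd[OF same_class_refl prd_pt_ideal_class[OF Q S], folded prd_assoc]
  also note prd_pt_ideal_class[OF P add[OF Q S]]
  finally show "same_class (pt_ideal (point_add (point_add P Q) S)) (pt_ideal (point_add P (point_add Q S)))" .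
qed

lemma comm_group_curve_group: "comm_group (curve_group b)"
proof (rule comm_groupI)
  show "\<exists>y\<in>carrier (curve_group b). y \<otimes>\<^bsub>curve_group b\<^esub> x = \<one>\<^bsub>curve_group b\<^esub>"
    if "x \<in> carrier (curve_group b)" for x
    using that on_curve_point_neg[of b x] point_add_commute[of "point_neg x" x]
    by (intro bexI[of _ "point_neg x"]) (simp_all add: curve_group_def)
qed (auto simp: curve_group_def on_curve_point_add[OF two] point_add_assoc
    on_curve_def[of b Infinity] intro: point_add_commute)

end


section \<open>Local analysis of cubes at the roots of \<open>f\<close>\<close>

lemma order_power': "p \<noteq> 0 \<Longrightarrow> order z (p ^ n) = n * order z p" for p :: "'a::idom poly"
  by (induction n) (simp_all add: order_mult)

lemma order_add_less:
  fixes p q :: "'a::field poly"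
  assumes "p \<noteq> 0" "q = 0 \<or> order z p < order z q"
  shows "p + q \<noteq> 0 \<and> order z (p + q) = order z p"
proof (cases "q = 0")
  case False
  let ?L = "[:- z, 1:]"
  have lt: "order z p < order z q" using assms False by auto
  have n: "\<not> ?L ^ Suc (order z p) dvd p" using order_2[OF assms(1)] .
  have q: "?L ^ Suc (order z p) dvd q" unfolding order_divides using lt by simp
  have nn: "\<not> ?L ^ Suc (order z p) dvd p + q" using n q dvd_add_left_iff by blast
  have "?L ^ order z p dvd p + q"
    by (intro dvd_add order_1) (use lt in \<open>simp add: order_divides\<close>)
  then have "p + q \<noteq> 0" "order z p \<le> order z (p + q)" using nn unfolding order_divides by auto
  moreover have "order z (p + q) \<le> order z p" using nn unfolding order_divides by auto
  ultimately show ?thesis by simp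
qed (use assms in simp)

lemma numeral_mult_poly: "numeral k * p = smult (numeral k) (p :: 'a::comm_ring_1 poly)"
  unfolding numeral_poly by simp

text \<open>Put \<open>u = A/C\<close> and \<open>v = B/C\<close>, so that
  \<open>(u + v*sqrt f)^3 = Y + g*sqrt f\<close>, and let \<open>n = u^2 - v^2*f\<close>, so that
  \<open>n^3 = V^3\<close>. Suppose \<open>v\<close> has a pole at \<open>z\<close>. From
  \<open>Y = u*(4*u^2 - 3*n)\<close> it follows that \<open>u\<close> is integral at
  \<open>z\<close>, hence so is \<open>v^2*f = u^2 - n\<close>. This forces
  \<open>order z f \<ge> 3\<close>, and the order of \<open>v^2*f\<close>, being odd, is positive.
  Since \<open>g = v*(3*u^2 + v^2*f)\<close> is integral, the bracket vanishes at \<open>z\<close>;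
  so \<open>u\<close> vanishes, and with it \<open>n\<close>. If \<open>order z f = 3\<close>, the
  pole is simple, \<open>v^2*f\<close> has a simple zero, and therefore so has
  \<open>n\<close>.\<close>

lemma cube_order:
  fixes A B C Y g V f :: "'a::field poly"
  assumes two: "(2::'a) \<noteq> 0" and three: "(3::'a) \<noteq> 0" and nz: "C \<noteq> 0" "V \<noteq> 0" "f \<noteq> 0" "B \<noteq> 0"
    and re: "A^3 + 3 * (A * B^2 * f) = C^3 * Y" and im: "3 * (A^2 * B) + B^3 * f = C^3 * g"
    and VY: "Y^2 - g^2 * f = V^3"
    and ord: "order z f \<in> {0, 1, 3, 5}" and less: "order z B < order z C"
  shows "order z V \<ge> 1 \<and> order z f \<ge> 3 \<and>
    (order z f = 3 \<longrightarrow> order z C = order z B + 1 \<and> order z V = 1)"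
proof -
  let ?L = "[:- z, 1:]"
  have "(2 * 2 :: 'a) \<noteq> 0" using two by (simp only: mult_eq_0_iff) simp
  then have four: "(4::'a) \<noteq> 0" by simp
  define N E where "N = A^2 - B^2 * f" and "E = B^2 * f"
  have "N^3 = (A^3 + 3 * (A * B^2 * f))^2 - (3 * (A^2 * B) + B^3 * f)^2 * f"
    unfolding N_def by (simp add: eval_nat_numeral algebra_simps)
  also have "\<dots> = C^6 * (Y^2 - g^2 * f)"
    unfolding re im by (simp add: eval_nat_numeral algebra_simps)
  finally have N3: "N^3 = C^6 * V^3" unfolding VY .
  have N0: "N \<noteq> 0" using N3 nz by auto
  define \<alpha> \<beta> \<gamma> \<phi> \<xi> where "\<alpha> = order z A" and "\<beta> = order z B" and "\<gamma> = order z C"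
    and "\<phi> = order z f" and "\<xi> = order z V"
  have oN: "order z N = 2 * \<gamma> + \<xi>"
    using arg_cong[OF N3, of "order z"] nz N0 by (simp add: order_power' order_mult \<gamma>_def \<xi>_def)
  have E0: "E \<noteq> 0" and oE: "order z E = 2 * \<beta> + \<phi>"
    using nz by (simp_all add: E_def order_mult order_power' \<beta>_def \<phi>_def)
  have A\<gamma>: "\<gamma> \<le> \<alpha>" if "A \<noteq> 0"
  proof (rule ccontr)
    assume "\<not> \<gamma> \<le> \<alpha>"
    then have lt: "\<alpha> < \<gamma>" by simp
    have eq: "A * (smult 4 (A^2) + smult (- 3) N) = C^3 * Y"
      unfolding re[symmetric] N_def
      by (simp flip: numeral_mult_poly) (simp add: eval_nat_numeral algebra_simps)
    have "order z (smult 4 (A^2)) = 2 * \<alpha>" "smult 4 (A^2) \<noteq> 0"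
      using four that by (simp_all add: order_smult order_power' \<alpha>_def)
    moreover have "order z (smult (- 3) N) = 2 * \<gamma> + \<xi>" using three by (simp add: order_smult oN)
    ultimately have *: "smult 4 (A^2) + smult (- 3) N \<noteq> 0"
      "order z (smult 4 (A^2) + smult (- 3) N) = 2 * \<alpha>"
      using order_add_less[of "smult 4 (A^2)" "smult (- 3) N" z] lt by auto
    then have ne: "C^3 * Y \<noteq> 0" using that unfolding eq[symmetric] by simp
    have "3 * \<alpha> = order z (C^3 * Y)"
      unfolding eq[symmetric] using * that by (subst order_mult) (simp_all add: \<alpha>_def)
    also have "\<dots> \<ge> 3 * \<gamma>" using ne nz by (simp add: order_mult order_power' \<gamma>_def)
    finally show False using lt by simp
  qed
  have dA: "?L ^ (2 * \<gamma>) dvd A^2"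
    using A\<gamma> by (cases "A = 0") (simp_all add: order_divides order_power' \<alpha>_def)
  have "?L ^ (2 * \<gamma>) dvd A^2 - N"
    by (rule dvd_diff[OF dA]) (use N0 oN in \<open>simp add: order_divides\<close>)
  then have "2 * \<gamma> \<le> 2 * \<beta> + \<phi>"
    using E0 oE unfolding N_def E_def by (simp add: order_divides)
  \<comment> \<open>\<open>2*\<beta> + \<phi>\<close> is odd, so the inequality gains 1.\<close>
  then have \<phi>: "\<phi> \<in> {3, 5}" and E1: "2 * \<gamma> + 1 \<le> 2 * \<beta> + \<phi>"
    using ord less by (auto simp: \<phi>_def \<beta>_def \<gamma>_def) presburger+
  have eqB: "B * (3 * A^2 + E) = C^3 * g"
    unfolding im[symmetric] E_def by (simp add: eval_nat_numeral algebra_simps)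
  have "?L ^ (3 * \<gamma>) dvd B * (3 * A^2 + E)"
    unfolding eqB by (rule dvd_mult2) (use nz in \<open>simp add: order_divides order_power' \<gamma>_def\<close>)
  then have "?L ^ (2 * \<gamma> + 1) dvd 3 * A^2 + E"
    using nz less unfolding order_divides
    by (cases "3 * A^2 + E = 0") (simp_all add: order_mult \<gamma>_def)
  moreover have dE: "?L ^ (2 * \<gamma> + 1) dvd E" using E1 oE by (simp only: order_divides) simp
  ultimately have "?L ^ (2 * \<gamma> + 1) dvd 3 * A^2" using dvd_add_left_iff by blast
  then have "?L ^ (2 * \<gamma> + 1) dvd A^2" using three unfolding numeral_mult_poly
    by (metis dvd_smult_cancel)
  \<comment> \<open>Squares have even order, so \<open>2*\<gamma> + 1\<close> improves to
    \<open>2*\<gamma> + 2\<close>.\<close>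
  then have dA': "?L ^ (2 * \<gamma> + 2) dvd A^2"
    unfolding order_divides by (cases "A = 0") (simp_all add: order_power', presburger)
  have "?L ^ (2 * \<gamma> + 1) dvd N"
    unfolding N_def E_def[symmetric]
    by (rule dvd_diff[OF dvd_trans[OF le_imp_power_dvd dA'] dE]) simp
  then have \<xi>: "1 \<le> \<xi>" using N0 oN unfolding order_divides by simp
  moreover have "\<gamma> = \<beta> + 1 \<and> \<xi> = 1" if "\<phi> = 3"
  proof
    show \<gamma>: "\<gamma> = \<beta> + 1" using E1 less that by (simp add: \<beta>_def \<gamma>_def)
    show "\<xi> = 1"
    proof (rule ccontr)
      assume "\<xi> \<noteq> 1"
      then have "?L ^ (2 * \<gamma> + 2) dvd N" using N0 oN \<xi> unfolding order_divides by simp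
      then have "?L ^ (2 * \<gamma> + 2) dvd A^2 - N" using dA' dvd_diff by blast
      then show False using E0 oE \<gamma> that unfolding N_def E_def order_divides by simp
    qed
  qed
  ultimately show ?thesis using \<phi> by (auto simp: \<beta>_def \<gamma>_def \<phi>_def \<xi>_def)
qed

lemma degree_pderiv_less_eq: "degree (pderiv p) \<le> degree p - 1"
  by (rule degree_le) (auto simp: coeff_pderiv coeff_eq_0)

text \<open>Parity at infinity. The weights cover both the norm \<open>A^2 - E\<close> and the
  factor \<open>3*A^2 + E\<close>, which therefore have equal degree.\<close>

lemma degree_odd_sum:
  fixes A E :: "'a::field poly"
  assumes "E \<noteq> 0" "odd (degree E)" "c \<noteq> 0" "e \<noteq> 0"
  shows "smult c (A^2) + smult e E \<noteq> 0 \<and>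
    degree (smult c (A^2) + smult e E) = max (2 * degree A) (degree E)"
proof (cases "A = 0")
  case False
  have a: "degree (smult c (A^2)) = 2 * degree A" "degree (smult e E) = degree E"
    using assms False by (simp_all add: degree_power_eq)
  have ne: "2 * degree A \<noteq> degree E" using assms by presburger
  then have "degree (smult c (A^2) + smult e E) = max (2 * degree A) (degree E)"
    using degree_add_eq_left[of "smult e E" "smult c (A^2)"]
      degree_add_eq_right[of "smult c (A^2)" "smult e E"] a
    by (cases "2 * degree A < degree E") (simp_all add: max_def)
  moreover have "degree E > 0" using assms(2) by (cases "degree E") auto
  ultimately show ?thesis by auto
qed (use assms in auto)

lemma cube_degree:
  fixes A B C Y g V f :: "'a::field poly"
  assumes three: "(3::'a) \<noteq> 0" and nz: "C \<noteq> 0" "V \<noteq> 0" "f \<noteq> 0" "B \<noteq> 0"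
    and re: "A^3 + 3 * (A * B^2 * f) = C^3 * Y" and im: "3 * (A^2 * B) + B^3 * f = C^3 * g"
    and VY: "Y^2 - g^2 * f = V^3" and odd: "odd (degree f)"
  shows "degree B + degree V = degree C + degree g"
proof -
  define N E where "N = A^2 - B^2 * f" and "E = B^2 * f"
  have "N^3 = (A^3 + 3 * (A * B^2 * f))^2 - (3 * (A^2 * B) + B^3 * f)^2 * f"
    unfolding N_def by (simp add: eval_nat_numeral algebra_simps)
  also have "\<dots> = C^6 * (Y^2 - g^2 * f)"
    unfolding re im by (simp add: eval_nat_numeral algebra_simps)
  finally have N3: "N^3 = C^6 * V^3" unfolding VY .
  then have N0: "N \<noteq> 0" using nz by auto
  have dN: "degree N = 2 * degree C + degree V"
    using arg_cong[OF N3, of degree] nz N0 by (simp add: degree_power_eq degree_mult_eq)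
  have E: "E \<noteq> 0" "odd (degree E)"
    using nz odd by (simp_all add: E_def degree_mult_eq degree_power_eq)
  have "N = smult 1 (A^2) + smult (- 1) E" by (simp add: N_def E_def)
  then have *: "degree N = max (2 * degree A) (degree E)"
    using degree_odd_sum[OF E, of 1 "- 1" A] by simp
  have eqB: "B * (smult 3 (A^2) + smult 1 E) = C^3 * g"
    unfolding im[symmetric] E_def
    by (simp flip: numeral_mult_poly) (simp add: eval_nat_numeral algebra_simps)
  have **: "smult 3 (A^2) + smult 1 E \<noteq> 0" "degree (smult 3 (A^2) + smult 1 E) = degree N"
    using degree_odd_sum[OF E, of 3 1 A] three * by simp_all
  then have "C^3 * g \<noteq> 0" unfolding eqB[symmetric] using nz by simp
  moreover have "degree (C^3 * g) = degree B + degree N"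
    unfolding eqB[symmetric] using ** nz by (subst degree_mult_eq) simp_all
  ultimately show ?thesis using dN nz by (simp add: degree_mult_eq degree_power_eq)
qed

lemma degree_mono_order:
  fixes p q :: "'a::alg_closed_field poly"
  assumes "p \<noteq> 0" "q \<noteq> 0" "\<And>z. order z p \<le> order z q"
  shows "degree p \<le> degree q"
  using assms
proof (induction "degree p" arbitrary: p q)
  case (Suc n)
  from Suc(2) obtain z where z: "poly p z = 0"
    using alg_closed_imp_poly_has_root[of p] by auto
  then have "order z p \<noteq> 0" using Suc.prems order_root[of p z] by simp
  then have "order z q \<noteq> 0" using Suc.prems(3)[of z] by simp
  then have "poly q z = 0" using order_root[of q z] by simp
  with z obtain p' q' where pq: "p = [:- z, 1:] * p'" "q = [:- z, 1:] * q'"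
    unfolding poly_eq_0_iff_dvd dvd_def by blast
  have n0: "p' \<noteq> 0" "q' \<noteq> 0" using pq Suc.prems by auto
  have d: "degree p = Suc (degree p')" "degree q = Suc (degree q')"
    unfolding pq using n0 by (simp_all add: degree_mult_eq del: mult_pCons_left)
  have "order x p' \<le> order x q'" for x
    using Suc.prems(3)[of x] Suc.prems(1,2) unfolding pq by (simp add: order_mult del: mult_pCons_left)
  then show ?case using Suc(1)[of p' q'] n0 Suc(2) d by simp
qed simp


section \<open>Integral points\<close>

text \<open>\<open>y\<close> vanishes at \<open>z\<close> as well. If the orders of
  \<open>y^2\<close> and \<open>x^3\<close> differ, the smaller one is the order of
  \<open>f\<close>, and among 1, 3, 5 only 3 is even or a multiple of 3. If they agree, both are at
  least 6, which is too much for \<open>f\<close>.\<close>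

lemma order_integral_point:
  fixes x y f :: "'a::field poly"
  assumes eq: "y^2 = x^3 + f" and nz: "x \<noteq> 0" "f \<noteq> 0"
    and ord: "order z f \<in> {0, 1, 3, 5}" "order z f \<noteq> 0" and x: "poly x z = 0"
  shows "order z f = 3 \<and> order z x = 1"
proof (cases "y = 0")
  case True
  then have "f = - (x^3)" using eq by (simp add: eq_neg_iff_add_eq_0 add.commute)
  then show ?thesis using ord nz by (auto simp: order_power')
next
  case False
  have ox: "order z x \<noteq> 0" using x nz order_root by blast
  have "poly f z = 0" using ord nz order_root by blast
  then have "poly y z = 0" using arg_cong[OF eq, of "\<lambda>p. poly p z"] x by simp
  then have oy: "order z y \<noteq> 0" using False order_root by blast
  have y2: "order z (y^2) = 2 * order z y" "y^2 \<noteq> 0" and x3: "order z (- (x^3)) = 3 * order z x" "- (x^3) \<noteq> 0"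
    using False nz by (simp_all add: order_power')
  have f: "f = y^2 + - (x^3)" "f = - (x^3) + y^2" using eq by simp_all
  consider "2 * order z y < 3 * order z x" | "3 * order z x < 2 * order z y"
    | "2 * order z y = 3 * order z x" by linarith
  then show ?thesis
  proof cases
    case 1
    then have "order z f = 2 * order z y" using order_add_less[OF y2(2), of "- (x^3)" z] y2 x3 f(1) by simp
    then show ?thesis using ord by auto presburger+
  next
    case 2
    then have "order z f = 3 * order z x" using order_add_less[OF x3(2), of "y^2" z] y2 x3 f(2) by simp
    then show ?thesis using ord by auto
  next
    case 3
    then have "3 * order z x \<ge> 6" using ox oy by presburger
    then have "[:- z, 1:] ^ 6 dvd y^2 + - (x^3)"
      using 3 y2 x3 by (intro dvd_add) (simp_all only: order_divides, simp_all)
    then have "6 \<le> order z f" using nz unfolding f(1)[symmetric] order_divides by simp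
    then show ?thesis using ord by auto
  qed
qed

text \<open>If \<open>f\<close> dominated \<open>x^3\<close>, its odd degree would equal the even
  degree of \<open>y^2\<close>. This is the source of \<open>d/6 \<le> h(P)\<close>, and it shows
  that \<open>x\<close> alone decides the height.\<close>

lemma degree_integral_point:
  fixes x y f :: "'a::field poly"
  assumes eq: "y^2 = x^3 + f" and odd: "odd (degree f)"
  shows "degree f \<le> 3 * degree x \<and> 2 * degree y \<le> 3 * degree x \<and> x \<noteq> 0"
proof -
  have y2: "degree (y^2) = 2 * degree y" by (cases "y = 0") (simp_all add: degree_power_eq)
  have x3: "degree (x^3) = 3 * degree x" by (cases "x = 0") (simp_all add: degree_power_eq)
  have *: "degree f \<le> 3 * degree x"
  proof (rule ccontr)
    assume "\<not> degree f \<le> 3 * degree x"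
    then have "degree (x^3 + f) = degree f" using x3 by (intro degree_add_eq_right) simp
    then have "degree f = 2 * degree y" using y2 eq by simp
    then show False using odd by simp
  qed
  moreover have "2 * degree y \<le> 3 * degree x"
    using y2 x3 * degree_add_le_max[of "x^3" f] unfolding eq by simp
  moreover have "x \<noteq> 0" using * odd by (cases "degree f") auto
  ultimately show ?thesis by blast
qed

text \<open>Davenport's inequality. The Wronskian of \<open>x\<^sup>3\<close> and \<open>y\<^sup>2\<close> could vanish identically in positive
  characteristic, but not if \<open>f\<close> has a simple root.\<close>

lemma degree_integral_point_upper:
  fixes x y f :: "'a::field poly"
  assumes eq: "y^2 = x^3 + f" and odd: "odd (degree f)" and simple: "order z f = 1"
  shows "degree x + 2 \<le> 2 * degree f"
proof -
  have f0: "f \<noteq> 0" using odd by auto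
  have "[:- z, 1:] dvd f" using order_1[of z f] simple by simp
  then obtain h where h: "f = [:- z, 1:] * h" by (auto simp: dvd_def)
  have h0: "h \<noteq> 0" using h f0 by auto
  have "order z f = order z [:- z, 1:] + order z h"
    unfolding h using f0 h by (intro order_mult) simp
  moreover have "order z [:- z, 1:] = 1" using order_power_n_n[of z 1] by simp
  ultimately have "order z h = 0" using simple by simp
  then have hz: "poly h z \<noteq> 0" using h0 order_root by blast
  have f'z: "poly (pderiv f) z = poly h z"
  proof -
    have "pderiv f = [:- z, 1:] * pderiv h + h * pderiv [:- z, 1:]" unfolding h by (rule pderiv_mult)
    then show ?thesis by (simp add: pderiv_pCons)
  qed
  have fz: "poly f z = 0" unfolding h by simp
  have d: "pderiv f = 2 * y * pderiv y - 3 * x^2 * pderiv x"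
    using arg_cong[OF eq, of pderiv]
    by (simp add: pderiv_add pderiv_power power2_eq_square numeral_mult_poly pderiv_mult power3_eq_cube algebra_simps)
  \<comment> \<open>\<open>x^2 * y * W\<close> is the Wronskian of \<open>x^3\<close> and
    \<open>y^2\<close>; the factor \<open>x^2 * y\<close> is removed beforehand.\<close>
  define W where "W = 2 * x * pderiv y - 3 * pderiv x * y"
  have f: "f = y^2 - x^3" using eq by simp
  have i1: "pderiv f * y - 2 * f * pderiv y = x^2 * W"
    unfolding d unfolding f W_def by (simp add: eval_nat_numeral algebra_simps)
  have i2: "pderiv f * x - 3 * f * pderiv x = y * W"
    unfolding d unfolding f W_def by (simp add: eval_nat_numeral algebra_simps)
  have W0: "W \<noteq> 0"
  proof
    assume "W = 0"
    \<comment> \<open>The derivative of \<open>f\<close> does not vanish at the simple root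
      \<open>z\<close>, so \<open>x\<close> and \<open>y\<close> both vanish there, and
      \<open>f = y^2 - x^3\<close> would have a double root.\<close>
    then have "pderiv f * y = 2 * f * pderiv y" "pderiv f * x = 3 * f * pderiv x"
      using i1 i2 by simp_all
    from arg_cong[OF this(1), of "\<lambda>p. poly p z"] arg_cong[OF this(2), of "\<lambda>p. poly p z"]
    have xy: "poly x z = 0" "poly y z = 0" using fz f'z hz by simp_all
    have "[:- z, 1:]^2 dvd y^2" "[:- z, 1:]^2 dvd x^3"
      using xy unfolding poly_eq_0_iff_dvd
      by (auto intro: dvd_power_same intro: dvd_trans[OF dvd_power_same le_imp_power_dvd, of _ _ 2])
    then have "[:- z, 1:]^2 dvd f" unfolding f by (rule dvd_diff)
    then show False using f0 simple by (simp add: order_divides)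
  qed
  note x = degree_integral_point[OF eq odd]
  have "degree (pderiv f * y - 2 * f * pderiv y) \<le> degree f + degree y - 1"
  proof (rule degree_diff_le)
    have df: "degree f > 0" using odd by (cases "degree f") auto
    show "degree (pderiv f * y) \<le> degree f + degree y - 1"
      using degree_mult_le[of "pderiv f" y] degree_pderiv_less_eq[of f] df by linarith
    show "degree (2 * f * pderiv y) \<le> degree f + degree y - 1"
    proof (cases "degree y = 0")
      case True
      then have "pderiv y = 0" by (auto elim!: degree_eq_zeroE simp: pderiv_pCons)
      then show ?thesis by simp
    next
      case False
      have "degree (2 * f * pderiv y) \<le> degree (f * pderiv y)"
        by (simp add: numeral_mult_poly mult.assoc degree_smult_le)
      also have "\<dots> \<le> degree f + degree (pderiv y)" by (rule degree_mult_le)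
      finally show ?thesis using degree_pderiv_less_eq[of y] False by linarith
    qed
  qed
  \<comment> \<open>Combined with \<open>2*degree y \<le> 3*degree x\<close> this gives
    \<open>4*degree x \<le> 2*degree f + 3*degree x - 2\<close>.\<close>
  then have "2 * degree x \<le> degree f + degree y - 1"
    unfolding i1 using W0 x by (simp add: degree_mult_eq degree_power_eq)
  then show ?thesis using x odd by (cases "degree f") auto
qed

text \<open>At a pole of \<open>B/C\<close> one of \<open>x1\<close>, \<open>x2\<close> vanishes at
  a multiple root of \<open>f\<close>, which by \<open>order_integral_point\<close> is a triple
  root. By assumption both then vanish, so \<open>x1 * x2\<close> has order at least 2, whereas
  \<open>cube_order\<close> demands order 1. Hence \<open>B/C\<close> has no poles.\<close>

lemma degree_of_cube_quotient:
  fixes A B C x1 y1 x2 y2 f :: "'a::alg_closed_field poly"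
  assumes two: "(2::'a) \<noteq> 0" and three: "(3::'a) \<noteq> 0" and C: "C \<noteq> 0"
    and re: "A^3 + 3 * (A * B^2 * f) = C^3 * (y1 * y2 - f)"
    and im: "3 * (A^2 * B) + B^3 * f = C^3 * (y2 - y1)"
    and P: "y1^2 = x1^3 + f" and Q: "y2^2 = x2^3 + f"
    and odd: "odd (degree f)" and ord: "\<And>z. order z f \<in> {0, 1, 3, 5}"
    and same: "\<And>z. order z f = 3 \<Longrightarrow> poly x1 z = 0 \<longleftrightarrow> poly x2 z = 0"
    and ne: "y1 \<noteq> y2"
  shows "degree x1 + degree x2 \<le> degree (y2 - y1)"
proof -
  have f0: "f \<noteq> 0" using odd by auto
  have B0: "B \<noteq> 0" using im C ne by auto
  have x0: "x1 \<noteq> 0" "x2 \<noteq> 0"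
    using degree_integral_point[OF P odd] degree_integral_point[OF Q odd] by auto
  then have V0: "x1 * x2 \<noteq> 0" by simp
  have "(y1 * y2 - f)^2 - (y2 - y1)^2 * f = (y1^2 - f) * (y2^2 - f)"
    by (simp add: power2_eq_square algebra_simps)
  then have VY: "(y1 * y2 - f)^2 - (y2 - y1)^2 * f = (x1 * x2)^3"
    unfolding P Q by (simp add: power_mult_distrib)
  have "order z C \<le> order z B" for z
  proof (rule ccontr)
    assume "\<not> order z C \<le> order z B"
    then have less: "order z B < order z C" by simp
    note c = cube_order[OF two three C V0 f0 B0 re im VY ord less]
    then have "poly (x1 * x2) z = 0" using order_root[of "x1 * x2" z] by auto
    then have "poly x1 z = 0 \<or> poly x2 z = 0" by simp
    then have f3: "order z f = 3"
      using order_integral_point[OF P x0(1) f0 ord, of z] order_integral_point[OF Q x0(2) f0 ord, of z] c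
      by auto
    then have "order z x1 \<noteq> 0" "order z x2 \<noteq> 0"
      using same \<open>poly x1 z = 0 \<or> poly x2 z = 0\<close> x0 order_root by blast+
    then show False using c f3 V0 by (simp add: order_mult)
  qed
  then have "degree C \<le> degree B" using degree_mono_order C B0 by blast
  then show ?thesis using cube_degree[OF three C V0 f0 B0 re im VY odd] V0
    by (simp add: degree_mult_eq)
qed

text \<open>Here \<open>B/C\<close> may have simple poles at triple roots of \<open>f\<close>. The
  polynomial \<open>h\<close>, later \<open>f3\<close>, absorbs them, so
  \<open>degree x \<le> degree h\<close>; this contradicts
  \<open>degree f \<le> 3*degree x\<close>.\<close>

lemma integral_point_not_cube:
  fixes A B C x y f h :: "'a::alg_closed_field poly"
  assumes two: "(2::'a) \<noteq> 0" and three: "(3::'a) \<noteq> 0" and C: "C \<noteq> 0"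
    and re: "A^3 + 3 * (A * B^2 * f) = C^3 * y"
    and im: "3 * (A^2 * B) + B^3 * f = C^3"
    and P: "y^2 = x^3 + f"
    and odd: "odd (degree f)" and ord: "\<And>z. order z f \<in> {0, 1, 3, 5}"
    and h: "h \<noteq> 0" "\<And>z. order z f = 3 \<Longrightarrow> poly h z = 0" "3 * degree h < degree f"
  shows False
proof -
  have f0: "f \<noteq> 0" using odd by auto
  have B0: "B \<noteq> 0" using im C by auto
  have x0: "x \<noteq> 0" using degree_integral_point[OF P odd] by auto
  have VY: "y^2 - 1^2 * f = x^3" using P by simp
  have im': "3 * (A^2 * B) + B^3 * f = C^3 * 1" using im by simp
  have "order z C \<le> order z (B * h)" for z
  proof (cases "order z B < order z C")
    case True
    note c = cube_order[OF two three C x0 f0 B0 re im' VY ord True]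
    then have "poly x z = 0" using order_root[of x z] by auto
    then have f3: "order z f = 3" using order_integral_point[OF P x0 f0 ord, of z] c by auto
    then have "order z h \<noteq> 0" using h order_root by blast
    then show ?thesis using c f3 B0 h by (simp add: order_mult)
  next
    case False
    then show ?thesis using B0 h by (simp add: order_mult)
  qed
  then have "degree C \<le> degree B + degree h"
    using degree_mono_order[of C "B * h"] C B0 h by (simp add: degree_mult_eq)
  moreover have "degree B + degree x = degree C"
    using cube_degree[OF three C x0 f0 B0 re im' VY odd] by simp
  ultimately show False using degree_integral_point[OF P odd] h by simp
qed


section \<open>Counting classes modulo cubes in abelian groups\<close>

context comm_group
begin

definition lincomb :: "'a set \<Rightarrow> ('a \<Rightarrow> int) \<Rightarrow> 'a" where
  "lincomb S c = finprod G (\<lambda>s. s [^] c s) S"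

lemma lincomb_closed [simp]: "S \<subseteq> carrier G \<Longrightarrow> lincomb S c \<in> carrier G"
  by (auto simp: lincomb_def intro: finprod_closed)

lemma lincomb_add:
  assumes "S \<subseteq> carrier G" "finite S"
  shows "lincomb S (\<lambda>s. c s + d s) = lincomb S c \<otimes> lincomb S d"
  unfolding lincomb_def using assms
  by (subst finprod_multf[symmetric]) (auto intro!: finprod_cong' int_pow_mult)

lemma lincomb_pow:
  assumes "finite S" "S \<subseteq> carrier G"
  shows "lincomb S c [^] (k::int) = lincomb S (\<lambda>s. k * c s)"
  using assms
proof (induction S)
  case (insert t S)
  have "lincomb (insert t S) c' = t [^] c' t \<otimes> lincomb S c'" for c' :: "'a \<Rightarrow> int"
    unfolding lincomb_def using insert by (intro finprod_insert) auto
  then show ?case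
    using insert by (simp add: int_pow_distrib int_pow_pow mult.commute)
qed (simp add: lincomb_def)

text \<open>Linear independence over the field with three elements in \<open>G\<close> modulo cubes,
  phrased with integer exponents to avoid the quotient group.\<close>

definition independent_mod_cubes :: "'a set \<Rightarrow> bool" where
  "independent_mod_cubes S \<longleftrightarrow>
     (\<forall>c z. z \<in> carrier G \<longrightarrow> lincomb S c = z [^] (3::int) \<longrightarrow> (\<forall>s\<in>S. 3 dvd c s))"

text \<open>Infinite descent: all exponents of a relation are divisible by 3, and without 3-torsion
  the relation can be divided by 3. So every exponent is divisible by all powers of 3.\<close>

lemma independent_mod_cubes_imp_int_independent:
  assumes tors: "\<And>x. x \<in> carrier G \<Longrightarrow> x [^] (3::int) = \<one> \<Longrightarrow> x = \<one>"
    and S: "finite S" "S \<subseteq> carrier G" and ind: "independent_mod_cubes S"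
  shows "int_independent G S"
proof -
  have pow: "3 ^ k dvd c s" if "lincomb S c = \<one>" "s \<in> S" for c s and k :: nat
    using that(1)
  proof (induction k arbitrary: c)
    case (Suc k)
    have "lincomb S c = \<one> [^] (3::int)" using Suc.prems by simp
    then have "\<forall>s\<in>S. 3 dvd c s"
      using ind unfolding independent_mod_cubes_def by blast
    then have c: "c s = 3 * (c s div 3)" if "s \<in> S" for s using that by simp
    have "lincomb S (\<lambda>s. c s div 3) [^] (3::int) = lincomb S (\<lambda>s. 3 * (c s div 3))"
      by (rule lincomb_pow[OF S])
    also have "\<dots> = lincomb S c"
      unfolding lincomb_def using S(2) by (intro finprod_cong') (auto simp flip: c)
    finally have "lincomb S (\<lambda>s. c s div 3) = \<one>" using tors Suc.prems S(2) by simp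
    from Suc.IH[OF this] have "3 ^ k * 3 dvd (c s div 3) * 3" by (rule mult_dvd_mono) simp
    then show ?case using c[OF that(2)] by (simp add: mult.commute)
  qed simp
  have "c s = 0" if "lincomb S c = \<one>" "s \<in> S" for c s
  proof (rule ccontr)
    assume "c s \<noteq> 0"
    then have "3 ^ nat \<bar>c s\<bar> \<le> \<bar>c s\<bar>"
      using pow[OF that, of "nat \<bar>c s\<bar>"] by (intro zdvd_imp_le) simp_all
    moreover have "n < 3 ^ n" for n :: nat by (rule less_exp[THEN order.strict_trans2]) (simp add: power_mono)
    then have "int (nat \<bar>c s\<bar>) < int (3 ^ nat \<bar>c s\<bar>)" by (simp only: of_nat_less_iff)
    ultimately show False by simp
  qed
  then show ?thesis using S unfolding int_independent_def lincomb_def by blast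
qed

text \<open>A maximal subset \<open>S\<close> of \<open>T\<close> that is independent modulo cubes
  has at most \<open>n\<close> elements and spans \<open>T\<close> modulo cubes, so the elements of
  \<open>T\<close> are told apart by exponent vectors in \<open>{0..2}\<close>. Choosing
  \<open>S\<close> inside the finite set \<open>T\<close> avoids any finiteness question about
  \<open>G\<close> modulo cubes.\<close>

lemma card_le_power_rank:
  assumes tors: "\<And>x. x \<in> carrier G \<Longrightarrow> x [^] (3::int) = \<one> \<Longrightarrow> x = \<one>"
    and rank: "\<And>S. int_independent G S \<Longrightarrow> card S \<le> n"
    and T: "finite T" "T \<subseteq> carrier G"
    and inj: "\<And>x y z. x \<in> T \<Longrightarrow> y \<in> T \<Longrightarrow> z \<in> carrier G \<Longrightarrow> x = y \<otimes> z [^] (3::int) \<Longrightarrow> x = y"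
  shows "card T \<le> 3 ^ n"
proof -
  let ?M = "{S. S \<subseteq> T \<and> independent_mod_cubes S}"
  have "finite ?M" using T by simp
  moreover have "{} \<in> ?M" by (simp add: independent_mod_cubes_def)
  ultimately obtain S where S: "S \<in> ?M" and maxi: "\<And>S'. S' \<in> ?M \<Longrightarrow> S \<subseteq> S' \<Longrightarrow> S = S'"
    by (metis (no_types, lifting) empty_iff finite_has_maximal)
  have S': "S \<subseteq> T" using S by simp
  have S': "finite S" "S \<subseteq> carrier G" "S \<subseteq> T"
    using S' T finite_subset[OF S' T(1)] by simp_all
  have indS: "independent_mod_cubes S" using S by simp
  have "card S \<le> n"
    by (rule rank[OF independent_mod_cubes_imp_int_independent[OF tors S'(1,2) indS]])
  have span: "\<exists>c z. z \<in> carrier G \<and> t = lincomb S c \<otimes> z [^] (3::int)" if t: "t \<in> T" for t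
  proof (cases "t \<in> S")
    case True
    have "lincomb S (\<lambda>s. if s = t then 1 else 0) = finprod G (\<lambda>s. if t = s then s else \<one>) S"
      unfolding lincomb_def using S' by (intro finprod_cong') auto
    also have "\<dots> = t" using S' True by (subst finprod_singleton) auto
    finally show ?thesis using t T by (intro exI[of _ "\<lambda>s. if s = t then 1 else 0"] exI[of _ \<one>]) auto
  next
    case False
    have tG: "t \<in> carrier G" using t T by auto
    have "\<not> independent_mod_cubes (insert t S)" using maxi[of "insert t S"] False S' t by auto
    then obtain c z where z: "z \<in> carrier G" and eq: "lincomb (insert t S) c = z [^] (3::int)"
      and nd: "\<not> (\<forall>s\<in>insert t S. 3 dvd c s)"
      unfolding independent_mod_cubes_def by auto
    have ins: "t [^] c t \<otimes> lincomb S c = z [^] (3::int)"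
      unfolding eq[symmetric] lincomb_def using S' False tG by (subst finprod_insert) auto
    have L: "lincomb S c \<in> carrier G" using S' by simp
    have ndt: "\<not> 3 dvd c t"
    proof
      assume "3 dvd c t"
      then obtain j where j: "c t = j * 3" by (auto elim!: dvdE simp: mult.commute)
      have "lincomb S c = inv (t [^] c t) \<otimes> z [^] (3::int)"
        unfolding ins[symmetric] using L tG by (simp flip: m_assoc)
      also have "\<dots> = (inv (t [^] j) \<otimes> z) [^] (3::int)"
        using tG z by (simp add: j int_pow_distrib int_pow_inv int_pow_pow)
      finally have cube: "lincomb S c = (inv (t [^] j) \<otimes> z) [^] (3::int)" .
      have "inv (t [^] j) \<otimes> z \<in> carrier G" using tG z by simp
      then have "\<forall>s\<in>S. 3 dvd c s"
        using indS[unfolded independent_mod_cubes_def, rule_format, OF _ cube] by simp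
      then show False using nd \<open>3 dvd c t\<close> by simp
    qed
    \<comment> \<open>The exponent of \<open>t\<close> is prime to 3 and hence its own inverse
      modulo 3. Raising the relation to the power \<open>k\<close> isolates \<open>t\<close> up to a
      cube.\<close>
    define k where "k = c t"
    have "\<exists>j. k * k = 1 + 3 * j"
    proof -
      have "k mod 3 = 1 \<or> k mod 3 = 2" using ndt unfolding k_def by presburger
      then have "(k * k) mod 3 = 1" by (subst mod_mult_eq[symmetric]) auto
      then show ?thesis by (intro exI[of _ "(k * k) div 3"]) presburger
    qed
    then obtain j where j: "k * k = 1 + 3 * j" ..
    have "z [^] (3 * k) = (z [^] (3::int)) [^] k" using z by (simp add: int_pow_pow)
    also have "\<dots> = t [^] (k * k) \<otimes> lincomb S (\<lambda>s. k * c s)"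
      unfolding ins[symmetric] using tG L S'
      by (simp add: int_pow_distrib int_pow_pow lincomb_pow flip: k_def)
    also have "t [^] (k * k) = t \<otimes> t [^] (j * 3)" unfolding j using tG
      by (simp add: int_pow_mult mult.commute)
    finally have zk: "z [^] (3 * k) = t \<otimes> t [^] (j * 3) \<otimes> lincomb S (\<lambda>s. k * c s)" .
    define u v where "u = lincomb S (\<lambda>s. k * c s)" and "v = t [^] j"
    have uv: "u \<in> carrier G" "v \<in> carrier G" using S' tG by (simp_all add: u_def v_def)
    have "(z [^] k) [^] (3::int) = t \<otimes> v [^] (3::int) \<otimes> u"
      using zk z tG by (simp add: int_pow_pow u_def v_def mult.commute)
    then have "t \<otimes> (v [^] (3::int) \<otimes> u) = (z [^] k) [^] (3::int)" using tG uv by (simp add: m_assoc)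
    then have "t = (z [^] k) [^] (3::int) \<otimes> inv (v [^] (3::int) \<otimes> u)"
      using tG uv z by (metis inv_solve_right int_pow_closed m_closed)
    also have "\<dots> = inv u \<otimes> (z [^] k \<otimes> inv v) [^] (3::int)"
      using uv z by (simp add: inv_mult int_pow_distrib int_pow_inv m_ac)
    also have "inv u = lincomb S (\<lambda>s. (- 1) * (k * c s))"
      unfolding u_def using S' lincomb_pow[of S "\<lambda>s. k * c s" "- 1"] by (simp add: int_pow_neg)
    finally show ?thesis using uv z by (intro exI conjI) auto
  qed
  have "\<exists>e\<in>PiE S (\<lambda>_. {0..2}). \<exists>z\<in>carrier G. t = lincomb S e \<otimes> z [^] (3::int)" if t: "t \<in> T" for t
  proof -
    obtain c z where z: "z \<in> carrier G" "t = lincomb S c \<otimes> z [^] (3::int)" using span[OF t] by blast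
    define e where "e = restrict (\<lambda>s. c s mod 3) S"
    have "lincomb S c = lincomb S (\<lambda>s. e s + 3 * (c s div 3))"
      unfolding lincomb_def e_def using S' by (intro finprod_cong') auto
    also have "\<dots> = lincomb S e \<otimes> lincomb S (\<lambda>s. c s div 3) [^] (3::int)"
      using S' by (simp add: lincomb_add lincomb_pow)
    finally have "t = lincomb S e \<otimes> (lincomb S (\<lambda>s. c s div 3) \<otimes> z) [^] (3::int)"
      using z S' by (simp add: int_pow_distrib m_assoc)
    moreover have "e \<in> PiE S (\<lambda>_. {0..2})"
    proof -
      have "0 \<le> c s mod 3 \<and> c s mod 3 \<le> 2" for s by presburger
      then show ?thesis by (simp add: e_def)
    qed
    ultimately show ?thesis using z S' by (metis lincomb_closed m_closed)
  qed
  then obtain e z where e: "\<And>t. t \<in> T \<Longrightarrow> e t \<in> PiE S (\<lambda>_. {0..2::int})"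
    "\<And>t. t \<in> T \<Longrightarrow> z t \<in> carrier G" "\<And>t. t \<in> T \<Longrightarrow> t = lincomb S (e t) \<otimes> z t [^] (3::int)"
    by metis
  have "inj_on e T"
  proof (rule inj_onI)
    fix x y assume xy: "x \<in> T" "y \<in> T" "e x = e y"
    define u where "u = lincomb S (e y)"
    have u: "u \<in> carrier G" using S' by (simp add: u_def)
    have x: "x = u \<otimes> z x [^] (3::int)" and y: "y = u \<otimes> z y [^] (3::int)"
      using e(3) xy unfolding u_def by metis+
    have zz: "z x \<in> carrier G" "z y \<in> carrier G" using e xy by auto
    have "y \<otimes> (z x \<otimes> inv (z y)) [^] (3::int)
        = u \<otimes> (z y [^] (3::int) \<otimes> (z x [^] (3::int) \<otimes> inv (z y [^] (3::int))))"
      using zz u by (subst y) (simp add: int_pow_distrib int_pow_inv m_assoc)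
    also have "z y [^] (3::int) \<otimes> (z x [^] (3::int) \<otimes> inv (z y [^] (3::int))) = z x [^] (3::int)"
      using zz by (simp add: m_lcomm)
    also have "u \<otimes> z x [^] (3::int) = x" by (rule x[symmetric])
    finally have eq: "x = y \<otimes> (z x \<otimes> inv (z y)) [^] (3::int)" by (rule sym)
    show "x = y" by (rule inj[OF xy(1,2) _ eq]) (use zz in simp)
  qed
  then have "card T \<le> card (PiE S (\<lambda>_. {0..2::int}))"
    using e(1) S' by (intro card_inj_on_le[of e]) (auto intro: finite_PiE)
  also have "\<dots> = 3 ^ card S" using S' by (simp add: card_PiE)
  also have "\<dots> \<le> 3 ^ n" using \<open>card S \<le> n\<close> by (intro power_increasing) auto
  finally show ?thesis .
qed

text \<open>An endomorphism \<open>\<phi>\<close> with \<open>1 + \<phi> + \<phi>\<^sup>2 = 0\<close> makes the group a \<open>\<int>[\<zeta>]\<close>-module; the factor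
  \<open>1 - \<zeta>\<close> of \<open>3\<close> appears squared, whence the square.\<close>

lemma card_square_le_power_rank:
  assumes hom: "\<phi> \<in> hom G G"
    and cyc: "\<And>x. x \<in> carrier G \<Longrightarrow> x \<otimes> (\<phi> x \<otimes> \<phi> (\<phi> x)) = \<one>"
    and fixed: "\<And>x. x \<in> carrier G \<Longrightarrow> \<phi> x = x \<Longrightarrow> x = \<one>"
    and D: "subgroup D G" and D\<phi>: "\<And>x. x \<in> carrier G \<Longrightarrow> x \<otimes> inv (\<phi> x) \<in> D"
    and tors: "\<And>x. x \<in> carrier G \<Longrightarrow> x [^] (3::int) = \<one> \<Longrightarrow> x = \<one>"
    and rank: "\<And>S. int_independent G S \<Longrightarrow> card S \<le> n"
    and T: "finite T" "T \<subseteq> carrier G" and inj: "inj_on (\<lambda>x. D #> x) T"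
  shows "card T ^ 2 \<le> 3 ^ n"
proof -
  \<comment> \<open>With \<open>\<phi>\<close> acting as \<open>\<zeta>\<close>, this is
    multiplication by \<open>1 - \<zeta>\<close>.\<close>
  define \<theta> where "\<theta> x = x \<otimes> inv (\<phi> x)" for x
  have \<phi>: "\<phi> x \<in> carrier G" if "x \<in> carrier G" for x using hom that by (auto simp: hom_def)
  have \<phi>m: "\<phi> (x \<otimes> y) = \<phi> x \<otimes> \<phi> y" if "x \<in> carrier G" "y \<in> carrier G" for x y
    using hom that by (auto simp: hom_def)
  have \<theta>: "\<theta> x \<in> carrier G" if "x \<in> carrier G" for x using \<phi> that by (simp add: \<theta>_def)
  have \<theta>m: "\<theta> (x \<otimes> y) = \<theta> x \<otimes> \<theta> y" if "x \<in> carrier G" "y \<in> carrier G" for x y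
    using that \<phi> by (simp add: \<theta>_def \<phi>m inv_mult m_ac)
  have \<theta>1: "x = \<one>" if "x \<in> carrier G" "\<theta> x = \<one>" for x
  proof (rule fixed[OF that(1)])
    show "\<phi> x = x" using that \<phi>[OF that(1)] unfolding \<theta>_def
      by (metis inv_closed inv_equality inv_inv)
  qed
  have cube: "z [^] (3::int) = z \<otimes> (z \<otimes> z)" if "z \<in> carrier G" for z
    using int_pow_mult[OF that, of 1 2] int_pow_mult[OF that, of 1 1] that by simp
  \<comment> \<open>This is the factorisation
    \<open>3 = (1 - \<zeta>) * (2 + \<zeta>)\<close>.\<close>
  have z3: "\<theta> (z \<otimes> (z \<otimes> \<phi> z)) = z [^] (3::int)" if z: "z \<in> carrier G" for z
  proof -
    have "\<phi> (z \<otimes> (z \<otimes> \<phi> z)) = \<phi> z \<otimes> (\<phi> z \<otimes> \<phi> (\<phi> z))" using z \<phi> by (simp add: \<phi>m)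
    moreover have "\<phi> z \<otimes> \<phi> (\<phi> z) = inv z" using cyc[OF z] z \<phi>
      by (metis inv_equality inv_inv inv_closed m_closed)
    ultimately have "\<theta> (z \<otimes> (z \<otimes> \<phi> z)) = z \<otimes> (z \<otimes> \<phi> z) \<otimes> inv (\<phi> z \<otimes> inv z)"
      by (simp add: \<theta>_def)
    also have "\<dots> = z \<otimes> (z \<otimes> (\<phi> z \<otimes> (inv (\<phi> z) \<otimes> z)))" using z \<phi> by (simp add: inv_mult m_assoc)
    also have "\<phi> z \<otimes> (inv (\<phi> z) \<otimes> z) = z" using z \<phi> by (simp flip: m_assoc)
    finally show ?thesis using z by (simp add: cube)
  qed
  have DT: "x = y" if "x \<in> T" "y \<in> T" "x = y \<otimes> d" "d \<in> D" for x y d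
  proof -
    have "x = d \<otimes> y" using that T subgroup.subset[OF D] by (auto intro: m_comm)
    then have "x \<in> D #> y" using that by (auto simp: r_coset_def)
    then have "D #> y = D #> x" using that T D by (intro repr_independence) auto
    then show ?thesis using inj that by (auto simp: inj_on_def)
  qed
  have \<theta>D: "\<theta> x \<in> D" if "x \<in> carrier G" for x using D\<phi>[OF that] by (simp add: \<theta>_def)
  \<comment> \<open>Additively \<open>h\<close> is \<open>a + (1 - \<zeta>) * b\<close>. Its values
    on \<open>T \<times> T\<close> are pairwise incongruent modulo 3: reduction modulo
    \<open>D\<close> recovers \<open>a\<close>, and after cancelling \<open>1 - \<zeta>\<close> a
    second reduction recovers \<open>b\<close>.\<close>
  define h where "h = (\<lambda>(a, b). a \<otimes> \<theta> b)"
  have key: "a = a' \<and> b = b'" if "a \<in> T" "b \<in> T" "a' \<in> T" "b' \<in> T" and z: "z \<in> carrier G"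
    and eq: "a \<otimes> \<theta> b = a' \<otimes> \<theta> b' \<otimes> z [^] (3::int)" for a b a' b' z
  proof -
    have c: "a \<in> carrier G" "b \<in> carrier G" "a' \<in> carrier G" "b' \<in> carrier G" using that T by auto
    define q where "q = z \<otimes> (z \<otimes> \<phi> z)"
    have q: "q \<in> carrier G" using z \<phi> by (simp add: q_def)
    have \<theta>inv: "\<theta> (inv b) = inv (\<theta> b)"
    proof -
      have "\<theta> \<one> = \<one>" using \<theta>m[of \<one> \<one>] \<theta>[of \<one>] by simp
      then have "\<theta> (inv b) \<otimes> \<theta> b = \<one>" using c \<theta>m[of "inv b" b] by simp
      then show ?thesis using c \<theta> by (metis inv_equality inv_closed)
    qed
    have "a \<otimes> \<theta> b = a' \<otimes> (\<theta> b' \<otimes> \<theta> q)" using eq z3[OF z] z c q \<theta> by (simp add: q_def m_assoc)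
    then have "a = a' \<otimes> (\<theta> b' \<otimes> \<theta> q) \<otimes> inv (\<theta> b)"
      using c q \<theta> by (metis inv_solve_right m_closed)
    also have "\<dots> = a' \<otimes> \<theta> (b' \<otimes> q \<otimes> inv b)" using c q \<theta> by (simp add: \<theta>m \<theta>inv m_assoc)
    finally have a: "a = a' \<otimes> \<theta> (b' \<otimes> q \<otimes> inv b)" .
    have aa: "a = a'" by (rule DT[OF that(1,3) a]) (rule \<theta>D, use c q in simp)
    have "a' \<otimes> \<theta> (b' \<otimes> q \<otimes> inv b) = a'" using a unfolding aa by (rule sym)
    then have "\<theta> (b' \<otimes> q \<otimes> inv b) = \<one>" using c q \<theta> by simp
    then have "b' \<otimes> q \<otimes> inv b = \<one>" using \<theta>1 c q by simp
    then have b: "b = b' \<otimes> q" using c q by (metis inv_closed inv_equality inv_inv m_closed)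
    \<comment> \<open>Since \<open>2 + \<zeta> = 3 - (1 - \<zeta>)\<close> and 3 is itself a
      multiple of \<open>1 - \<zeta>\<close>, the element \<open>q\<close> is a quotient of values
      of \<open>\<theta>\<close>, all of which lie in \<open>D\<close>.\<close>
    have "q = \<theta> q \<otimes> inv (\<theta> z)"
    proof -
      have "\<theta> q \<otimes> inv (\<theta> z) = z \<otimes> (z \<otimes> z) \<otimes> inv (z \<otimes> inv (\<phi> z))"
        using z3[OF z] cube[OF z] by (simp add: q_def \<theta>_def)
      also have "\<dots> = z \<otimes> (z \<otimes> (z \<otimes> (inv z \<otimes> \<phi> z)))" using z \<phi> by (simp add: inv_mult m_assoc)
      also have "z \<otimes> (inv z \<otimes> \<phi> z) = \<phi> z" using z \<phi> by (simp flip: m_assoc)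
      finally show ?thesis by (simp add: q_def)
    qed
    then have "q \<in> D"
      using \<theta>D q z by (metis D subgroup.m_closed subgroup.m_inv_closed)
    then have "b = b'" using DT that(2,4) b by blast
    with aa show ?thesis by blast
  qed
  have "inj_on h (T \<times> T)"
  proof (rule inj_onI)
    fix x y assume xy: "x \<in> T \<times> T" "y \<in> T \<times> T" "h x = h y"
    obtain a b a' b' where [simp]: "x = (a, b)" "y = (a', b')" by (cases x; cases y)
    have "a' \<otimes> \<theta> b' \<in> carrier G" using xy T \<theta> by auto
    then show "x = y" using key[of a b a' b' \<one>] xy by (simp add: h_def)
  qed
  moreover have "card (h ` (T \<times> T)) \<le> 3 ^ n"
  proof (rule card_le_power_rank[OF tors rank])
    show "finite (h ` (T \<times> T))" using T by simp
    show "h ` (T \<times> T) \<subseteq> carrier G" using T \<theta> by (auto simp: h_def)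
    show "x = y" if "x \<in> h ` (T \<times> T)" "y \<in> h ` (T \<times> T)" "z \<in> carrier G"
      "x = y \<otimes> z [^] (3::int)" for x y z
      using that key by (fastforce simp: h_def)
  qed auto
  ultimately show ?thesis by (simp add: card_image card_cartesian_product power2_eq_square)
qed

end


section \<open>The descent map\<close>

locale descent = weierstrass b for b :: "'a::field" +
  assumes nonsquare: "u^2 \<noteq> b"
begin

definition rootb :: "'a alg_closure" where "rootb = (SOME s. s^2 = to_ac b)"

definition quad :: "'a \<Rightarrow> 'a \<Rightarrow> 'a alg_closure" where
  "quad u v = to_ac u + to_ac v * rootb"

text \<open>The cube root has to lie in the quadratic extension generated by \<open>rootb\<close>;
  in the algebraic closure every element is a cube.\<close>

definition is_cube :: "'a alg_closure \<Rightarrow> bool" where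
  "is_cube z \<longleftrightarrow> (\<exists>u v. z = quad u v ^ 3)"

definition desc :: "'a point \<Rightarrow> 'a alg_closure" where
  "desc P = (case P of Infinity \<Rightarrow> 1 | Affine x y \<Rightarrow> quad y 1)"

lemma rootb_square: "rootb^2 = to_ac b"
  unfolding rootb_def by (rule someI_ex) (rule nth_root_exists, simp)

lemma quad_mult: "quad u v * quad u' v' = quad (u * u' + v * v' * b) (u * v' + v * u')"
  using rootb_square by (simp add: quad_def algebra_simps power2_eq_square)

lemma quad_cube: "quad u v ^ 3 = quad (u^3 + 3 * u * v^2 * b) (3 * u^2 * v + v^3 * b)"
  by (simp add: power3_eq_cube quad_mult power2_eq_square algebra_simps)

lemma quad_eq_iff: "quad u v = quad u' v' \<longleftrightarrow> u = u' \<and> v = v'"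
proof
  assume "quad u v = quad u' v'"
  then have "to_ac (u - u') = - to_ac (v - v') * rootb" by (simp add: quad_def algebra_simps)
  then have "to_ac (u - u')^2 = to_ac (v - v')^2 * rootb^2"
    by (simp only: power_mult_distrib power2_minus)
  then have "to_ac ((u - u')^2) = to_ac ((v - v')^2 * b)" unfolding rootb_square by simp
  then have eq: "(u - u')^2 = (v - v')^2 * b" unfolding to_ac_eq_iff .
  have "v = v'"
  proof (rule ccontr)
    assume "v \<noteq> v'"
    then have "((u - u') / (v - v'))^2 = b" using eq by (simp add: power_divide)
    then show False using nonsquare by blast
  qed
  then show "u = u' \<and> v = v'" using eq by simp
qed simp

lemma quad_0: "quad 0 0 = 0" and quad_1: "quad 1 0 = 1"
  by (simp_all add: quad_def)

lemma quad_inverse: "\<exists>u' v'. inverse (quad u v) = quad u' v'"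
proof (cases "u = 0 \<and> v = 0")
  case True then show ?thesis by (metis quad_0 inverse_zero)
next
  case False
  define n where "n = u^2 - v^2 * b"
  have n: "n \<noteq> 0"
  proof
    assume "n = 0"
    then have eq: "u^2 = v^2 * b" by (simp add: n_def)
    then have "v \<noteq> 0" using False by auto
    then have "(u / v)^2 = b" using eq by (simp add: power_divide)
    then show False using nonsquare by blast
  qed
  have "u * (u / n) + v * (- v / n) * b = (u^2 - v^2 * b) / n"
    by (simp add: diff_divide_distrib power2_eq_square)
  also have "\<dots> = 1" unfolding n_def[symmetric] using n by simp
  finally have "u * (u / n) + v * (- v / n) * b = 1" .
  moreover have "u * (- v / n) + v * (u / n) = 0" by (simp add: mult.commute)
  ultimately have "quad u v * quad (u / n) (- v / n) = 1" by (simp only: quad_mult quad_1)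
  then have "inverse (quad u v) = quad (u / n) (- v / n)" by (rule inverse_unique)
  then show ?thesis by blast
qed

lemma is_cube_mult: "is_cube z \<Longrightarrow> is_cube z' \<Longrightarrow> is_cube (z * z')"
  unfolding is_cube_def by (metis power_mult_distrib quad_mult)

lemma is_cube_inverse: "is_cube z \<Longrightarrow> is_cube (inverse z)"
  unfolding is_cube_def by (metis power_inverse quad_inverse)

lemma is_cube_divide: "is_cube z \<Longrightarrow> is_cube z' \<Longrightarrow> is_cube (z / z')"
  unfolding divide_inverse by (intro is_cube_mult is_cube_inverse)

lemma is_cube_to_ac: "is_cube (to_ac u ^ 3)"
  unfolding is_cube_def by (intro exI[of _ u] exI[of _ 0]) (simp add: quad_def)

lemma is_cube_1: "is_cube 1"
  using is_cube_to_ac[of 1] by simp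

lemma desc_neq_0: "desc P \<noteq> 0"
proof (cases P)
  case (Affine x y)
  then show ?thesis using quad_eq_iff[of y 1 0 0] by (simp add: desc_def quad_0)
qed (simp add: desc_def)

lemma desc_mult_neg:
  assumes "on_curve b P" shows "is_cube (desc P * desc (point_neg P))"
proof (cases P)
  case (Affine x y)
  then have "y^2 = x^3 + b" using assms by (simp add: on_curve_def)
  then have "- (y * y) + b = (- x)^3" by (simp add: power2_eq_square)
  then have "desc P * desc (point_neg P) = to_ac (- x) ^ 3"
    by (simp add: Affine desc_def quad_mult) (simp add: quad_def flip: to_ac_power)
  then show ?thesis by (simp only: is_cube_to_ac)
qed (simp add: desc_def is_cube_1)

lemma desc_neg: "on_curve b P \<Longrightarrow> is_cube (desc (point_neg P) / inverse (desc P))"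
  using desc_mult_neg[of P] by (simp add: divide_inverse mult.commute)

text \<open>For collinear points the product of the values \<open>y_i + sqrt b\<close> is
  \<open>(c + sqrt b)^3\<close>. The cubic with roots \<open>x_i\<close> is
  \<open>X^3 - (m*X + c + sqrt b)*(m*X + c - sqrt b)\<close>, and at the zero of the first linear
  factor only \<open>X^3\<close> survives. The expansion in the proof also covers
  \<open>m = 0\<close>.\<close>

lemma desc_add:
  assumes P: "on_curve b P" and Q: "on_curve b Q"
  shows "is_cube (desc (point_add P Q) / (desc P * desc Q))"
proof (cases "P = Infinity \<or> Q = Infinity")
  case True
  have "desc S / desc S = 1" for S using desc_neq_0 by simp
  then show ?thesis using True by (cases P; cases Q) (auto simp: desc_def[of Infinity] is_cube_1)
next
  case False
  then obtain x1 y1 x2 y2 where PQ: "P = Affine x1 y1" "Q = Affine x2 y2"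
    by (cases P; cases Q) auto
  show ?thesis
  proof (cases "x1 = x2 \<and> y1 = - y2")
    case True
    then have "Q = point_neg P" using PQ by simp
    then show ?thesis using is_cube_inverse[OF desc_mult_neg[OF P]]
      by (simp add: desc_def[of Infinity] divide_inverse)
  next
    case False
    obtain m c x3 where S: "point_add P Q = Affine x3 (- (m * x3 + c))"
      and y: "y1 = m * x1 + c" "y2 = m * x2 + c" and e: "x1 + x2 + x3 = m^2"
        "x1 * x2 + x1 * x3 + x2 * x3 = - 2 * m * c" "x1 * x2 * x3 = c^2 - b"
      using point_add_collinear[OF two P[unfolded PQ] Q[unfolded PQ] False] PQ by metis
    let ?S = "point_add P Q"
    define M C where "M = to_ac m" and "C = to_ac c + rootb"
    have E: "to_ac x1 + to_ac x2 + to_ac x3 = M^2"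
      "to_ac x1 * to_ac x2 + to_ac x1 * to_ac x3 + to_ac x2 * to_ac x3 = - 2 * M * to_ac c"
      "to_ac x1 * to_ac x2 * to_ac x3 = to_ac c^2 - rootb^2"
      using e[THEN arg_cong, of to_ac] unfolding rootb_square by (simp_all add: M_def)
    have "desc P * desc Q * desc (point_neg ?S)
       = (M * to_ac x1 + C) * (M * to_ac x2 + C) * (M * to_ac x3 + C)"
      unfolding S unfolding PQ y by (simp add: desc_def quad_def M_def C_def add.assoc)
    also have "\<dots> = M^3 * (to_ac x1 * to_ac x2 * to_ac x3)
        + M^2 * C * (to_ac x1 * to_ac x2 + to_ac x1 * to_ac x3 + to_ac x2 * to_ac x3)
        + M * C^2 * (to_ac x1 + to_ac x2 + to_ac x3) + C^3"
      by (simp add: power2_eq_square power3_eq_cube algebra_simps)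
    also have "\<dots> = C^3"
      unfolding E C_def by (simp add: power2_eq_square power3_eq_cube algebra_simps)
    finally have "is_cube (desc P * desc Q * desc (point_neg ?S))"
      unfolding is_cube_def by (intro exI[of _ c] exI[of _ 1]) (simp add: C_def quad_def)
    from is_cube_divide[OF desc_mult_neg[OF on_curve_point_add[OF two P Q]] this]
    show ?thesis using desc_neq_0[of "point_neg ?S"] by (simp add: field_simps)
  qed
qed

section \<open>The image of the dual isogeny as the kernel of the descent map\<close>

abbreviation dimage :: "'a point set" where
  "dimage \<equiv> dual_isog b ` carrier (curve_group (- 27 * b))"

lemma numerals_neq_0: "(9::'a) \<noteq> 0" "(27::'a) \<noteq> 0" "(81::'a) \<noteq> 0" "(243::'a) \<noteq> 0" "(729::'a) \<noteq> 0"
proof -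
  have "(9::'a) = 3 * 3" "(27::'a) = 3 * 3 * 3" "(81::'a) = 3 * 3 * 3 * 3"
    "(243::'a) = 3 * 3 * 3 * 3 * 3" "(729::'a) = 3 * 3 * 3 * 3 * 3 * 3" by simp_all
  then show "(9::'a) \<noteq> 0" "(27::'a) \<noteq> 0" "(81::'a) \<noteq> 0" "(243::'a) \<noteq> 0" "(729::'a) \<noteq> 0" using three by (metis mult_eq_0_iff)+
qed

lemma dimage_imp_cube:
  assumes "P \<in> dimage"
  shows "is_cube (desc P)"
proof -
  obtain Q where Q: "on_curve (- 27 * b) Q" "P = dual_isog b Q"
    using assms by (auto simp: curve_group_def)
  show ?thesis
  proof (cases Q)
    case Infinity
    then show ?thesis using Q by (simp add: dual_isog_def desc_def is_cube_1)
  next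
    case (Affine x y)
    show ?thesis
    proof (cases "x = 0")
      case True
      then show ?thesis using Q Affine by (simp add: dual_isog_def desc_def is_cube_1)
    next
      case False
      have y: "y^2 = x^3 - 27 * b" using Q Affine by (simp add: on_curve_def)
      have P: "desc P = quad (y * (x^3 - 8 * (- 27 * b)) / x^3 / 27) 1"
        using Q Affine False by (simp add: dual_isog_def desc_def)
      \<comment> \<open>The cube root \<open>quad (y / (3 * x)) (3 / x)\<close> comes from solving
        \<open>x = 3/v\<close>, \<open>y = 9*u/v\<close> for \<open>u\<close> and \<open>v\<close>,
        the substitution of \<open>cube_imp_dimage\<close>.\<close>
      have c1: "(y / (3 * x))^3 + 3 * (y / (3 * x)) * (3 / x)^2 * b
          = y * (x^3 - 8 * (- 27 * b)) / x^3 / 27"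
      proof -
        have "(y / (3 * x))^3 + 3 * (y / (3 * x)) * (3 / x)^2 * b
            = y * (y^2 + 243 * b) / x^3 / 27"
          using False three numerals_neq_0 by (simp add: field_simps power2_eq_square power3_eq_cube)
        also have "y^2 + 243 * b = x^3 - 8 * (- 27 * b)" unfolding y by simp
        finally show ?thesis .
      qed
      have c2: "3 * (y / (3 * x))^2 * (3 / x) + (3 / x)^3 * b = 1"
      proof -
        have "3 * (y / (3 * x))^2 * (3 / x) + (3 / x)^3 * b = (y^2 + 27 * b) / x^3"
          using False three numerals_neq_0 by (simp add: field_simps power2_eq_square power3_eq_cube)
        then show ?thesis unfolding y using False by simp
      qed
      have "desc P = quad (y / (3 * x)) (3 / x) ^ 3"
        unfolding P quad_cube c1 c2 ..
      then show ?thesis unfolding is_cube_def by blast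
    qed
  qed
qed

text \<open>The coefficient of \<open>sqrt b\<close> in \<open>(u + v*sqrt b)^3\<close> must be 1.
  Divided by \<open>v^3\<close> and multiplied by 27, this equation says that
  \<open>(3/v, 9*u/v)\<close> lies on the curve with constant \<open>-27*b\<close>.\<close>

lemma cube_imp_dimage:
  assumes on: "on_curve b P" and cube: "is_cube (desc P)"
  shows "P \<in> dimage"
proof (cases P)
  case Infinity
  then have "P = dual_isog b Infinity" by (simp add: dual_isog_def)
  then show ?thesis by (intro image_eqI[of _ _ Infinity]) (auto simp: curve_group_def on_curve_def)
next
  case (Affine x y)
  have yx: "y^2 = x^3 + b" using on Affine by (simp add: on_curve_def)
  have x0: "x \<noteq> 0" using yx nonsquare[of y] by auto
  obtain u0 v0 where "quad y 1 = quad u0 v0 ^ 3"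
    using cube Affine unfolding is_cube_def desc_def by auto
  then have uv0: "y = u0^3 + 3 * u0 * v0^2 * b" "1 = 3 * u0^2 * v0 + v0^3 * b"
    unfolding quad_cube quad_eq_iff by auto
  define n where "n = u0^2 - v0^2 * b"
  have "n^3 = (u0^3 + 3 * u0 * v0^2 * b)^2 - (3 * u0^2 * v0 + v0^3 * b)^2 * b"
    unfolding n_def by (simp add: eval_nat_numeral algebra_simps)
  also have "\<dots> = x^3" unfolding uv0[symmetric] using yx by simp
  finally have n3: "n^3 = x^3" .
  then have n0: "n \<noteq> 0" using x0 by auto
  \<comment> \<open>The norm \<open>n\<close> of the cube root equals \<open>x\<close> only up to a
    cube root of unity. Scaling the root by \<open>\<omega>^2\<close> leaves its cube unchanged and
    multiplies the norm by \<open>\<omega>^4 = \<omega>\<close>.\<close>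
  define \<omega> where "\<omega> = x / n"
  have \<omega>3: "\<omega>^3 = 1" using n3 n0 x0 by (simp add: \<omega>_def power_divide)
  define u v where "u = \<omega>^2 * u0" and "v = \<omega>^2 * v0"
  have \<omega>6: "\<omega>^6 = 1" using arg_cong[OF \<omega>3, of "\<lambda>z. z^2"] by (simp flip: power_mult)
  have "u^3 + 3 * u * v^2 * b = \<omega>^6 * (u0^3 + 3 * u0 * v0^2 * b)"
    "3 * u^2 * v + v^3 * b = \<omega>^6 * (3 * u0^2 * v0 + v0^3 * b)"
    by (simp_all add: u_def v_def eval_nat_numeral algebra_simps)
  then have uv: "u^3 + 3 * u * v^2 * b = y" "3 * u^2 * v + v^3 * b = 1"
    unfolding uv0[symmetric] \<omega>6 by simp_all
  have "u^2 - v^2 * b = \<omega>^3 * (\<omega> * n)"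
    by (simp add: u_def v_def n_def eval_nat_numeral algebra_simps)
  then have x: "u^2 - v^2 * b = x" unfolding \<omega>3 using n0 by (simp add: \<omega>_def)
  have v0: "v \<noteq> 0" using uv by auto
  define Q where "Q = Affine (3 / v) (9 * u / v)"
  have vb: "v^3 * b = 1 - 3 * u^2 * v" using uv(2) by (simp add: algebra_simps)
  have "(3 / v)^3 + - 27 * b = 27 * (1 - v^3 * b) / v^3"
    using v0 by (simp add: field_simps power3_eq_cube)
  then have "(9 * u / v)^2 = (3 / v)^3 + - 27 * b"
    unfolding vb using v0 by (simp add: power_divide power3_eq_cube power2_eq_square)
  then have Q: "Q \<in> carrier (curve_group (- 27 * b))"
    by (simp add: Q_def curve_group_def on_curve_def)
  have X: "((3 / v)^3 + 4 * (- 27 * b)) / (3 / v)^2 / 9 = x"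
  proof -
    have "((3 / v)^3 + 4 * (- 27 * b)) / (3 / v)^2 / 9 = (27 * (1 - 4 * (v^3 * b))) / (81 * v)"
      using v0 three numerals_neq_0 by (simp add: field_simps power2_eq_square power3_eq_cube)
    also have "27 * (1 - 4 * (v^3 * b)) = 27 * ((1 - v^3 * b) - 3 * (v^3 * b))" by simp
    also have "1 - v^3 * b = 3 * u^2 * v" unfolding vb by simp
    also have "27 * (3 * u^2 * v - 3 * (v^3 * b)) = 81 * v * (u^2 - v^2 * b)"
      by (simp add: algebra_simps power2_eq_square power3_eq_cube)
    finally show ?thesis unfolding x using v0 three numerals_neq_0 by simp
  qed
  have Y: "9 * u / v * ((3 / v)^3 - 8 * (- 27 * b)) / (3 / v)^3 / 27 = y"
  proof -
    have "9 * u / v * ((3 / v)^3 - 8 * (- 27 * b)) / (3 / v)^3 / 27 = (243 * (u * (1 + 8 * (v^3 * b)))) / (729 * v)"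
      using v0 three numerals_neq_0 by (simp add: field_simps power2_eq_square power3_eq_cube)
    also have "243 * (u * (1 + 8 * (v^3 * b))) = 729 * (u^3 * v + 3 * u * (v^3 * b))"
      unfolding vb by (simp add: algebra_simps power2_eq_square power3_eq_cube)
    also have "u^3 * v + 3 * u * (v^3 * b) = v * y"
      unfolding uv(1)[symmetric] by (simp add: algebra_simps power2_eq_square power3_eq_cube)
    finally show ?thesis using v0 numerals_neq_0 by simp
  qed
  have "dual_isog b Q = P"
    using three v0 unfolding Q_def dual_isog_def Affine isog.simps by (simp add: X[simplified] Y[simplified])
  then show ?thesis using Q by blast
qed


lemma dimage_iff: "P \<in> dimage \<longleftrightarrow> on_curve b P \<and> is_cube (desc P)"
  using dimage_imp_cube cube_imp_dimage on_curve_dual_isog[OF _ three]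
  by (auto simp: curve_group_def)

section \<open>The quotient by the image of the dual isogeny\<close>

sublocale G: comm_group "curve_group b"
  by (rule comm_group_curve_group)

lemma carrier_iff [simp]: "P \<in> carrier (curve_group b) \<longleftrightarrow> on_curve b P"
  and mult_eq [simp]: "P \<otimes>\<^bsub>curve_group b\<^esub> Q = point_add P Q"
  and one_eq [simp]: "\<one>\<^bsub>curve_group b\<^esub> = Infinity"
  by (simp_all add: curve_group_def)

lemma inv_eq: "on_curve b P \<Longrightarrow> inv\<^bsub>curve_group b\<^esub> P = point_neg P"
  using G.inv_equality[of "point_neg P" P] on_curve_point_neg[of b P]
    point_add_commute[of "point_neg P" P] by simp

lemma subgroup_dimage: "subgroup dimage (curve_group b)"
proof (rule G.subgroupI)
  show "dimage \<subseteq> carrier (curve_group b)" by (rule subsetI) (simp only: dimage_iff carrier_iff)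
  have "Infinity \<in> dimage" unfolding dimage_iff by (simp add: on_curve_def desc_def is_cube_1)
  then show "dimage \<noteq> {}" by blast
  fix P Q assume P: "P \<in> dimage"
  then have P': "on_curve b P" "is_cube (desc P)" unfolding dimage_iff by auto
  have "is_cube (desc (point_neg P))"
    using is_cube_mult[OF desc_neg[OF P'(1)] is_cube_inverse[OF P'(2)]] desc_neq_0 by simp
  then show "inv\<^bsub>curve_group b\<^esub> P \<in> dimage"
    unfolding inv_eq[OF P'(1)] dimage_iff using on_curve_point_neg P' by blast
  assume "Q \<in> dimage"
  then have Q': "on_curve b Q" "is_cube (desc Q)" unfolding dimage_iff by auto
  have "is_cube (desc (point_add P Q))"
    using is_cube_mult[OF desc_add[OF P'(1) Q'(1)] is_cube_mult[OF P'(2) Q'(2)]] desc_neq_0 by simp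
  then show "P \<otimes>\<^bsub>curve_group b\<^esub> Q \<in> dimage"
    unfolding mult_eq dimage_iff using on_curve_point_add[OF two] P' Q' by blast
qed

lemma coset_eq_imp_cube:
  assumes P: "on_curve b P" and Q: "on_curve b Q"
    and eq: "dimage #>\<^bsub>curve_group b\<^esub> P = dimage #>\<^bsub>curve_group b\<^esub> Q"
  shows "is_cube (desc P / desc Q)"
proof -
  have "P \<in> dimage #>\<^bsub>curve_group b\<^esub> Q"
    using G.rcos_self[OF _ subgroup_dimage, of P] P eq by simp
  then obtain h where h: "h \<in> dimage" "P = point_add h Q" by (auto simp: r_coset_def)
  then have h': "on_curve b h" "is_cube (desc h)" unfolding dimage_iff by auto
  show ?thesis
    using is_cube_mult[OF desc_add[OF h'(1) Q] h'(2)] desc_neq_0[of h] h(2) by simp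
qed

lemma coset_eqI:
  assumes "on_curve b Q" "h \<in> dimage" "P = point_add Q h"
  shows "dimage #>\<^bsub>curve_group b\<^esub> P = dimage #>\<^bsub>curve_group b\<^esub> Q"
proof -
  have h: "on_curve b h" using assms dimage_iff by auto
  have "P = point_add h Q" using assms point_add_commute[OF assms(1) h] by simp
  then have "P \<in> dimage #>\<^bsub>curve_group b\<^esub> Q" using assms(2) by (auto simp: r_coset_def)
  then show ?thesis
    using G.repr_independence[OF _ _ subgroup_dimage, of P Q] assms by simp
qed

lemma pow_3: "on_curve b P \<Longrightarrow> P [^]\<^bsub>curve_group b\<^esub> (3::int) = point_add P (point_add P P)"
  using G.int_pow_mult[of P 1 2] G.int_pow_mult[of P 1 1] by simp

lemma pow_3_in_dimage:
  assumes P: "on_curve b P" shows "P [^]\<^bsub>curve_group b\<^esub> (3::int) \<in> dimage"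
proof -
  note PP = on_curve_point_add[OF two P P]
  have "is_cube (desc (point_add P (point_add P P)) / (desc P * desc (point_add P P))
     * (desc (point_add P P) / (desc P * desc P)))"
    by (intro is_cube_mult desc_add P PP)
  also have "desc (point_add P (point_add P P)) / (desc P * desc (point_add P P))
     * (desc (point_add P P) / (desc P * desc P)) = desc (point_add P (point_add P P)) / desc P ^ 3"
    using desc_neq_0 by (simp add: field_simps power3_eq_cube)
  finally have 1: "is_cube (desc (point_add P (point_add P P)) / desc P ^ 3)" .
  have 2: "is_cube (desc P ^ 3)"
    unfolding is_cube_def desc_def by (cases P) (auto simp flip: quad_1)
  have "is_cube (desc (point_add P (point_add P P)))"
    using is_cube_mult[OF 1 2] desc_neq_0[of P] by simp
  then show ?thesis
    unfolding pow_3[OF P] dimage_iff using on_curve_point_add[OF two P PP] by simp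
qed

text \<open>Multiplication by 3 factors through the two isogenies. So a 3-torsion point has
  \<open>x = 0\<close>, which would make \<open>b\<close> a square, or is sent by
  \<open>isog\<close> to a point with vanishing abscissa, which means
  \<open>x^3 = -4*b\<close>.\<close>

lemma no_3_torsion:
  assumes noncube: "\<And>u. u^3 \<noteq> - 4 * b"
    and P: "on_curve b P" and P3: "P [^]\<^bsub>curve_group b\<^esub> (3::int) = Infinity"
  shows "P = Infinity"
proof (cases P)
  case (Affine x y)
  have "x \<noteq> 0" using P Affine nonsquare[of y] by (auto simp: on_curve_def)
  moreover have "x^3 + 4 * b \<noteq> 0" using noncube[of x] by (auto simp: add_eq_0_iff2)
  moreover have "dual_isog b (isog b P) = Infinity"
    using dual_isog_isog[OF P two three b] P3 pow_3[OF P] by simp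
  ultimately show ?thesis using Affine by (simp add: dual_isog_def)
qed

lemma card_cosets_le:
  assumes noncube: "\<And>u. u^3 \<noteq> - 4 * b"
    and rank: "\<And>S. int_independent (curve_group b) S \<Longrightarrow> card S \<le> n"
    and M: "finite M" "M \<subseteq> carrier (curve_group b)"
      "inj_on (\<lambda>P. dimage #>\<^bsub>curve_group b\<^esub> P) M"
  shows "card M \<le> 3 ^ n"
proof (rule G.card_le_power_rank[OF _ rank M(1,2)])
  fix P assume "P \<in> carrier (curve_group b)" "P [^]\<^bsub>curve_group b\<^esub> (3::int) = \<one>\<^bsub>curve_group b\<^esub>"
  then show "P = \<one>\<^bsub>curve_group b\<^esub>" using no_3_torsion[OF noncube] by simp
next
  fix P Q z assume PQ: "P \<in> M" "Q \<in> M" "z \<in> carrier (curve_group b)"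
    "P = Q \<otimes>\<^bsub>curve_group b\<^esub> z [^]\<^bsub>curve_group b\<^esub> (3::int)"
  then have "dimage #>\<^bsub>curve_group b\<^esub> P = dimage #>\<^bsub>curve_group b\<^esub> Q"
    using M by (intro coset_eqI[OF _ pow_3_in_dimage]) auto
  then show "P = Q" using M(3) PQ by (auto simp: inj_on_def)
qed auto

section \<open>The action of a primitive cube root of unity\<close>

fun zeta_mult :: "'a \<Rightarrow> 'a point \<Rightarrow> 'a point" where
  "zeta_mult \<zeta> Infinity = Infinity"
| "zeta_mult \<zeta> (Affine x y) = Affine (\<zeta> * x) y"

text \<open>Scaling abscissae by \<open>\<zeta>\<close> scales slopes by the inverse of
  \<open>\<zeta>\<close>, which is \<open>\<zeta>^2\<close>, so the chord and tangent formulas are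
  equivariant.\<close>

lemma zeta_mult_add:
  assumes \<zeta>: "\<zeta>^2 + \<zeta> + 1 = 0"
  shows "zeta_mult \<zeta> (point_add P Q) = point_add (zeta_mult \<zeta> P) (zeta_mult \<zeta> Q)"
proof (cases "P = Infinity \<or> Q = Infinity")
  case True then show ?thesis by (cases P; cases Q) auto
next
  case False
  then obtain x1 y1 x2 y2 where PQ: "P = Affine x1 y1" "Q = Affine x2 y2"
    by (cases P; cases Q) auto
  have z3: "\<zeta>^3 = 1"
  proof -
    have "\<zeta>^3 - 1 = (\<zeta> - 1) * (\<zeta>^2 + \<zeta> + 1)" by (simp add: algebra_simps power2_eq_square power3_eq_cube)
    then show ?thesis unfolding \<zeta> by simp
  qed
  have z0: "\<zeta> \<noteq> 0" using z3 by auto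
  have inv: "inverse \<zeta> = \<zeta>^2" using z3 z0 by (simp add: field_simps power2_eq_square power3_eq_cube)
  define m where "m = (if x1 = x2 then 3 * x1^2 / (2 * y1) else (y2 - y1) / (x2 - x1))"
  have m: "(if \<zeta> * x1 = \<zeta> * x2 then 3 * (\<zeta> * x1)^2 / (2 * y1) else (y2 - y1) / (\<zeta> * x2 - \<zeta> * x1))
      = \<zeta>^2 * m"
  proof (cases "x1 = x2")
    case False
    have "(y2 - y1) / (\<zeta> * x2 - \<zeta> * x1) = inverse \<zeta> * ((y2 - y1) / (x2 - x1))"
      using z0 by (simp add: divide_inverse flip: right_diff_distrib)
    then show ?thesis using False z0 by (simp add: m_def inv)
  qed (simp add: m_def power_mult_distrib)
  have sq: "(\<zeta>^2 * m)^2 = \<zeta> * m^2"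
  proof -
    have "(\<zeta>^2 * m)^2 = \<zeta>^3 * (\<zeta> * m^2)" by (simp add: eval_nat_numeral)
    then show ?thesis unfolding z3 by simp
  qed
  have y: "\<zeta>^2 * m * (\<zeta> * u) = m * u" for u
  proof -
    have "\<zeta>^2 * m * (\<zeta> * u) = \<zeta>^3 * (m * u)" by (simp add: eval_nat_numeral)
    then show ?thesis unfolding z3 by simp
  qed
  show ?thesis
  proof (cases "x1 = x2 \<and> y1 = - y2")
    case False
    then have False': "\<not> (\<zeta> * x1 = \<zeta> * x2 \<and> y1 = - y2)" using z0 by simp
    show ?thesis
      unfolding PQ zeta_mult.simps point_add.simps if_not_P[OF False] if_not_P[OF False'] Let_def m
        m_def[symmetric] sq
      by (simp add: y flip: right_diff_distrib)
  qed (simp add: PQ)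
qed

text \<open>\<open>desc\<close> depends on \<open>y\<close> alone, so \<open>P\<close> and
  \<open>\<zeta>P\<close> have the same value and \<open>(1 - \<zeta>)P\<close> lies in
  \<open>dimage\<close>. The three points with a common \<open>y\<close> lie on a line, whence
  \<open>1 + \<zeta> + \<zeta>^2 = 0\<close>. An affine fixed point would have \<open>x = 0\<close>
  and make \<open>b\<close> a square.\<close>

lemma card_cosets_square_le:
  fixes \<zeta> :: 'a
  assumes \<zeta>: "\<zeta>^2 + \<zeta> + 1 = 0"
    and noncube: "\<And>u. u^3 \<noteq> - 4 * b"
    and rank: "\<And>S. int_independent (curve_group b) S \<Longrightarrow> card S \<le> n"
    and M: "finite M" "M \<subseteq> carrier (curve_group b)"
      "inj_on (\<lambda>P. dimage #>\<^bsub>curve_group b\<^esub> P) M"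
  shows "card M ^ 2 \<le> 3 ^ n"
proof -
  have z1: "\<zeta> \<noteq> 1"
  proof
    assume "\<zeta> = 1"
    then have "\<zeta>^2 + \<zeta> + 1 = 3" by simp
    then show False using \<zeta> three by simp
  qed
  have z3: "\<zeta>^3 = 1"
  proof -
    have "\<zeta>^3 - 1 = (\<zeta> - 1) * (\<zeta>^2 + \<zeta> + 1)" by (simp add: algebra_simps power2_eq_square power3_eq_cube)
    then show ?thesis unfolding \<zeta> by simp
  qed
  have on: "on_curve b (zeta_mult \<zeta> P)" if "on_curve b P" for P
    using that z3 by (cases P) (auto simp: on_curve_def power_mult_distrib)
  show ?thesis
  proof (rule G.card_square_le_power_rank[OF _ _ _ subgroup_dimage _ _ rank M])
    show "zeta_mult \<zeta> \<in> hom (curve_group b) (curve_group b)"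
      using on zeta_mult_add[OF \<zeta>] by (auto simp: hom_def)
  next
    fix P assume P: "P \<in> carrier (curve_group b)"
    show "P = \<one>\<^bsub>curve_group b\<^esub>" if "zeta_mult \<zeta> P = P"
    proof (cases P)
      case (Affine x y)
      then have "x = 0" using that z1 by simp
      then have "y^2 = b" using P Affine by (simp add: on_curve_def)
      then show ?thesis using nonsquare by blast
    qed simp
    show "P = \<one>\<^bsub>curve_group b\<^esub>" if "P [^]\<^bsub>curve_group b\<^esub> (3::int) = \<one>\<^bsub>curve_group b\<^esub>"
      using no_3_torsion[OF noncube] P that by simp
    have "desc (zeta_mult \<zeta> P) = desc P" by (cases P) (simp_all add: desc_def)
    then have c: "is_cube (desc P * desc (point_neg (zeta_mult \<zeta> P)))"
      using desc_mult_neg[OF on, of P] P by simp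
    have on': "on_curve b P" "on_curve b (point_neg (zeta_mult \<zeta> P))"
      using P on on_curve_point_neg by auto
    have "is_cube (desc (point_add P (point_neg (zeta_mult \<zeta> P))))"
      using is_cube_mult[OF desc_add[OF on'] c] desc_neq_0 by simp
    then have "point_add P (point_neg (zeta_mult \<zeta> P)) \<in> dimage"
      unfolding dimage_iff using on_curve_point_add[OF two on'] by blast
    moreover have "on_curve b (zeta_mult \<zeta> P)" using on P by simp
    ultimately show "P \<otimes>\<^bsub>curve_group b\<^esub> inv\<^bsub>curve_group b\<^esub> (zeta_mult \<zeta> P) \<in> dimage"
      unfolding mult_eq by (simp only: inv_eq)
    show "P \<otimes>\<^bsub>curve_group b\<^esub> (zeta_mult \<zeta> P \<otimes>\<^bsub>curve_group b\<^esub> zeta_mult \<zeta> (zeta_mult \<zeta> P))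
        = \<one>\<^bsub>curve_group b\<^esub>"
    proof (cases P)
      case (Affine x y)
      then have "x \<noteq> 0" using P nonsquare[of y] by (auto simp: on_curve_def)
      have z0: "\<zeta> \<noteq> 0" using \<zeta> by auto
      have "point_add (Affine (\<zeta> * x) y) (Affine (\<zeta> * (\<zeta> * x)) y) = Affine (- \<zeta> * x - \<zeta>^2 * x) (- y)"
        using \<open>x \<noteq> 0\<close> z0 z1 by (simp add: Let_def power2_eq_square mult.assoc)
      also have "- \<zeta> * x - \<zeta>^2 * x = x - (\<zeta>^2 + \<zeta> + 1) * x" by (simp add: algebra_simps)
      finally show ?thesis using Affine \<zeta> by simp
    qed simp
  qed auto
qed

end


section \<open>Polynomials over the algebraic closure\<close>

definition acp :: "'k::field poly \<Rightarrow> 'k alg_closure poly" where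
  "acp p = map_poly to_ac p"

lemma coeff_acp [simp]: "coeff (acp p) n = to_ac (coeff p n)"
  by (simp add: acp_def coeff_map_poly)

lemma acp_simps [simp]: "acp 0 = 0" "acp 1 = 1" "acp (p + q) = acp p + acp q"
  "acp (p - q) = acp p - acp q" "acp (- p) = - acp p" "acp (p * q) = acp p * acp q"
  "acp p = acp q \<longleftrightarrow> p = q" "acp p = 0 \<longleftrightarrow> p = 0"
  by (auto simp: poly_eq_iff coeff_mult to_ac_sum if_distrib[of to_ac] cong: if_cong)

lemma acp_power [simp]: "acp (p ^ n) = acp p ^ n"
  by (induction n) simp_all

lemma acp_numeral [simp]: "acp (numeral n) = numeral n"
  by (simp add: poly_eq_iff numeral_poly coeff_pCons split: nat.split)

lemma degree_acp [simp]: "degree (acp p) = degree p"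
  by (simp add: acp_def degree_map_poly)

lemma separable_iff: "separable p \<longleftrightarrow> rsquarefree (acp p)"
  by (simp add: separable_def acp_def)

text \<open>The minimal polynomial of \<open>z\<close>. It trades conditions at roots in the
  algebraic closure for divisibility by irreducible factors over \<open>k\<close>.\<close>

lemma irreducible_polynomial_of_root:
  fixes p :: "'k::field poly"
  assumes "p \<noteq> 0" "poly (acp p) z = 0"
  obtains q where "Factorial_Ring.irreducible q" "lead_coeff q = 1"
    "\<And>g. poly (acp g) z = 0 \<longleftrightarrow> q dvd g"
proof -
  define J where "J = {g. g \<noteq> 0 \<and> poly (acp g) z = 0}"
  have "p \<in> J" using assms by (simp add: J_def)
  define q0 where "q0 = arg_min degree (\<lambda>g. g \<in> J)"
  have q0: "q0 \<in> J" "\<And>g. g \<in> J \<Longrightarrow> degree q0 \<le> degree g"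
    unfolding q0_def using arg_min_nat_lemma[of "\<lambda>g. g \<in> J" p degree] \<open>p \<in> J\<close> by auto
  define q where "q = smult (inverse (lead_coeff q0)) q0"
  have q0_nz: "q0 \<noteq> 0" using q0 by (simp add: J_def)
  have lc: "lead_coeff q = 1" using q0_nz by (simp add: q_def)
  have dq: "degree q = degree q0" and q_nz: "q \<noteq> 0" using q0_nz by (simp_all add: q_def)
  have "q = [:inverse (lead_coeff q0):] * q0" by (simp add: q_def)
  then have "acp q = acp [:inverse (lead_coeff q0):] * acp q0" by (metis acp_simps(6))
  then have qz: "poly (acp q) z = 0" using q0 by (simp add: J_def)
  have dvd: "poly (acp g) z = 0 \<longleftrightarrow> q dvd g" for g
  proof
    assume "q dvd g"
    then show "poly (acp g) z = 0" using qz by (auto elim!: dvdE)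
  next
    assume g: "poly (acp g) z = 0"
    have "acp g = acp (g div q) * acp q + acp (g mod q)"
      unfolding acp_simps(3,6)[symmetric] by simp
    then have "poly (acp (g mod q)) z = 0" using g qz by simp
    then have "g mod q = 0"
      using q0(2)[of "g mod q"] degree_mod_less[OF q_nz, of g] dq unfolding J_def by fastforce
    then show "q dvd g" by (simp add: mod_eq_0_iff_dvd)
  qed
  have "Factorial_Ring.irreducible q"
  proof (rule irreducibleI[OF q_nz])
    show "\<not> is_unit q" using dvd[of 1] by simp
    fix a b assume ab: "q = a * b"
    then have nz: "a \<noteq> 0" "b \<noteq> 0" using q_nz by auto
    have d: "degree q = degree a + degree b" using ab nz by (simp add: degree_mult_eq)
    have "poly (acp a) z = 0 \<or> poly (acp b) z = 0" using qz by (simp add: ab)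
    then have "degree b = 0 \<or> degree a = 0"
      using q0(2)[of a] q0(2)[of b] nz d dq by (auto simp: J_def)
    then show "is_unit a \<or> is_unit b" using nz by (metis is_unit_iff_degree)
  qed
  then show ?thesis using that lc dvd by blast
qed

lemma coprime_no_common_root:
  fixes p q :: "'k::field poly"
  assumes "coprime p q" "p \<noteq> 0" "poly (acp p) z = 0"
  shows "poly (acp q) z \<noteq> 0"
proof
  assume "poly (acp q) z = 0"
  with irreducible_polynomial_of_root[OF assms(2,3)] obtain r
    where "Factorial_Ring.irreducible r" "r dvd p" "r dvd q" using assms(3) by metis
  then show False using assms(1) by (metis coprime_common_divisor irreducible_not_unit)
qed

text \<open>Each factor has a root, and two monic irreducible polynomials with a common root both
  equal its minimal polynomial; so there are at most as many factors as roots of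
  \<open>p\<close>.\<close>

lemma finite_irreducible_factors:
  fixes p :: "'k::field poly"
  assumes "p \<noteq> 0"
  shows "finite {q. Factorial_Ring.irreducible q \<and> lead_coeff q = 1 \<and> q dvd p}" (is "finite ?S")
proof -
  have "\<exists>z. poly (acp q) z = 0" if "q \<in> ?S" for q
  proof (rule alg_closed_imp_poly_has_root)
    have "q \<noteq> 0" "\<not> is_unit q" using that by (auto simp: irreducible_not_unit)
    then show "degree (acp q) > 0" using is_unit_iff_degree[of q] by simp
  qed
  then obtain r where r: "\<And>q. q \<in> ?S \<Longrightarrow> poly (acp q) (r q) = 0" by metis
  have "inj_on r ?S"
  proof (rule inj_onI)
    fix q q' assume q: "q \<in> ?S" "q' \<in> ?S" "r q = r q'"
    then have nz: "q \<noteq> 0" by auto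
    obtain m where m: "Factorial_Ring.irreducible m" "lead_coeff m = 1"
      "\<And>g. poly (acp g) (r q) = 0 \<longleftrightarrow> m dvd g"
      using irreducible_polynomial_of_root[OF nz r[OF q(1)]] by blast
    have eq: "s = m" if "s \<in> ?S" "m dvd s" for s
    proof -
      obtain u where u: "s = m * u" using \<open>m dvd s\<close> by (auto simp: dvd_def)
      then have "is_unit u" using that m(1) irreducibleD[of s m u] irreducible_not_unit by auto
      then obtain c where c: "u = [:c:]" by (auto simp: is_unit_poly_iff)
      have "lead_coeff s = lead_coeff m * lead_coeff u" unfolding u by (rule lead_coeff_mult)
      then have "c = 1" using that m(2) c by simp
      then show ?thesis using u c by simp
    qed
    show "q = q'" using eq[of q] eq[of q'] q r m(3) by metis
  qed
  moreover have "r ` ?S \<subseteq> {z. poly (acp p) z = 0}"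
    using r by (auto elim!: dvdE)
  moreover have "finite {z. poly (acp p) z = 0}" using assms by (intro poly_roots_finite) simp
  ultimately show ?thesis by (meson finite_imageD finite_subset)
qed

lemma two_three_neq_0:
  assumes "CHAR('k::field) \<noteq> 2" "CHAR('k) \<noteq> 3"
  shows "(2::'k) \<noteq> 0" "(3::'k) \<noteq> 0"
proof -
  have 1: "CHAR('k) \<noteq> 1" using of_nat_CHAR[where ?'a = 'k] by auto
  have "n \<in> {1, p}" if "n dvd p" "p = 2 \<or> p = 3" for n p :: nat
  proof -
    have "n \<le> 3" using that dvd_imp_le[OF that(1)] by auto
    then have "n = 0 \<or> n = 1 \<or> n = 2 \<or> n = 3" by auto
    then show ?thesis using that by auto
  qed
  then have dvd: "\<not> CHAR('k) dvd 2" "\<not> CHAR('k) dvd 3" using assms 1 by blast+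
  from dvd(1) have "of_nat 2 \<noteq> (0::'k)" unfolding of_nat_eq_0_iff_char_dvd .
  then show "(2::'k) \<noteq> 0" by simp
  from dvd(2) have "of_nat 3 \<noteq> (0::'k)" unfolding of_nat_eq_0_iff_char_dvd .
  then show "(3::'k) \<noteq> 0" by simp
qed


section \<open>The fibres of the natural map\<close>

locale curve_data =
  fixes f f1 f3 f5 :: "'k::field poly"
  assumes two: "(2::'k) \<noteq> 0" and three: "(3::'k) \<noteq> 0"
    and f: "f = f1 * f3 ^ 3 * f5 ^ 5"
    and coprime: "coprime f1 f3" "coprime f1 f5" "coprime f3 f5"
    and separable: "separable f1" "separable f3" "separable f5"
    and nonconstant: "degree f1 > 0"
    and odd: "odd (degree f)"
begin

lemma f_neq_0: "f \<noteq> 0" "f1 \<noteq> 0" "f3 \<noteq> 0" "f5 \<noteq> 0"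
  using separable odd by (auto simp: separable_iff rsquarefree_def)

lemma order_f: "order z (acp f) = order z (acp f1) + 3 * order z (acp f3) + 5 * order z (acp f5)"
  using f_neq_0 unfolding f by (simp add: order_mult order_power')

lemma order_factors: "order z (acp f1) \<le> 1" "order z (acp f3) \<le> 1" "order z (acp f5) \<le> 1"
  using separable[unfolded separable_iff rsquarefree_def] by (metis le_numeral_extra(4) zero_le_one)+

lemma order_disjoint:
  "order z (acp f1) = 0 \<or> order z (acp f3) = 0" "order z (acp f1) = 0 \<or> order z (acp f5) = 0"
  "order z (acp f3) = 0 \<or> order z (acp f5) = 0"
proof -
  have r: "order z (acp g) = 0 \<longleftrightarrow> poly (acp g) z \<noteq> 0" if "g \<noteq> 0" for g
    using that by (simp add: order_root)
  show "order z (acp f1) = 0 \<or> order z (acp f3) = 0" "order z (acp f1) = 0 \<or> order z (acp f5) = 0"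
    "order z (acp f3) = 0 \<or> order z (acp f5) = 0"
    unfolding r[OF f_neq_0(2)] r[OF f_neq_0(3)] r[OF f_neq_0(4)]
    using coprime_no_common_root[OF coprime(1) f_neq_0(2), of z]
      coprime_no_common_root[OF coprime(2) f_neq_0(2), of z]
      coprime_no_common_root[OF coprime(3) f_neq_0(3), of z] by blast+
qed

lemma order_f_cases: "order z (acp f) \<in> {0, 1, 3, 5}"
proof -
  have "order z (acp f1) = 0 \<or> order z (acp f1) = 1" "order z (acp f3) = 0 \<or> order z (acp f3) = 1"
    "order z (acp f5) = 0 \<or> order z (acp f5) = 1"
    using order_factors[of z] by linarith+
  then show ?thesis unfolding order_f using order_disjoint[of z] by auto
qed

lemma order_f_eq_3: "order z (acp f) = 3 \<Longrightarrow> poly (acp f3) z = 0"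
proof -
  assume "order z (acp f) = 3"
  then have "order z (acp f3) \<noteq> 0"
    unfolding order_f using order_factors[of z] by presburger
  then show ?thesis using order_root by blast
qed

lemma simple_root: obtains z where "order z (acp f) = 1"
proof -
  obtain z where "poly (acp f1) z = 0"
    using alg_closed_imp_poly_has_root[of "acp f1"] nonconstant by auto
  then have "order z (acp f1) \<noteq> 0" using f_neq_0 by (simp add: order_root)
  then have "order z (acp f) = 1"
    unfolding order_f using order_factors[of z] order_disjoint[of z] by auto
  then show ?thesis by (rule that)
qed

lemma degree_f3: "3 * degree f3 < degree f"
  using f_neq_0 nonconstant unfolding f by (simp add: degree_mult_eq degree_power_eq)

lemma fract_quotient:
  obtains A C where "C \<noteq> 0" "(u :: 'k poly fract) = to_fract A / to_fract C"
  by (cases u) (auto simp: Fract_conv_to_fract)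

lemma nonsquare: "u^2 \<noteq> to_fract f"
proof
  assume u: "u^2 = to_fract f"
  obtain A C where C: "C \<noteq> 0" and A: "u = to_fract A / to_fract C" by (rule fract_quotient)
  have "to_fract (A^2) = to_fract (f * C^2)" using u C unfolding A by (simp add: power_divide field_simps)
  then have eq: "A^2 = f * C^2" unfolding to_fract_eq_iff .
  then have "A \<noteq> 0" using C f_neq_0 by auto
  then have "2 * degree A = degree f + 2 * degree C"
    using arg_cong[OF eq, of degree] C f_neq_0 by (simp add: degree_mult_eq degree_power_eq)
  then show False using odd by presburger
qed

text \<open>At a simple root of \<open>f\<close> the two sides have orders 0 and 1 modulo 3. This is
  what excludes 3-torsion.\<close>

lemma noncube: "u^3 \<noteq> - 4 * to_fract f"
proof
  assume u: "u^3 = - 4 * to_fract f"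
  obtain A C where C: "C \<noteq> 0" and A: "u = to_fract A / to_fract C" by (rule fract_quotient)
  have "to_fract (A^3) = to_fract (- (4 * (f * C^3)))"
    using u C unfolding A by (simp add: power_divide field_simps)
  then have "A^3 = - (4 * (f * C^3))" unfolding to_fract_eq_iff .
  then have "acp (A^3) = acp (- (4 * (f * C^3)))" by (rule arg_cong)
  then have "acp A^3 = - (4 * (acp f * acp C^3))" by (simp only: acp_simps acp_power acp_numeral)
  then have eq: "acp A^3 = smult (- 4) (acp f * acp C^3)" by (simp add: numeral_mult_poly)
  have "(2 * 2 :: 'k) \<noteq> 0" using two by (simp only: mult_eq_0_iff) simp
  then have "to_ac (4::'k) \<noteq> 0" by (simp del: to_ac_numeral)
  then have four: "(4::'k alg_closure) \<noteq> 0" by simp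
  obtain z where z: "order z (acp f) = 1" by (rule simple_root)
  have "acp A \<noteq> 0" using eq C f_neq_0 four by auto
  then have "3 * order z (acp A) = 1 + 3 * order z (acp C)"
    using arg_cong[OF eq, of "order z"] C f_neq_0 four z
    by (simp add: order_power' order_smult order_mult)
  then show False by presburger
qed

lemma descent: "descent (to_fract f)"
proof
  have "to_fract [:2::'k:] \<noteq> 0" "to_fract [:3::'k:] \<noteq> 0" using two three by simp_all
  then show "(2 :: 'k poly fract) \<noteq> 0" "(3 :: 'k poly fract) \<noteq> 0"
    by (simp_all flip: numeral_poly)
qed (use f_neq_0 nonsquare in auto)

sublocale D: descent "to_fract f"
  by (rule descent)

lemma integral_pointE:
  assumes "P \<in> integral_points f"
  obtains x y where "P = Affine (to_fract x) (to_fract y)" "y^2 = x^3 + f"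
    "naive_height P = degree x / 2"
proof -
  obtain x y where P: "P = Affine (to_fract x) (to_fract y)"
    and "(to_fract y)^2 = (to_fract x)^3 + to_fract f"
    using assms by (auto simp: integral_points_def on_curve_def)
  then have "to_fract (y^2) = to_fract (x^3 + f)" by simp
  then have eq: "y^2 = x^3 + f" unfolding to_fract_eq_iff .
  have "inj (to_fract :: 'k poly \<Rightarrow> _)" by (auto simp: inj_def)
  then have "naive_height P = max (degree x / 2) (degree y / 3)" by (simp add: P)
  also have "\<dots> = degree x / 2" using degree_integral_point[OF eq odd] by (simp add: max_def)
  finally show ?thesis using that P eq by blast
qed

text \<open>The common denominator \<open>C\<close> need not be reduced: later only orders and
  degrees of \<open>B\<close> and \<open>C\<close> are compared.\<close>

lemma cube_polynomials:
  assumes "D.is_cube (D.quad (to_fract Y) (to_fract g))"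
  obtains A B C :: "'k poly" where "C \<noteq> 0" "A^3 + 3 * (A * B^2 * f) = C^3 * Y"
    "3 * (A^2 * B) + B^3 * f = C^3 * g"
proof -
  obtain u v where "D.quad (to_fract Y) (to_fract g) = D.quad u v ^ 3"
    using assms unfolding D.is_cube_def by blast
  then have uv: "to_fract Y = u^3 + 3 * u * v^2 * to_fract f" "to_fract g = 3 * u^2 * v + v^3 * to_fract f"
    unfolding D.quad_cube D.quad_eq_iff by auto
  obtain A0 C1 where C1: "C1 \<noteq> 0" and A0: "u = to_fract A0 / to_fract C1" by (rule fract_quotient)
  obtain B0 C2 where C2: "C2 \<noteq> 0" and B0: "v = to_fract B0 / to_fract C2" by (rule fract_quotient)
  define A B C where "A = A0 * C2" and "B = B0 * C1" and "C = C1 * C2"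
  have C: "C \<noteq> 0" using C1 C2 by (simp add: C_def)
  have A: "to_fract A = u * to_fract C" and B: "to_fract B = v * to_fract C"
    using C1 C2 by (simp_all add: A_def B_def C_def A0 B0)
  have "to_fract (A^3 + 3 * (A * B^2 * f)) = to_fract (C^3 * Y)"
    by (simp add: A B uv algebra_simps power2_eq_square power3_eq_cube)
  moreover have "to_fract (3 * (A^2 * B) + B^3 * f) = to_fract (C^3 * g)"
    by (simp add: A B uv algebra_simps power2_eq_square power3_eq_cube)
  ultimately show ?thesis using that C unfolding to_fract_eq_iff by blast
qed

lemma integral_point_notin_dual_image:
  assumes "P \<in> integral_points f"
  shows "P \<notin> dual_image f"
proof
  assume "P \<in> dual_image f"
  then have cube: "D.is_cube (D.desc P)" unfolding dual_image_def D.dimage_iff by blast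
  obtain x y where P: "P = Affine (to_fract x) (to_fract y)" "y^2 = x^3 + f"
    using assms by (rule integral_pointE)
  have "D.is_cube (D.quad (to_fract y) (to_fract 1))" using cube P by (simp add: D.desc_def)
  then obtain A B C :: "'k poly" where C: "C \<noteq> 0" and re: "A^3 + 3 * (A * B^2 * f) = C^3 * y"
    and im: "3 * (A^2 * B) + B^3 * f = C^3 * 1" by (rule cube_polynomials)
  show False
  proof (rule integral_point_not_cube[of "acp C" "acp A" "acp B" "acp f" "acp y" "acp x" "acp f3"])
    show "(2::'k alg_closure) \<noteq> 0" "(3::'k alg_closure) \<noteq> 0"
      using two three by (metis to_ac_eq_0_iff to_ac_numeral)+
    show "acp A ^ 3 + 3 * (acp A * acp B ^ 2 * acp f) = acp C ^ 3 * acp y"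
      using arg_cong[OF re, of acp] by simp
    show "3 * (acp A ^ 2 * acp B) + acp B ^ 3 * acp f = acp C ^ 3"
      using arg_cong[OF im, of acp] by simp
    show "acp y ^ 2 = acp x ^ 3 + acp f" using arg_cong[OF P(2), of acp] by simp
  qed (use C odd order_f_cases f_neq_0 order_f_eq_3 degree_f3 in auto)
qed

definition factors :: "'k poly set" where
  "factors = {q. Factorial_Ring.irreducible q \<and> lead_coeff q = 1 \<and> q dvd f3}"

fun bad_factors :: "'k poly fract point \<Rightarrow> 'k poly set" where
  "bad_factors Infinity = {}"
| "bad_factors (Affine x y) = {q \<in> factors. \<exists>p. x = to_fract p \<and> q dvd p}"

lemma finite_factors: "finite factors" and card_factors: "card factors = num_irreducible_factors f3"
  using finite_irreducible_factors[OF f_neq_0(3)]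
  by (simp_all add: factors_def num_irreducible_factors_def)

text \<open>The primes dividing \<open>f\<^sub>3\<close> may or may not divide \<open>x\<close>; this choice is the factor \<open>2\<close> per prime
  in the bound on the fibres.\<close>

lemma same_coset_gap:
  assumes P: "P \<in> integral_points f" and Q: "Q \<in> integral_points f"
    and eq: "quotient_map f P = quotient_map f Q" and bad: "bad_factors P = bad_factors Q"
    and gap: "naive_height P < 2 * naive_height Q" "naive_height Q < 2 * naive_height P"
  shows "\<exists>x x' y. P = Affine x y \<and> Q = Affine x' y"
proof -
  obtain x1 y1 where P': "P = Affine (to_fract x1) (to_fract y1)" "y1^2 = x1^3 + f"
    "naive_height P = degree x1 / 2" using P by (rule integral_pointE)
  obtain x2 y2 where Q': "Q = Affine (to_fract x2) (to_fract y2)" "y2^2 = x2^3 + f"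
    "naive_height Q = degree x2 / 2" using Q by (rule integral_pointE)
  have on: "on_curve (to_fract f) P" "on_curve (to_fract f) Q"
    using P Q by (auto simp: integral_points_def)
  have "D.is_cube (D.desc P / D.desc Q)"
    using D.coset_eq_imp_cube[OF on] eq unfolding quotient_map_def dual_image_def by blast
  \<comment> \<open>Division by \<open>desc Q\<close> is replaced by multiplication by
    \<open>desc (point_neg Q)\<close>, so the coefficients stay polynomials. The cube of
    \<open>-1\<close> turns \<open>-y2 + sqrt f\<close> into \<open>y2 - sqrt f\<close>.\<close>
  from D.is_cube_mult[OF D.is_cube_mult[OF this D.desc_mult_neg[OF on(2)]] D.is_cube_to_ac[of "- 1"]]
  have "D.is_cube (- (D.desc P * D.desc (point_neg Q)))" using D.desc_neq_0[of Q] by simp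
  also have "- (D.desc P * D.desc (point_neg Q)) = D.quad (to_fract (y1 * y2 - f)) (to_fract (y2 - y1))"
    by (simp add: P' Q' D.desc_def D.quad_mult) (simp add: D.quad_def algebra_simps)
  finally obtain A B C :: "'k poly" where C: "C \<noteq> 0"
    and re: "A^3 + 3 * (A * B^2 * f) = C^3 * (y1 * y2 - f)"
    and im: "3 * (A^2 * B) + B^3 * f = C^3 * (y2 - y1)" by (rule cube_polynomials)
  have "y1 = y2"
  proof (rule ccontr)
    assume ne: "y1 \<noteq> y2"
    have "degree (acp x1) + degree (acp x2) \<le> degree (acp y2 - acp y1)"
    proof (rule degree_of_cube_quotient[of "acp C" "acp A" "acp B" "acp f"])
      show "(2::'k alg_closure) \<noteq> 0" "(3::'k alg_closure) \<noteq> 0"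
        using two three by (metis to_ac_eq_0_iff to_ac_numeral)+
      show "acp A ^ 3 + 3 * (acp A * acp B ^ 2 * acp f) = acp C ^ 3 * (acp y1 * acp y2 - acp f)"
        using arg_cong[OF re, of acp] by simp
      show "3 * (acp A ^ 2 * acp B) + acp B ^ 3 * acp f = acp C ^ 3 * (acp y2 - acp y1)"
        using arg_cong[OF im, of acp] by simp
      show "acp y1 ^ 2 = acp x1 ^ 3 + acp f" "acp y2 ^ 2 = acp x2 ^ 3 + acp f"
        using arg_cong[OF P'(2), of acp] arg_cong[OF Q'(2), of acp] by simp_all
      show "poly (acp x1) z = 0 \<longleftrightarrow> poly (acp x2) z = 0" if "order z (acp f) = 3" for z
      proof -
        have z: "poly (acp f3) z = 0" using order_f_eq_3[OF that] .
        obtain q where q: "Factorial_Ring.irreducible q" "lead_coeff q = 1"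
          "\<And>g. poly (acp g) z = 0 \<longleftrightarrow> q dvd g"
          using irreducible_polynomial_of_root[OF f_neq_0(3) z] by blast
        have "q \<in> factors" using q z by (auto simp: factors_def)
        then have "q dvd x1 \<longleftrightarrow> q dvd x2" using bad unfolding P' Q' by auto
        then show ?thesis using q(3) by simp
      qed
    qed (use C odd order_f_cases ne in auto)
    also have "acp y2 - acp y1 = acp (y2 - y1)" by simp
    finally have "degree x1 + degree x2 \<le> degree (y2 - y1)" unfolding degree_acp .
    also have "\<dots> \<le> max (degree y2) (degree y1)" by (rule degree_diff_le_max)
    \<comment> \<open>Hence the smaller of the two degrees is at most half of the larger.\<close>
    finally have "2 * (degree x1 + degree x2) \<le> 3 * max (degree x2) (degree x1)"
      using degree_integral_point[OF P'(2) odd] degree_integral_point[OF Q'(2) odd]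
      by (auto simp: max_def split: if_splits)
    then show False using gap unfolding P'(3) Q'(3) by (simp add: max_def split: if_splits)
  qed
  then show ?thesis using P' Q' by blast
qed

lemma naive_height_bounds:
  assumes "P \<in> integral_points f"
  shows "degree f / 6 \<le> naive_height P" "naive_height P < degree f"
proof -
  obtain x y where P: "y^2 = x^3 + f" "naive_height P = degree x / 2"
    using assms by (rule integral_pointE)
  show "degree f / 6 \<le> naive_height P"
    using degree_integral_point[OF P(1) odd] unfolding P(2) by simp
  obtain z where "order z (acp f) = 1" by (rule simple_root)
  moreover have "acp y ^ 2 = acp x ^ 3 + acp f" using arg_cong[OF P(1), of acp] by simp
  ultimately have "degree (acp x) + 2 \<le> 2 * degree (acp f)"
    using odd by (intro degree_integral_point_upper) auto
  then show "naive_height P < degree f" unfolding P(2) by simp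
qed

end


text \<open>Without nontrivial cube roots of unity, \<open>x\<close> and \<open>y\<close> have the
  same leading coefficient \<open>c\<close>; then \<open>x^2 + x*y + y^2\<close> has leading
  coefficient \<open>3*c^2\<close> and cannot vanish.\<close>

lemma cube_root_unique:
  fixes x y :: "'k::field poly"
  assumes three: "(3::'k) \<noteq> 0" and unity: "\<And>c::'k. c^3 = 1 \<Longrightarrow> c = 1" and eq: "x^3 = y^3"
  shows "x = y"
proof (rule ccontr)
  assume ne: "x \<noteq> y"
  have "(x - y) * (x * x + x * y + y * y) = 0"
    using eq by (simp add: power3_eq_cube algebra_simps)
  then have s: "x * x + x * y + y * y = 0" using ne by simp
  have nz: "x \<noteq> 0" "y \<noteq> 0" using eq ne by auto
  have deg: "degree x = degree y"
    using arg_cong[OF eq, of degree] nz by (simp add: degree_power_eq)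
  define a c where "a = lead_coeff x" and "c = lead_coeff y"
  have ac: "a \<noteq> 0" "c \<noteq> 0" using nz by (simp_all add: a_def c_def)
  have "a^3 = c^3" using arg_cong[OF eq, of lead_coeff] by (simp add: a_def c_def lead_coeff_power)
  then have "(a / c)^3 = 1" using ac by (simp add: power_divide)
  then have "a = c" using unity ac by fastforce
  have "coeff (x * x + x * y + y * y) (degree y + degree y) = a * a + a * c + c * c"
    using coeff_mult_degree_sum[of x x] coeff_mult_degree_sum[of x y] coeff_mult_degree_sum[of y y]
    by (simp add: deg a_def c_def)
  also have "\<dots> = 3 * c^2" using \<open>a = c\<close> by (simp add: power2_eq_square)
  finally show False using s three ac by simp
qed

section \<open>Fibres of the natural map and the final count\<close>

context curve_data
begin

lemma points_with_same_y:
  "finite {P \<in> integral_points f. \<exists>x. P = Affine x y} \<and>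
   card {P \<in> integral_points f. \<exists>x. P = Affine x y} \<le> 3"
proof -
  define p where "p = [:to_fract f - y^2, 0, 0, 1:]"
  have p: "p \<noteq> 0" "degree p = 3" by (simp_all add: p_def)
  have sub: "{P \<in> integral_points f. \<exists>x. P = Affine x y} \<subseteq> (\<lambda>x. Affine x y) ` {x. poly p x = 0}"
    by (auto simp: integral_points_def on_curve_def p_def power3_eq_cube algebra_simps)
  have fin: "finite {x. poly p x = 0}" using p by (intro poly_roots_finite)
  have "card {P \<in> integral_points f. \<exists>x. P = Affine x y} \<le> card ((\<lambda>x. Affine x y) ` {x. poly p x = 0})"
    using sub fin by (intro card_mono) auto
  also have "\<dots> \<le> card {x. poly p x = 0}" using fin by (rule card_image_le)
  also have "\<dots> \<le> 3" using card_poly_roots_bound[OF p(1)] p by simp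
  finally show ?thesis using finite_subset[OF sub] fin by simp
qed

lemma point_with_same_y_unique:
  assumes "\<And>c::'k. c^3 = 1 \<Longrightarrow> c = 1"
  shows "card {P \<in> integral_points f. \<exists>x. P = Affine x y} \<le> 1"
proof -
  have "P = Q" if PQ: "P \<in> integral_points f" "Q \<in> integral_points f" "P = Affine x1 y" "Q = Affine x2 y"
    for P Q x1 x2
  proof -
    obtain x y' where P: "P = Affine (to_fract x) (to_fract y')" "y'^2 = x^3 + f"
      using PQ(1) by (rule integral_pointE)
    obtain x' y'' where Q: "Q = Affine (to_fract x') (to_fract y'')" "y''^2 = x'^3 + f"
      using PQ(2) by (rule integral_pointE)
    have y: "to_fract y' = to_fract y''" using PQ P Q by simp
    then have "x^3 = x'^3" using P(2) Q(2) by (simp add: eq_diff_eq)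
    then have "x = x'" using cube_root_unique[OF three] assms by blast
    then show ?thesis using P Q y by simp
  qed
  then show ?thesis using points_with_same_y by (auto simp: card_le_Suc0_iff_eq)
qed

text \<open>A fibre is split by the set of primes of \<open>f3\<close> that divide \<open>x\<close>.
  Within one piece \<open>same_coset_gap\<close> forces a common \<open>y\<close>, so the piece has
  at most \<open>m\<close> points; \<open>m\<close> will be 1 or 3 according to the cube roots of
  unity in \<open>k\<close>.\<close>

lemma at_most_to_one_quotient_map:
  assumes A: "A \<subseteq> integral_points f"
    and gap: "\<And>P Q. P \<in> A \<Longrightarrow> Q \<in> A \<Longrightarrow> naive_height P < 2 * naive_height Q"
    and m: "\<And>y. card {P \<in> integral_points f. \<exists>x. P = Affine x y} \<le> m"
  shows "at_most_to_one (m * 2 ^ num_irreducible_factors f3) (quotient_map f) A"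
  unfolding at_most_to_one_def
proof
  fix c
  define F where "F = {a \<in> A. quotient_map f a = c}"
  define G where "G \<sigma> = {a \<in> F. bad_factors a = \<sigma>}" for \<sigma>
  have G: "finite (G \<sigma>) \<and> card (G \<sigma>) \<le> m" for \<sigma>
  proof (cases "G \<sigma> = {}")
    case False
    then obtain P where P: "P \<in> G \<sigma>" by blast
    then have PI: "P \<in> integral_points f" using A by (auto simp: G_def F_def)
    obtain x y where P': "P = Affine x y" using PI by (auto simp: integral_points_def)
    have "G \<sigma> \<subseteq> {P \<in> integral_points f. \<exists>x. P = Affine x y}"
    proof
      fix Q assume Q: "Q \<in> G \<sigma>"
      then have QI: "Q \<in> integral_points f" using A by (auto simp: G_def F_def)
      have "\<exists>x x' y. P = Affine x y \<and> Q = Affine x' y"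
        using P Q gap by (intro same_coset_gap PI QI) (auto simp: G_def F_def)
      then show "Q \<in> {P \<in> integral_points f. \<exists>x. P = Affine x y}" using QI P' by auto
    qed
    moreover have "finite {P \<in> integral_points f. \<exists>x. P = Affine x y}"
      using points_with_same_y by blast
    ultimately show ?thesis using m card_mono finite_subset le_trans by meson
  qed simp
  have "bad_factors a \<subseteq> factors" for a by (cases a) auto
  then have F: "F = (\<Union>\<sigma>\<in>Pow factors. G \<sigma>)" by (auto simp: G_def)
  have "card F \<le> (\<Sum>\<sigma>\<in>Pow factors. card (G \<sigma>))"
    unfolding F using finite_factors by (intro card_UN_le) simp
  also have "\<dots> \<le> (\<Sum>\<sigma>\<in>Pow factors. m)" using G by (intro sum_mono) blast
  also have "\<dots> = m * 2 ^ num_irreducible_factors f3"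
    using finite_factors by (simp add: card_Pow card_factors)
  finally have "card F \<le> m * 2 ^ num_irreducible_factors f3" .
  moreover have "finite F" unfolding F using finite_factors G by auto
  ultimately show "finite {a \<in> A. quotient_map f a = c} \<and>
      card {a \<in> A. quotient_map f a = c} \<le> m * 2 ^ num_irreducible_factors f3"
    unfolding F_def by blast
qed

text \<open>Together with the zero class, which they avoid, the classes of integral points number at
  most \<open>B\<close>.\<close>

lemma card_integral_points_le:
  fixes B :: real
  assumes A: "A \<subseteq> integral_points f"
    and fib: "at_most_to_one M (quotient_map f) A"
    and B: "\<And>S. finite S \<Longrightarrow> S \<subseteq> carrier (curve_group (to_fract f)) \<Longrightarrow>
      inj_on (quotient_map f) S \<Longrightarrow> card S \<le> B"
  shows "finite A \<and> card A \<le> M * (B - 1)"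
proof -
  \<comment> \<open>The set of classes is not known to be finite in advance, so its finite subsets
    are bounded uniformly. The floor is there because \<open>B\<close> may be irrational.\<close>
  have C: "card C + 1 \<le> nat \<lfloor>B\<rfloor>" if C: "C \<subseteq> quotient_map f ` A" "finite C" for C
  proof -
    obtain S where S: "S \<subseteq> A" "inj_on (quotient_map f) S" "C = quotient_map f ` S"
      using C(1) by (auto simp: subset_image_inj)
    have finS: "finite S" using S C finite_image_iff by blast
    have SI: "S \<subseteq> integral_points f" using S A by blast
    have "quotient_map f Infinity \<noteq> quotient_map f P" if "P \<in> S" for P
    proof
      assume eq: "quotient_map f Infinity = quotient_map f P"
      have P: "P \<in> integral_points f" using that SI by blast
      then have "on_curve (to_fract f) P" by (simp add: integral_points_def)
      from D.coset_eq_imp_cube[OF this, of Infinity] eq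
      have "D.is_cube (D.desc P)"
        unfolding quotient_map_def dual_image_def by (simp add: on_curve_def D.desc_def[of Infinity])
      then have "P \<in> dual_image f"
        unfolding dual_image_def D.dimage_iff using P by (simp add: integral_points_def)
      then show False using integral_point_notin_dual_image P by blast
    qed
    then have "inj_on (quotient_map f) (insert Infinity S)" using S(2) by (auto simp: inj_on_def)
    moreover have "insert Infinity S \<subseteq> carrier (curve_group (to_fract f))"
      using SI by (auto simp: integral_points_def on_curve_def)
    ultimately have "card (insert Infinity S) \<le> B" using finS by (intro B) auto
    moreover have "Infinity \<notin> S" using SI by (auto simp: integral_points_def)
    ultimately have "real (card S + 1) \<le> B" using finS by simp
    then have "card S + 1 \<le> nat \<lfloor>B\<rfloor>" by (rule le_nat_floor)
    then show ?thesis using S by (simp add: card_image)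
  qed
  have B1: "1 \<le> nat \<lfloor>B\<rfloor>" using C[of "{}"] by simp
  have "card C \<le> nat \<lfloor>B\<rfloor> - 1" if "C \<subseteq> quotient_map f ` A" "finite C" for C
    using C[OF that] by simp
  then have fin: "finite (quotient_map f ` A)" and card: "card (quotient_map f ` A) \<le> nat \<lfloor>B\<rfloor> - 1"
    using finite_if_finite_subsets_card_bdd[of "quotient_map f ` A"] by auto
  have AU: "A = (\<Union>c\<in>quotient_map f ` A. {a \<in> A. quotient_map f a = c})" by auto
  have "finite (\<Union>c\<in>quotient_map f ` A. {a \<in> A. quotient_map f a = c})"
    using fib by (intro finite_UN_I fin) (simp add: at_most_to_one_def)
  then have fA: "finite A" unfolding AU[symmetric] .
  have "card A \<le> (\<Sum>c\<in>quotient_map f ` A. card {a \<in> A. quotient_map f a = c})"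
    by (subst AU) (rule card_UN_le[OF fin])
  also have "\<dots> \<le> (\<Sum>c\<in>quotient_map f ` A. M)"
    using fib by (intro sum_mono) (auto simp: at_most_to_one_def)
  also have "\<dots> \<le> M * (nat \<lfloor>B\<rfloor> - 1)" using card by simp
  finally have "card A \<le> M * (nat \<lfloor>B\<rfloor> - 1)" .
  then have "real (card A) \<le> real (M * (nat \<lfloor>B\<rfloor> - 1))" by (simp only: of_nat_le_iff)
  also have "\<dots> = real M * (real (nat \<lfloor>B\<rfloor>) - 1)" using B1 by (simp add: of_nat_diff)
  also have "real (nat \<lfloor>B\<rfloor>) \<le> B" using B1 by linarith
  finally show ?thesis using fA by (simp add: mult_left_mono)
qed

text \<open>The bounds \<open>d/6 \<le> h < d\<close> close the two outer ranges, whose end points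
  then have ratios 3/2 and 2; the middle range has ratio 2 by itself, and all upper ends are
  excluded.\<close>

lemma gaps:
  assumes "A = {P \<in> integral_points f. naive_height P < real (degree f) / 4} \<or>
    A = {P \<in> integral_points f. real (degree f) / 4 \<le> naive_height P \<and> naive_height P < real (degree f) / 2} \<or>
    A = {P \<in> integral_points f. real (degree f) / 2 \<le> naive_height P}"
    and "P \<in> A" "Q \<in> A"
  shows "naive_height P < 2 * naive_height Q"
proof -
  have d: "real (degree f) > 0" using odd by (cases "degree f") auto
  have "P \<in> integral_points f" "Q \<in> integral_points f" using assms by auto
  then show ?thesis using assms d naive_height_bounds[of P] naive_height_bounds[of Q] by auto
qed

lemma fibres:
  assumes "\<And>y. card {P \<in> integral_points f. \<exists>x. P = Affine x y} \<le> m"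
  shows "at_most_to_one (m * 2 ^ num_irreducible_factors f3) (quotient_map f)
      {P \<in> integral_points f. naive_height P < real (degree f) / 4}"
    "at_most_to_one (m * 2 ^ num_irreducible_factors f3) (quotient_map f)
      {P \<in> integral_points f. real (degree f) / 4 \<le> naive_height P \<and> naive_height P < real (degree f) / 2}"
    "at_most_to_one (m * 2 ^ num_irreducible_factors f3) (quotient_map f)
      {P \<in> integral_points f. real (degree f) / 2 \<le> naive_height P}"
proof -
  note rule = at_most_to_one_quotient_map[OF _ gaps assms]
  show "at_most_to_one (m * 2 ^ num_irreducible_factors f3) (quotient_map f)
      {P \<in> integral_points f. naive_height P < real (degree f) / 4}"
    by (rule rule[OF _ disjI1[OF refl]]) auto
  show "at_most_to_one (m * 2 ^ num_irreducible_factors f3) (quotient_map f)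
      {P \<in> integral_points f. real (degree f) / 4 \<le> naive_height P \<and> naive_height P < real (degree f) / 2}"
    by (rule rule[OF _ disjI2[OF disjI1[OF refl]]]) auto
  show "at_most_to_one (m * 2 ^ num_irreducible_factors f3) (quotient_map f)
      {P \<in> integral_points f. real (degree f) / 2 \<le> naive_height P}"
    by (rule rule[OF _ disjI2[OF disjI2[OF refl]]]) auto
qed

lemma card_bounds:
  fixes B :: real and m M :: nat
  assumes m: "\<And>y. card {P \<in> integral_points f. \<exists>x. P = Affine x y} \<le> m"
    and B: "\<And>S. finite S \<Longrightarrow> S \<subseteq> carrier (curve_group (to_fract f)) \<Longrightarrow>
      inj_on (quotient_map f) S \<Longrightarrow> card S \<le> B"
    and M: "M = m * 2 ^ num_irreducible_factors f3"
  shows "ereal_of_enat (ecard {P \<in> integral_points f. naive_height P < real (degree f) / 4}) \<le> ereal (M * (B - 1))"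
    "ereal_of_enat (ecard {P \<in> integral_points f. real (degree f) / 4 \<le> naive_height P}) \<le> ereal (2 * M * B)"
    "ereal_of_enat (ecard (integral_points f)) \<le> ereal (M * (3 * B - 1))"
proof -
  let ?A1 = "{P \<in> integral_points f. naive_height P < real (degree f) / 4}"
  let ?A2 = "{P \<in> integral_points f. real (degree f) / 4 \<le> naive_height P \<and> naive_height P < real (degree f) / 2}"
  let ?A3 = "{P \<in> integral_points f. real (degree f) / 2 \<le> naive_height P}"
  note fib = fibres[OF m, folded M]
  have 1: "finite ?A1 \<and> card ?A1 \<le> M * (B - 1)" by (rule card_integral_points_le[OF _ fib(1) B]) auto
  have 2: "finite ?A2 \<and> card ?A2 \<le> M * (B - 1)" by (rule card_integral_points_le[OF _ fib(2) B]) auto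
  have 3: "finite ?A3 \<and> card ?A3 \<le> M * (B - 1)" by (rule card_integral_points_le[OF _ fib(3) B]) auto
  \<comment> \<open>Only the lowest range keeps \<open>B - 1\<close>; then
    \<open>M * (B - 1) + 2 * M * B = M * (3 * B - 1)\<close> is the shape of the total
    bound.\<close>
  have M0: "M * (B - 1) \<le> M * B" by (simp add: mult_left_mono)
  have 23: "{P \<in> integral_points f. real (degree f) / 4 \<le> naive_height P} = ?A2 \<union> ?A3" by auto
  have 123: "integral_points f = ?A1 \<union> (?A2 \<union> ?A3)" by auto
  have c23: "card (?A2 \<union> ?A3) \<le> 2 * M * B"
    using card_Un_le[of ?A2 ?A3] 2 3 M0 by linarith
  have "card (?A1 \<union> (?A2 \<union> ?A3)) \<le> M * (B - 1) + 2 * M * B"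
    using card_Un_le[of ?A1 "?A2 \<union> ?A3"] 1 c23 by linarith
  then have c123: "card (integral_points f) \<le> M * (3 * B - 1)"
    unfolding 123[symmetric] by (simp add: algebra_simps)
  show "ereal_of_enat (ecard ?A1) \<le> ereal (M * (B - 1))" using 1 by (simp add: ecard_def)
  show "ereal_of_enat (ecard {P \<in> integral_points f. real (degree f) / 4 \<le> naive_height P}) \<le> ereal (2 * M * B)"
    unfolding 23 using 2 3 c23 by (simp add: ecard_def)
  have "finite (integral_points f)" using 1 2 3 by (subst 123) simp
  then show "ereal_of_enat (ecard (integral_points f)) \<le> ereal (M * (3 * B - 1))"
    using c123 by (simp add: ecard_def)
qed

lemma card_quotient_le:
  assumes rk: "int_rank (curve_group (to_fract f)) = enat n"
    and S: "finite S" "S \<subseteq> carrier (curve_group (to_fract f))" "inj_on (quotient_map f) S"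
  shows "real (card S) \<le> 3 powr n"
    and "\<zeta>^2 + \<zeta> + 1 = (0::'k) \<Longrightarrow> real (card S) \<le> 3 powr (n / 2)"
proof -
  have rank: "card U \<le> n" if "int_independent (curve_group (to_fract f)) U" for U
  proof -
    have "enat (card U) \<le> int_rank (curve_group (to_fract f))"
      unfolding int_rank_def using that by (intro SUP_upper) simp
    then show ?thesis unfolding rk by simp
  qed
  have inj: "inj_on (\<lambda>P. D.dimage #>\<^bsub>curve_group (to_fract f)\<^esub> P) S"
    using S(3) unfolding quotient_map_def dual_image_def .
  have "card S \<le> 3 ^ n" by (rule D.card_cosets_le[OF noncube rank S(1,2) inj])
  then have "real (card S) \<le> real (3 ^ n)" by (simp only: of_nat_le_iff)
  then show "real (card S) \<le> 3 powr n" by (simp add: powr_realpow)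
  assume \<zeta>: "\<zeta>^2 + \<zeta> + 1 = (0::'k)"
  have "to_fract [:\<zeta>:]^2 + to_fract [:\<zeta>:] + 1 = to_fract ([:\<zeta>:]^2 + [:\<zeta>:] + 1)" by simp
  also have "[:\<zeta>:]^2 + [:\<zeta>:] + 1 = [:\<zeta>^2 + \<zeta> + 1:]" by (simp add: one_pCons power2_eq_square)
  finally have "to_fract [:\<zeta>:]^2 + to_fract [:\<zeta>:] + 1 = 0" unfolding \<zeta> by simp
  from D.card_cosets_square_le[OF this noncube rank S(1,2) inj]
  have "real ((card S)^2) \<le> real (3 ^ n)" by (simp only: of_nat_le_iff)
  moreover have "(3 powr (n / 2)) ^ 2 = (3 :: real) ^ n"
    unfolding power2_eq_square powr_add[symmetric] by (simp add: powr_realpow)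
  ultimately have "real (card S) ^ 2 \<le> (3 powr (n / 2)) ^ 2" by simp
  then show "real (card S) \<le> 3 powr (n / 2)" by (rule power2_le_imp_le) simp
qed

end

text \<open>For a nontrivial cube root of unity \<open>c\<close>, the roots of
  \<open>X^2 + X + 1\<close> are \<open>c\<close> and \<open>c^2\<close>. So \<open>z\<close> lies
  in \<open>k\<close> as soon as \<open>k\<close> contains one such \<open>c\<close>.\<close>

lemma cube_root_of_unity_cases:
  fixes z :: "'k::field alg_closure"
  assumes z: "z^3 = 1" "z \<noteq> 1"
  shows "z \<notin> range to_ac \<Longrightarrow> c^3 = (1::'k) \<Longrightarrow> c = 1"
    and "z \<in> range to_ac \<Longrightarrow> \<exists>\<zeta>::'k. \<zeta>^2 + \<zeta> + 1 = 0"
proof -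
  have fac: "u^3 - 1 = (u - 1) * (u^2 + u + 1)" for u :: "'r::comm_ring_1"
    by (simp add: power2_eq_square power3_eq_cube algebra_simps)
  have root: "u^2 + u + 1 = 0" if "u^3 = 1" "u \<noteq> 1" for u :: "'r::field"
    using fac[of u] that by simp
  show "c = 1" if "z \<notin> range to_ac" "c^3 = (1::'k)"
  proof (rule ccontr)
    assume "c \<noteq> 1"
    have c3: "to_ac c^3 = 1" using that(2) by (metis to_ac_1 to_ac_power)
    have "to_ac c \<noteq> 1" using \<open>c \<noteq> 1\<close> by (metis to_ac_1 to_ac_eq_iff)
    then have c2: "to_ac c + to_ac c^2 = - 1" using root[OF c3] by (simp add: eq_neg_iff_add_eq_0 ac_simps)
    have z2: "z^2 + z + 1 = 0" using root[OF z] .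
    have "(z - to_ac c) * (z - to_ac (c^2)) = z^2 - (to_ac c + to_ac c^2) * z + to_ac c^3"
      by (simp add: power2_eq_square power3_eq_cube algebra_simps)
    also have "\<dots> = 0" unfolding c3 c2 using z2 by simp
    finally have "z = to_ac c \<or> z = to_ac (c^2)" by simp
    then show False using that(1) by blast
  qed
  show "\<exists>\<zeta>::'k. \<zeta>^2 + \<zeta> + 1 = 0" if "z \<in> range to_ac"
  proof -
    obtain \<zeta> where \<zeta>: "z = to_ac \<zeta>" using \<open>z \<in> range to_ac\<close> by blast
    have "to_ac (\<zeta>^3) = to_ac 1" "\<zeta> \<noteq> 1" using z unfolding \<zeta> by auto
    then show ?thesis using root[of \<zeta>] unfolding to_ac_eq_iff by blast
  qed
qed

lemma ereal_two_power: "(2::ereal) ^ w = ereal (2 ^ w)"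
  by (metis ereal_power numeral_eq_ereal)

theorem theorem6p11:
  fixes f f1 f3 f5 :: "'k::field poly" and zeta3 :: "'k alg_closure"
  defines "d \<equiv> real (Polynomial.degree f)"
    and "w3 \<equiv> num_irreducible_factors f3"
    and "rk \<equiv> ereal_of_enat (int_rank (curve_group (to_fract f)))"
    and "EI \<equiv> integral_points f"
  assumes perfect: "perfect_field TYPE('k)"
    and char: "CHAR('k) \<noteq> 2" "CHAR('k) \<noteq> 3"
    and f: "f = f1 * f3 ^ 3 * f5 ^ 5"
    and coprime: "coprime f1 f3" "coprime f1 f5" "coprime f3 f5"
    and separable: "separable f1" "separable f3" "separable f5"
    and nonconstant: "Polynomial.degree f1 > 0"
    and odd: "odd (Polynomial.degree f)"
    and zeta3: "zeta3 ^ 3 = 1" "zeta3 \<noteq> 1"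
  shows
    "\<comment> \<open>(i)\<close>
     (zeta3 \<notin> range to_ac \<longrightarrow>
        at_most_to_one (2 ^ w3) (quotient_map f) {P \<in> EI. naive_height P < d / 4}) \<and>
     (zeta3 \<in> range to_ac \<longrightarrow>
        at_most_to_one (3 * 2 ^ w3) (quotient_map f) {P \<in> EI. naive_height P < d / 4}) \<and>
     \<one>\<^bsub>curve_group (to_fract f) Mod dual_image f\<^esub>
       \<notin> quotient_map f ` {P \<in> EI. naive_height P < d / 4} \<and>
     (zeta3 \<notin> range to_ac \<longrightarrow>
        ereal_of_enat (ecard {P \<in> EI. naive_height P < d / 4}) \<le> 2 ^ w3 * (pow3 rk - 1)) \<and>
     (zeta3 \<in> range to_ac \<longrightarrow>
        ereal_of_enat (ecard {P \<in> EI. naive_height P < d / 4})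
          \<le> 2 ^ w3 * (pow3 (rk / 2 + 1) - 3)) \<and>
     \<comment> \<open>(ii)\<close>
     (zeta3 \<notin> range to_ac \<longrightarrow>
        at_most_to_one (2 ^ w3) (quotient_map f)
          {P \<in> EI. d / 4 \<le> naive_height P \<and> naive_height P < d / 2} \<and>
        at_most_to_one (2 ^ w3) (quotient_map f) {P \<in> EI. d / 2 \<le> naive_height P}) \<and>
     (zeta3 \<in> range to_ac \<longrightarrow>
        at_most_to_one (3 * 2 ^ w3) (quotient_map f)
          {P \<in> EI. d / 4 \<le> naive_height P \<and> naive_height P < d / 2} \<and>
        at_most_to_one (3 * 2 ^ w3) (quotient_map f) {P \<in> EI. d / 2 \<le> naive_height P}) \<and>
     (zeta3 \<notin> range to_ac \<longrightarrow>
        ereal_of_enat (ecard {P \<in> EI. d / 4 \<le> naive_height P})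
          \<le> 2 ^ (w3 + 1) * pow3 rk) \<and>
     (zeta3 \<in> range to_ac \<longrightarrow>
        ereal_of_enat (ecard {P \<in> EI. d / 4 \<le> naive_height P})
          \<le> 2 ^ (w3 + 1) * pow3 (rk / 2 + 1)) \<and>
     \<comment> \<open>(iii)\<close>
     (zeta3 \<notin> range to_ac \<longrightarrow>
        ereal_of_enat (ecard EI) \<le> 2 ^ w3 * (pow3 (rk + 1) - 1)) \<and>
     (zeta3 \<in> range to_ac \<longrightarrow>
        ereal_of_enat (ecard EI) \<le> 2 ^ w3 * (pow3 (rk / 2 + 2) - 3))"
proof -
  interpret curve_data f f1 f3 f5
    using two_three_neq_0[OF char] f coprime separable nonconstant odd by unfold_locales
  let ?N = "num_irreducible_factors f3"
  have fib1: "card {P \<in> integral_points f. \<exists>x. P = Affine x y} \<le> 1" if "zeta3 \<notin> range to_ac" for y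
    using cube_root_of_unity_cases(1)[OF zeta3 that] by (rule point_with_same_y_unique)
  have fib3: "card {P \<in> integral_points f. \<exists>x. P = Affine x y} \<le> 3" for y
    using points_with_same_y by blast
  note A1 = fibres[OF fib1, unfolded mult_1] and A3 = fibres[OF fib3]
  have zero: "\<one>\<^bsub>curve_group (to_fract f) Mod dual_image f\<^esub> \<notin> quotient_map f ` integral_points f"
  proof
    assume "\<one>\<^bsub>curve_group (to_fract f) Mod dual_image f\<^esub> \<in> quotient_map f ` integral_points f"
    then obtain P where P: "P \<in> integral_points f" "quotient_map f P = dual_image f"
      by (auto simp: FactGroup_def)
    then have "P \<in> dual_image f"
      unfolding quotient_map_def dual_image_def
      by (intro D.G.coset_join1[OF _ _ D.subgroup_dimage]) (auto simp: integral_points_def)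
    then show False using integral_point_notin_dual_image P by blast
  qed
  have bounds1: "ereal_of_enat (ecard {P \<in> integral_points f. naive_height P < real (degree f) / 4}) \<le> 2 ^ ?N * (pow3 rk - 1) \<and>
    ereal_of_enat (ecard {P \<in> integral_points f. real (degree f) / 4 \<le> naive_height P}) \<le> 2 ^ (?N + 1) * pow3 rk \<and>
    ereal_of_enat (ecard (integral_points f)) \<le> 2 ^ ?N * (pow3 (rk + 1) - 1)"
    if z: "zeta3 \<notin> range to_ac"
  proof (cases "int_rank (curve_group (to_fract f))")
    case (enat n)
    have rk: "rk = ereal n" by (simp add: rk_def enat)
    note b = card_bounds[OF fib1[OF z] card_quotient_le(1)[OF enat] refl]
    have "2 ^ ?N * (pow3 rk - 1) = ereal (real (1 * 2 ^ ?N) * (3 powr n - 1))"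
      by (simp add: rk pow3_def ereal_two_power one_ereal_def)
    moreover have "2 ^ (?N + 1) * pow3 rk = ereal (2 * real (1 * 2 ^ ?N) * 3 powr n)"
      by (simp add: rk pow3_def ereal_two_power del: power_Suc) simp
    moreover have "2 ^ ?N * (pow3 (rk + 1) - 1) = ereal (real (1 * 2 ^ ?N) * (3 * 3 powr n - 1))"
      by (simp add: rk pow3_def ereal_two_power powr_add one_ereal_def)
    ultimately show ?thesis using b by simp
  next
    case infinity
    \<comment> \<open>For infinite rank \<open>pow3\<close> is infinite, and so are the right-hand
      sides.\<close>
    then have "rk = \<infinity>" by (simp add: rk_def)
    then show ?thesis by (simp add: pow3_def ereal_two_power)
  qed
  have bounds3: "ereal_of_enat (ecard {P \<in> integral_points f. naive_height P < real (degree f) / 4}) \<le> 2 ^ ?N * (pow3 (rk / 2 + 1) - 3) \<and>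
    ereal_of_enat (ecard {P \<in> integral_points f. real (degree f) / 4 \<le> naive_height P}) \<le> 2 ^ (?N + 1) * pow3 (rk / 2 + 1) \<and>
    ereal_of_enat (ecard (integral_points f)) \<le> 2 ^ ?N * (pow3 (rk / 2 + 2) - 3)"
    if z: "zeta3 \<in> range to_ac"
  proof (cases "int_rank (curve_group (to_fract f))")
    case (enat n)
    have rk: "rk / 2 + 1 = ereal (n / 2 + 1)" "rk / 2 + 2 = ereal (n / 2 + 2)"
      by (simp_all add: rk_def enat numeral_eq_ereal one_ereal_def)
    obtain \<zeta> :: 'k where \<zeta>: "\<zeta>^2 + \<zeta> + 1 = 0" using cube_root_of_unity_cases(2)[OF zeta3 z] by blast
    note b = card_bounds[OF fib3 card_quotient_le(2)[OF enat _ _ _ \<zeta>] refl]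
    \<comment> \<open>Here \<open>M\<close> is \<open>3 * 2 ^ ?N\<close> and \<open>B\<close> is
      \<open>3 powr (n / 2)\<close>. Moving the factor 3 of \<open>M\<close> into the bracket turns
      \<open>B - 1\<close> into \<open>3 powr (n / 2 + 1) - 3\<close>.\<close>
    have "2 ^ ?N * (pow3 (rk / 2 + 1) - 3) = ereal (real (3 * 2 ^ ?N) * (3 powr (n / 2) - 1))"
      unfolding rk by (simp add: pow3_def ereal_two_power powr_add algebra_simps numeral_eq_ereal)
    moreover have "2 ^ (?N + 1) * pow3 (rk / 2 + 1) = ereal (2 * real (3 * 2 ^ ?N) * 3 powr (n / 2))"
      unfolding rk ereal_two_power by (simp add: pow3_def powr_add)
    moreover have "2 ^ ?N * (pow3 (rk / 2 + 2) - 3) = ereal (real (3 * 2 ^ ?N) * (3 * 3 powr (n / 2) - 1))"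
      unfolding rk by (simp add: pow3_def ereal_two_power powr_add algebra_simps numeral_eq_ereal)
    ultimately show ?thesis using b by simp
  next
    case infinity
    then have "rk = \<infinity>" by (simp add: rk_def)
    then show ?thesis by (simp add: pow3_def ereal_two_power)
  qed
  show ?thesis
    unfolding d_def w3_def EI_def using A1 A3 zero bounds1 bounds3 by blast
qed

end
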